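(* Let $\alpha,\beta\in(0,1)$, $T>0$, $a\in(1,2)$, $\theta=1$, and let $g:[0,1]\to[0,1]$ be measurable. For any integer $m\ge1$ there exist constants $M_0<\infty$ and $c>0$, that do not depend on $\kappa$, such that for any $\kappa>0$ $$\mathbb E_{\mathbb Q}\big[\mathcal E^{\alpha,\beta}_{m,\kappa,c}(\rho^\kappa)\big]\le M_0<\infty,$$ where $\rho^\kappa$ is the unique weak solution of the porous medium equation with Robin boundary conditions with parameter $\kappa$ and initial condition $g$, and $\mathbb Q$ is a limit point of the sequence $\{\mathbb Q_n\}_{n\in\mathbb N}$ of laws of the empirical measure process of the porous medium model (with parameters $m,\kappa,\alpha,\beta,a,\theta$, started from measures $\mu_n$ associated with $g$).
   Context: Notation. $\langle\cdot,\cdot\rangle$ is the inner product of $L^2([0,1])$, with norm $\|\cdot\|_2$, and $\langle\langle G,H\rangle\rangle:=\int_0^T\langle G_s,H_s\rangle\,ds$. $\mathcal H^1$ is the set of locally summable $\varphi:(0,1)\to\mathbb R$ with weak derivative $\partial_u\varphi\in L^2([0,1])$, with $\|\varphi\|_{\mathcal H^1}^2=\|\varphi\|_2^2+\|\partial_u\varphi\|_2^2$, extended to $[0,1]$ by $\varphi(0):=\varphi(0^+)$, $\varphi(1):=\varphi(1^-)$. $L^2(0,T;\mathcal H^1)$: measurable $\zeta:[0,T]\to\mathcal H^1$ with $\int_0^T\|\zeta_t\|_{\mathcal H^1}^2dt<\infty$. For $\rho\ge0$ with $\rho^m\in L^2(0,T;\mathcal H^1)$, $\rho_s(0),\rho_s(1)$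 are understood through this extension of $(\rho_s)^m$. $C^{n,p}([0,T]\times[0,1])$: functions $n$ times continuously differentiable in time and $p$ times in space. Weak solution, Robin, $\kappa>0$: $\rho:[0,T]\times[0,1]\to[0,1]$ with $\rho^m\in L^2(0,T;\mathcal H^1)$ and, for all $t\in[0,T]$ and $G\in C^{1,2}([0,T]\times[0,1])$, $$\langle\rho_t,G_t\rangle-\langle g,G_0\rangle-\int_0^t\langle\rho_s,\partial_sG_s+(\rho_s)^{m-1}\partial_u^2G_s\rangle ds+\int_0^t\{(\rho_s)^m(1)\partial_uG_s(1)-(\rho_s)^m(0)\partial_uG_s(0)\}ds-\kappa\int_0^t\{G_s(0)(\alpha-\rho_s(0))+G_s(1)(\beta-\rho_s(1))\}ds=0.$$ Existence and uniqueness is taken as known. Energy functional. $P^\gamma_m(r)=\sum_{i=0}^{m-1}\gamma^{m-1-i}r^i$ for $\gamma\in\{\alpha,\beta\}$, $r\ge0$. For measurable $\xi:[0,T]\times[0,1]\to[0,\infty)$ with $\xi^m\in L^2([0,T]\times[0,1])$ and $s\mapsto\xi_s(0),\xi_s(1)$ measurable and bounded, and for $H\in C^{0,1}([0,T]\times[0,1])$, put $$\langle\langle H,H\rangle\rangle^{\alpha,\beta}_{\kappa,\xi}=\langle\langle H,H\rangle\rangle+\int_0^T\Big\{\frac{P^\alpha_m(\xi_s(0))}{\kappa}H_s^2(0)+\frac{P^\beta_m(\xi_s(1))}{\kappa}H_s^2(1)\Big\}ds,$$ $$\mathcal T^{\alpha,\beta}_{\xi,m}(H)=\langle\langle\xi^m,\partial_uH\rangle\rangle+\int_0^T\{\alpha^mH_s(0)-\beta^mH_s(1)\}ds,\qquad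 \mathcal E^{\alpha,\beta}_{m,\kappa,c}(\xi)=\sup_{H\in C^{0,1}([0,T]\times[0,1])}\big\{\mathcal T^{\alpha,\beta}_{\xi,m}(H)-c\langle\langle H,H\rangle\rangle^{\alpha,\beta}_{\kappa,\xi}\big\}.$$ Particle system. $\Sigma_n=\{1,\dots,n-1\}$, $\Omega_n=\{0,1\}^{\Sigma_n}$. $\eta^{x,y}$ is $\eta$ with the values at $x,y$ exchanged; $\eta^x$ is $\eta$ with the value at $x$ replaced by $1-\eta(x)$. Convention: $\eta(x)=\alpha$ for $x\le0$, $\eta(x)=\beta$ for $x\ge n$. Let $a_{x,y}(\eta)=\eta(x)(1-\eta(y))$, $c^m_{x,x+1}(\eta)=\sum_{k=1}^m\prod_{j=-(m-k),\,j\ne0,1}^{k}\eta(x+j)$ (empty product $=1$), and $I^\gamma_z(\eta)=\gamma(1-\eta(z))+(1-\gamma)\eta(z)$. The generator is $L^m_n=L^m_P+n^{a-2}L_S+L_B$ with $(L^m_Pf)(\eta)=\sum_{x=1}^{n-2}c^m_{x,x+1}(\eta)\{a_{x,x+1}(\eta)+a_{x+1,x}(\eta)\}[f(\eta^{x,x+1})-f(\eta)]$, $(L_Sf)(\eta)=\sum_{x=1}^{n-2}\{a_{x,x+1}(\eta)+a_{x+1,x}(\eta)\}[f(\eta^{x,x+1})-f(\eta)]$, $(L_Bf)(\eta)=\frac{\kappa}{n^\theta}I^\alpha_1(\eta)[f(\eta^1)-f(\eta)]+\frac{\kappa}{n^\theta}I^\beta_{n-1}(\eta)[f(\eta^{n-1})-f(\eta)]$.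 $\{\eta_{tn^2}\}_{t\in[0,T]}$ is the Markov process with generator $n^2L^m_n$ and initial law $\mu_n$, a probability measure on $\Omega_n$. The empirical measure is $\pi^n_t(du)=\frac1n\sum_{x\in\Sigma_n}\eta_{tn^2}(x)\delta_{x/n}(du)$. The $\mu_n$ are associated with $g$: for every continuous $G:[0,1]\to\mathbb R$ and $\delta>0$, $\mu_n\big(|\frac1n\sum_{x\in\Sigma_n}G(\frac xn)\eta(x)-\int_0^1G(u)g(u)du|>\delta\big)\to0$ as $n\to\infty$. $\mathbb Q_n$ is the law of $(\pi^n_t)_{t\in[0,T]}$ on the Skorokhod space $\mathcal D([0,T],\mathcal M_+)$, where $\mathcal M_+$ is the space of positive measures on $[0,1]$ of total mass at most $1$ with the weak topology; limit points are in the sense of weak convergence. It is known that, for $\theta=1$, $\mathbb Q$ is the Dirac mass on the trajectory $\pi_t(du)=\rho^\kappa_t(u)\,du$. *)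

theory Defs
  imports "HOL-Probability.Probability"
begin

section \<open>Function spaces\<close>

definition L2_inner :: "(real \<Rightarrow> real) \<Rightarrow> (real \<Rightarrow> real) \<Rightarrow> real" where
  "L2_inner \<phi> \<psi> = (\<integral>u. \<phi> u * \<psi> u \<partial>lebesgue_on {0..1})"

text \<open>As usual, a function of time and space is curried: \<open>G s u\<close> is $G_s(u)$.\<close>

definition L2_inner_time :: "real \<Rightarrow> (real \<Rightarrow> real \<Rightarrow> real) \<Rightarrow> (real \<Rightarrow> real \<Rightarrow> real) \<Rightarrow> real" where
  "L2_inner_time T G H = (\<integral>s. L2_inner (G s) (H s) \<partial>lebesgue_on {0..T})"

definition is_weak_deriv :: "(real \<Rightarrow> real) \<Rightarrow> (real \<Rightarrow> real) \<Rightarrow> bool" where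
  "is_weak_deriv \<phi> \<psi> \<longleftrightarrow>
     (\<forall>h h' a b. 0 < a \<and> b < 1 \<and> (\<forall>u. u \<notin> {a..b} \<longrightarrow> h u = 0) \<and>
        (\<forall>u. (h has_real_derivative h' u) (at u)) \<and> continuous_on UNIV h' \<longrightarrow>
        (\<integral>u. \<phi> u * h' u \<partial>lebesgue_on {0<..<1}) = - (\<integral>u. \<psi> u * h u \<partial>lebesgue_on {0<..<1}))"

definition square_summable :: "(real \<Rightarrow> real) \<Rightarrow> bool" where
  "square_summable \<psi> \<longleftrightarrow> \<psi> \<in> borel_measurable (lebesgue_on {0..1}) \<and>
     integrable (lebesgue_on {0..1}) (\<lambda>u. (\<psi> u)\<^sup>2)"

definition locally_summable :: "(real \<Rightarrow> real) \<Rightarrow> bool" where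
  "locally_summable \<phi> \<longleftrightarrow> (\<forall>a b. 0 < a \<and> a < b \<and> b < 1 \<longrightarrow> integrable (lebesgue_on {a..b}) \<phi>)"

definition H1 :: "(real \<Rightarrow> real) set" where
  "H1 = {\<phi>. locally_summable \<phi> \<and> (\<exists>\<psi>. square_summable \<psi> \<and> is_weak_deriv \<phi> \<psi>)}"

definition weak_deriv :: "(real \<Rightarrow> real) \<Rightarrow> real \<Rightarrow> real" where
  "weak_deriv \<phi> = (SOME \<psi>. square_summable \<psi> \<and> is_weak_deriv \<phi> \<psi>)"

definition H1_norm :: "(real \<Rightarrow> real) \<Rightarrow> real" where
  "H1_norm \<phi> = sqrt (L2_inner \<phi> \<phi> + L2_inner (weak_deriv \<phi>) (weak_deriv \<phi>))"

text \<open>Elements of $\mathcal H^1$ are identified when they agree almost everywhere; the one-sided limits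
  $\varphi(0^+)$ (filter \<open>at_right 0\<close>) and $\varphi(1^-)$ (filter \<open>at_left 1\<close>) are those of the
  continuous representative.\<close>

definition boundary_value :: "real filter \<Rightarrow> (real \<Rightarrow> real) \<Rightarrow> real" where
  "boundary_value F \<phi> = (THE l. \<exists>v. continuous_on {0<..<1} v \<and>
     (AE u in lebesgue_on {0<..<1}. v u = \<phi> u) \<and> (v \<longlongrightarrow> l) F)"

text \<open>Membership in $L^2(0,T;\mathcal H^1)$. As for every Bochner space, \<open>\<zeta> t\<close> needs to lie in
  $\mathcal H^1$ only for almost every \<open>t\<close>: the weak solution started from a general \<open>g\<close> is not in
  $\mathcal H^1$ at time 0. Since $\mathcal H^1$ is separable, its Borel sets are generated by balls,
  so measurability of \<open>\<zeta>\<close> means that of its distance to every fixed element.\<close>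

definition L2_H1 :: "real \<Rightarrow> (real \<Rightarrow> real \<Rightarrow> real) \<Rightarrow> bool" where
  "L2_H1 T \<zeta> \<longleftrightarrow>
     (AE t in lebesgue_on {0..T}. \<zeta> t \<in> H1) \<and>
     (\<forall>\<phi>\<in>H1. (\<lambda>t. H1_norm (\<lambda>u. \<zeta> t u - \<phi> u)) \<in> borel_measurable (lebesgue_on {0..T})) \<and>
     (\<integral>\<^sup>+t. ennreal ((H1_norm (\<zeta> t))\<^sup>2) \<partial>lebesgue_on {0..T}) < \<infinity>"

text \<open>Classical derivatives, one-sided at the endpoints of the intervals.\<close>

definition time_deriv :: "real \<Rightarrow> (real \<Rightarrow> real \<Rightarrow> real) \<Rightarrow> real \<Rightarrow> real \<Rightarrow> real" where
  "time_deriv T G s u = vector_derivative (\<lambda>r. G r u) (at s within {0..T})"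

definition space_deriv :: "(real \<Rightarrow> real \<Rightarrow> real) \<Rightarrow> real \<Rightarrow> real \<Rightarrow> real" where
  "space_deriv G s u = vector_derivative (G s) (at u within {0..1})"

definition C_time_space :: "nat \<Rightarrow> nat \<Rightarrow> real \<Rightarrow> (real \<Rightarrow> real \<Rightarrow> real) set" where
  "C_time_space n p T = {G.
     (\<forall>i\<le>n. continuous_on ({0..T} \<times> {0..1}) (\<lambda>(s, u). (time_deriv T ^^ i) G s u)) \<and>
     (\<forall>i\<le>p. continuous_on ({0..T} \<times> {0..1}) (\<lambda>(s, u). (space_deriv ^^ i) G s u)) \<and>
     (\<forall>i<n. \<forall>s\<in>{0..T}. \<forall>u\<in>{0..1}.
        (\<lambda>r. (time_deriv T ^^ i) G r u) differentiable at s within {0..T}) \<and>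
     (\<forall>i<p. \<forall>s\<in>{0..T}. \<forall>u\<in>{0..1}.
        (\<lambda>v. (space_deriv ^^ i) G s v) differentiable at u within {0..1})}"


section \<open>The porous medium equation with Robin boundary conditions\<close>

text \<open>\<open>\<rho>\<close> with its values at the two endpoints replaced by those understood through the extension
  of $(\rho_s)^m \in \mathcal H^1$.\<close>

definition extend :: "nat \<Rightarrow> (real \<Rightarrow> real \<Rightarrow> real) \<Rightarrow> real \<Rightarrow> real \<Rightarrow> real" where
  "extend m \<rho> s u =
     (if u = 0 then root m (boundary_value (at_right 0) (\<lambda>v. \<rho> s v ^ m))
      else if u = 1 then root m (boundary_value (at_left 1) (\<lambda>v. \<rho> s v ^ m))
      else \<rho> s u)"

text \<open>Measurability is Lebesgue measurability; the slices \<open>\<rho> t\<close> are mentioned separately because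
  joint Lebesgue measurability gives it for almost every \<open>t\<close> only.\<close>

definition weak_solution_Robin ::
  "real \<Rightarrow> real \<Rightarrow> real \<Rightarrow> nat \<Rightarrow> real \<Rightarrow> (real \<Rightarrow> real) \<Rightarrow> (real \<Rightarrow> real \<Rightarrow> real) \<Rightarrow> bool" where
  "weak_solution_Robin T \<alpha> \<beta> m \<kappa> g \<rho> \<longleftrightarrow>
     (\<forall>t\<in>{0..T}. \<forall>u\<in>{0..1}. \<rho> t u \<in> {0..1}) \<and>
     (\<lambda>(t, u). \<rho> t u) \<in> borel_measurable (lebesgue_on ({0..T} \<times> {0..1})) \<and>
     (\<forall>t\<in>{0..T}. \<rho> t \<in> borel_measurable (lebesgue_on {0..1})) \<and>
     L2_H1 T (\<lambda>t u. \<rho> t u ^ m) \<and>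
     (\<forall>t\<in>{0..T}. \<forall>G\<in>C_time_space 1 2 T.
        L2_inner (\<rho> t) (G t) - L2_inner g (G 0)
        - (\<integral>s. L2_inner (\<rho> s)
                 (\<lambda>u. time_deriv T G s u + \<rho> s u ^ (m - 1) * space_deriv (space_deriv G) s u)
             \<partial>lebesgue_on {0..t})
        + (\<integral>s. (extend m \<rho> s 1) ^ m * space_deriv G s 1 - (extend m \<rho> s 0) ^ m * space_deriv G s 0
             \<partial>lebesgue_on {0..t})
        - \<kappa> * (\<integral>s. G s 0 * (\<alpha> - extend m \<rho> s 0) + G s 1 * (\<beta> - extend m \<rho> s 1)
             \<partial>lebesgue_on {0..t}) = 0)"


section \<open>The energy functional\<close>

definition P_poly :: "nat \<Rightarrow> real \<Rightarrow> real \<Rightarrow> real" where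
  "P_poly m \<gamma> r = (\<Sum>i<m. \<gamma> ^ (m - 1 - i) * r ^ i)"

definition energy_norm ::
  "real \<Rightarrow> real \<Rightarrow> real \<Rightarrow> nat \<Rightarrow> real \<Rightarrow> (real \<Rightarrow> real \<Rightarrow> real) \<Rightarrow> (real \<Rightarrow> real \<Rightarrow> real) \<Rightarrow> real" where
  "energy_norm T \<alpha> \<beta> m \<kappa> \<xi> H = L2_inner_time T H H +
     (\<integral>s. P_poly m \<alpha> (\<xi> s 0) / \<kappa> * (H s 0)\<^sup>2 + P_poly m \<beta> (\<xi> s 1) / \<kappa> * (H s 1)\<^sup>2
        \<partial>lebesgue_on {0..T})"

definition energy_linear ::
  "real \<Rightarrow> real \<Rightarrow> real \<Rightarrow> nat \<Rightarrow> (real \<Rightarrow> real \<Rightarrow> real) \<Rightarrow> (real \<Rightarrow> real \<Rightarrow> real) \<Rightarrow> real" where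
  "energy_linear T \<alpha> \<beta> m \<xi> H = L2_inner_time T (\<lambda>s u. \<xi> s u ^ m) (space_deriv H) +
     (\<integral>s. \<alpha> ^ m * H s 0 - \<beta> ^ m * H s 1 \<partial>lebesgue_on {0..T})"

definition energy ::
  "real \<Rightarrow> real \<Rightarrow> real \<Rightarrow> nat \<Rightarrow> real \<Rightarrow> real \<Rightarrow> (real \<Rightarrow> real \<Rightarrow> real) \<Rightarrow> ereal" where
  "energy T \<alpha> \<beta> m \<kappa> c \<xi> = (SUP H\<in>C_time_space 0 1 T.
     ereal (energy_linear T \<alpha> \<beta> m \<xi> H - c * energy_norm T \<alpha> \<beta> m \<kappa> \<xi> H))"

text \<open>Hence nothing is lost when the energy is read as an \<open>ennreal\<close>.\<close>

lemma energy_nonneg: "0 \<le> energy T \<alpha> \<beta> m \<kappa> c \<xi>"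
proof -
  let ?Z = "\<lambda>(s::real) (u::real). 0::real"
  have d: "space_deriv ?Z s u = 0" if "u \<in> {0..1}" for s u
  proof -
    have "at u within {0..1} \<noteq> bot"
      using that by (simp add: trivial_limit_within islimpt_Icc)
    then show ?thesis
      unfolding space_deriv_def by (rule vector_derivative_within) (rule has_vector_derivative_const)
  qed
  have "continuous_on ({0..T} \<times> {0..1}) (\<lambda>(s, u). space_deriv ?Z s u)"
    by (rule continuous_on_eq[where f = "\<lambda>_. 0"]) (auto simp: d)
  then have Z: "?Z \<in> C_time_space 0 1 T"
    by (auto simp: C_time_space_def le_Suc_eq case_prod_unfold)
  have "L2_inner_time T (\<lambda>s u. \<xi> s u ^ m) (space_deriv ?Z) = 0"
  proof -
    have "L2_inner (\<lambda>u. \<xi> s u ^ m) (space_deriv ?Z s) = 0" for s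
      unfolding L2_inner_def
      by (subst Bochner_Integration.integral_cong[OF refl, where g = "\<lambda>_. 0"]) (auto simp: d)
    then show ?thesis by (simp add: L2_inner_time_def)
  qed
  then have "energy_linear T \<alpha> \<beta> m \<xi> ?Z - c * energy_norm T \<alpha> \<beta> m \<kappa> \<xi> ?Z = 0"
    by (simp add: energy_linear_def energy_norm_def L2_inner_time_def L2_inner_def)
  then show ?thesis
    unfolding energy_def using Z by (intro SUP_upper2[where i = ?Z]) auto
qed


section \<open>The particle system\<close>

type_synonym config = "int \<Rightarrow> real"

definition sites :: "nat \<Rightarrow> int set" where
  "sites n = {1..int n - 1}"

definition configs :: "nat \<Rightarrow> config set" where
  "configs n = sites n \<rightarrow>\<^sub>E {0, 1}"

definition occ :: "real \<Rightarrow> real \<Rightarrow> nat \<Rightarrow> config \<Rightarrow> config" where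
  "occ \<alpha> \<beta> n \<eta> x = (if x \<le> 0 then \<alpha> else if x \<ge> int n then \<beta> else \<eta> x)"

definition exchange :: "int \<Rightarrow> int \<Rightarrow> config \<Rightarrow> config" where
  "exchange x y \<eta> = \<eta>(x := \<eta> y, y := \<eta> x)"

definition flip :: "int \<Rightarrow> config \<Rightarrow> config" where
  "flip x \<eta> = \<eta>(x := 1 - \<eta> x)"

definition jump_rate :: "int \<Rightarrow> int \<Rightarrow> config \<Rightarrow> real" where
  "jump_rate x y \<eta> = \<eta> x * (1 - \<eta> y)"

definition constraint :: "real \<Rightarrow> real \<Rightarrow> nat \<Rightarrow> nat \<Rightarrow> int \<Rightarrow> config \<Rightarrow> real" where
  "constraint \<alpha> \<beta> m n x \<eta> =
     (\<Sum>k=1..int m. \<Prod>j\<in>{- (int m - k)..k} - {0, 1}. occ \<alpha> \<beta> n \<eta> (x + j))"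

definition reservoir_rate :: "real \<Rightarrow> int \<Rightarrow> config \<Rightarrow> real" where
  "reservoir_rate \<gamma> z \<eta> = \<gamma> * (1 - \<eta> z) + (1 - \<gamma>) * \<eta> z"

definition L_P :: "real \<Rightarrow> real \<Rightarrow> nat \<Rightarrow> nat \<Rightarrow> (config \<Rightarrow> real) \<Rightarrow> config \<Rightarrow> real" where
  "L_P \<alpha> \<beta> m n f \<eta> = (\<Sum>x=1..int n - 2. constraint \<alpha> \<beta> m n x \<eta> *
     (jump_rate x (x + 1) \<eta> + jump_rate (x + 1) x \<eta>) * (f (exchange x (x + 1) \<eta>) - f \<eta>))"

definition L_S :: "nat \<Rightarrow> (config \<Rightarrow> real) \<Rightarrow> config \<Rightarrow> real" where
  "L_S n f \<eta> = (\<Sum>x=1..int n - 2.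
     (jump_rate x (x + 1) \<eta> + jump_rate (x + 1) x \<eta>) * (f (exchange x (x + 1) \<eta>) - f \<eta>))"

definition L_B :: "real \<Rightarrow> real \<Rightarrow> real \<Rightarrow> real \<Rightarrow> nat \<Rightarrow> (config \<Rightarrow> real) \<Rightarrow> config \<Rightarrow> real" where
  "L_B \<alpha> \<beta> \<kappa> \<theta> n f \<eta> =
     \<kappa> / real n powr \<theta> * reservoir_rate \<alpha> 1 \<eta> * (f (flip 1 \<eta>) - f \<eta>) +
     \<kappa> / real n powr \<theta> * reservoir_rate \<beta> (int n - 1) \<eta> * (f (flip (int n - 1) \<eta>) - f \<eta>)"

definition generator ::
  "real \<Rightarrow> real \<Rightarrow> real \<Rightarrow> real \<Rightarrow> real \<Rightarrow> nat \<Rightarrow> nat \<Rightarrow> (config \<Rightarrow> real) \<Rightarrow> config \<Rightarrow> real" where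
  "generator \<alpha> \<beta> \<kappa> a \<theta> m n f \<eta> =
     L_P \<alpha> \<beta> m n f \<eta> + real n powr (a - 2) * L_S n f \<eta> + L_B \<alpha> \<beta> \<kappa> \<theta> n f \<eta>"


section \<open>Trajectories and Markov processes\<close>

definition cadlag_paths :: "real \<Rightarrow> 'a topology \<Rightarrow> (real \<Rightarrow> 'a) set" where
  "cadlag_paths T X = {\<omega> \<in> {0..T} \<rightarrow>\<^sub>E topspace X.
     (\<forall>t\<in>{0..<T}. limitin X \<omega> (\<omega> t) (at_right t)) \<and>
     (\<forall>t\<in>{0<..T}. \<exists>l. limitin X \<omega> l (at_left t))}"

text \<open>The semigroup $e^{tA}$; the series converges when \<open>A\<close> is the generator of a chain on a finite
  state space.\<close>

definition semigroup :: "(('s \<Rightarrow> real) \<Rightarrow> 's \<Rightarrow> real) \<Rightarrow> real \<Rightarrow> ('s \<Rightarrow> real) \<Rightarrow> 's \<Rightarrow> real" where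
  "semigroup A t f \<eta> = (\<Sum>k. t ^ k / fact k * (A ^^ k) f \<eta>)"

text \<open>\<open>P\<close> is the law, on the space of cadlag trajectories with the sigma-algebra generated by the
  coordinates, of the Markov process on \<open>[0,T]\<close> with finite state space \<open>S\<close>, generator \<open>A\<close> and
  initial law \<open>\<mu>\<close>.\<close>

definition markov_law ::
  "real \<Rightarrow> 's set \<Rightarrow> (('s \<Rightarrow> real) \<Rightarrow> 's \<Rightarrow> real) \<Rightarrow> 's pmf \<Rightarrow> (real \<Rightarrow> 's) measure \<Rightarrow> bool" where
  "markov_law T S A \<mu> P \<longleftrightarrow>
     prob_space P \<and>
     sets P = sets (restrict_space (Pi\<^sub>M {0..T} (\<lambda>_. count_space S))
                      (cadlag_paths T (discrete_topology S))) \<and>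
     (\<forall>(k::nat) t \<eta>. t 0 = 0 \<and> (\<forall>i<k. t i \<le> t (Suc i)) \<and> t k \<le> T \<and> (\<forall>i\<le>k. \<eta> i \<in> S) \<longrightarrow>
        measure P {\<omega> \<in> space P. \<forall>i\<le>k. \<omega> (t i) = \<eta> i} =
        pmf \<mu> (\<eta> 0) * (\<Prod>i<k. semigroup A (t (Suc i) - t i) (indicator {\<eta> (Suc i)}) (\<eta> i)))"


section \<open>Measure-valued trajectories and weak convergence of their laws\<close>

abbreviation borel_unit :: "real measure" where
  "borel_unit \<equiv> restrict_space borel {0..1}"

definition M_plus :: "real measure set" where
  "M_plus = {\<nu>. sets \<nu> = sets borel_unit \<and> emeasure \<nu> (space \<nu>) \<le> 1}"

definition C_unit :: "(real \<Rightarrow> real) set" where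
  "C_unit = {f. continuous_on {0..1} f}"

definition weak_topology :: "real measure topology" where
  "weak_topology = pullback_topology M_plus (\<lambda>\<nu>. \<lambda>f\<in>C_unit. \<integral>u. f u \<partial>\<nu>)
     (product_topology (\<lambda>_. euclideanreal) C_unit)"

text \<open>The Skorokhod J1 topology. The compact Hausdorff space \<open>M_plus\<close> has a unique uniformity, and it is
  generated by the pseudometrics \<open>\<lambda>\<mu> \<nu>. \<bar>\<integral>f d\<mu> - \<integral>f d\<nu>\<bar>\<close> for continuous \<open>f\<close>; so no metric for
  the weak topology needs to be chosen.\<close>

definition skorokhod_nhd ::
  "real \<Rightarrow> (real \<Rightarrow> real measure) \<Rightarrow> (real \<Rightarrow> real) set \<Rightarrow> real \<Rightarrow> (real \<Rightarrow> real measure) set" where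
  "skorokhod_nhd T \<pi> F \<epsilon> = {\<sigma> \<in> cadlag_paths T weak_topology.
     \<exists>\<tau>. strict_mono_on {0..T} \<tau> \<and> \<tau> ` {0..T} = {0..T} \<and>
       (\<forall>t\<in>{0..T}. \<bar>\<tau> t - t\<bar> < \<epsilon> \<and>
          (\<forall>f\<in>F. \<bar>(\<integral>u. f u \<partial>\<sigma> (\<tau> t)) - (\<integral>u. f u \<partial>\<pi> t)\<bar> < \<epsilon>))}"

definition skorokhod_open :: "real \<Rightarrow> (real \<Rightarrow> real measure) set \<Rightarrow> bool" where
  "skorokhod_open T U \<longleftrightarrow> U \<subseteq> cadlag_paths T weak_topology \<and>
     (\<forall>\<pi>\<in>U. \<exists>F \<epsilon>. finite F \<and> F \<subseteq> C_unit \<and> 0 < \<epsilon> \<and> skorokhod_nhd T \<pi> F \<epsilon> \<subseteq> U)"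

definition skorokhod_topology :: "real \<Rightarrow> (real \<Rightarrow> real measure) topology" where
  "skorokhod_topology T = topology (skorokhod_open T)"

lemma istopology_skorokhod_open: "istopology (skorokhod_open T)"
  unfolding istopology_def
proof (intro conjI allI impI)
  fix U V assume U: "skorokhod_open T U" and V: "skorokhod_open T V"
  show "skorokhod_open T (U \<inter> V)"
    unfolding skorokhod_open_def
  proof (intro conjI ballI)
    show "U \<inter> V \<subseteq> cadlag_paths T weak_topology"
      using U by (auto simp: skorokhod_open_def)
  next
    fix \<pi> assume "\<pi> \<in> U \<inter> V"
    then obtain F \<epsilon> G \<delta> where
      F: "finite F" "F \<subseteq> C_unit" "0 < \<epsilon>" "skorokhod_nhd T \<pi> F \<epsilon> \<subseteq> U" and
      G: "finite G" "G \<subseteq> C_unit" "0 < \<delta>" "skorokhod_nhd T \<pi> G \<delta> \<subseteq> V"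
      using U V unfolding skorokhod_open_def by (meson IntD1 IntD2)
    have "skorokhod_nhd T \<pi> (F \<union> G) (min \<epsilon> \<delta>) \<subseteq> skorokhod_nhd T \<pi> F \<epsilon>"
      "skorokhod_nhd T \<pi> (F \<union> G) (min \<epsilon> \<delta>) \<subseteq> skorokhod_nhd T \<pi> G \<delta>"
      unfolding skorokhod_nhd_def by fastforce+
    with F G have "finite (F \<union> G) \<and> F \<union> G \<subseteq> C_unit \<and> 0 < min \<epsilon> \<delta> \<and>
        skorokhod_nhd T \<pi> (F \<union> G) (min \<epsilon> \<delta>) \<subseteq> U \<inter> V"
      by auto
    then show "\<exists>F \<epsilon>. finite F \<and> F \<subseteq> C_unit \<and> 0 < \<epsilon> \<and> skorokhod_nhd T \<pi> F \<epsilon> \<subseteq> U \<inter> V"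
      by blast
  qed
next
  fix K assume "\<forall>U\<in>K. skorokhod_open T U"
  then show "skorokhod_open T (\<Union>K)"
    unfolding skorokhod_open_def by (meson Sup_least UnionE Union_upper order_trans)
qed

lemma openin_skorokhod: "openin (skorokhod_topology T) U \<longleftrightarrow> skorokhod_open T U"
  by (simp add: skorokhod_topology_def istopology_skorokhod_open topology_inverse')

lemma topspace_skorokhod: "topspace (skorokhod_topology T) = cadlag_paths T weak_topology"
proof -
  have "skorokhod_open T (cadlag_paths T weak_topology)"
    unfolding skorokhod_open_def skorokhod_nhd_def
    by (intro conjI subset_refl ballI exI[of _ "{}"] exI[of _ 1]) auto
  moreover have "U \<subseteq> cadlag_paths T weak_topology" if "skorokhod_open T U" for U
    using that by (simp add: skorokhod_open_def)
  ultimately show ?thesis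
    unfolding topspace_def openin_skorokhod by blast
qed

definition borel_of_topology :: "'a topology \<Rightarrow> 'a measure" where
  "borel_of_topology X = sigma (topspace X) {U. openin X U}"

definition weak_conv_laws :: "'a topology \<Rightarrow> (nat \<Rightarrow> 'a measure) \<Rightarrow> 'a measure \<Rightarrow> bool" where
  "weak_conv_laws X Qs Q \<longleftrightarrow>
     (\<forall>f. continuous_map X euclideanreal f \<and> bounded (f ` topspace X) \<longrightarrow>
        (\<lambda>n. \<integral>\<omega>. f \<omega> \<partial>Qs n) \<longlonglongrightarrow> (\<integral>\<omega>. f \<omega> \<partial>Q))"

text \<open>The weak topology on the laws on a Polish space is metrizable, so limit points of a sequence are the limits of
  its subsequences.\<close>

definition limit_point_laws :: "'a topology \<Rightarrow> (nat \<Rightarrow> 'a measure) \<Rightarrow> 'a measure \<Rightarrow> bool" where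
  "limit_point_laws X Qs Q \<longleftrightarrow>
     prob_space Q \<and> sets Q = sets (borel_of_topology X) \<and>
     (\<exists>r. strict_mono (r :: nat \<Rightarrow> nat) \<and> weak_conv_laws X (Qs \<circ> r) Q)"


section \<open>The empirical measure\<close>

definition empirical_measure :: "nat \<Rightarrow> config \<Rightarrow> real measure" where
  "empirical_measure n \<eta> =
     distr (point_measure (sites n) (\<lambda>x. ennreal (\<eta> x / real n))) borel_unit (\<lambda>x. of_int x / real n)"

definition empirical_law :: "real \<Rightarrow> nat \<Rightarrow> (real \<Rightarrow> config) measure \<Rightarrow> (real \<Rightarrow> real measure) measure" where
  "empirical_law T n P = distr P (borel_of_topology (skorokhod_topology T))
     (\<lambda>\<omega>. \<lambda>t\<in>{0..T}. empirical_measure n (\<omega> t))"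

definition associated :: "(nat \<Rightarrow> config pmf) \<Rightarrow> (real \<Rightarrow> real) \<Rightarrow> bool" where
  "associated \<mu> g \<longleftrightarrow>
     (\<forall>G \<delta>. continuous_on {0..1} G \<and> 0 < \<delta> \<longrightarrow>
        (\<lambda>n. measure_pmf.prob (\<mu> n)
           {\<eta>. \<bar>(1 / real n) * (\<Sum>x\<in>sites n. G (of_int x / real n) * \<eta> x) - L2_inner G g\<bar> > \<delta>})
        \<longlonglongrightarrow> 0)"

end

theory Submission
  imports Defs
begin

text \<open>The integrand does not depend on the trajectory \<open>\<pi>\<close>, so its expectation under the probability measure
\<open>Q\<close> is the energy of \<open>\<rho>\<close> itself, and the claim is an a priori estimate, uniform in \<open>\<kappa>\<close>, for weak
solutions of \<open>\<partial>\<^sub>t \<rho> = \<partial>\<^sub>u\<^sup>2 (\<rho>\<^sup>m)\<close> with fluxes \<open>\<partial>\<^sub>u \<rho>\<^sup>m(0) = \<kappa> (\<rho>(0) - \<alpha>)\<close> and \<open>\<partial>\<^sub>u \<rho>\<^sup>m(1) = \<kappa> (\<beta> - \<rho>(1))\<close>.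

Write \<open>w = \<rho>\<^sup>m\<close>, \<open>A = \<alpha>\<^sup>m\<close>, \<open>B = \<beta>\<^sup>m\<close> and let \<open>L\<close> be the affine function with \<open>L(0) = A\<close>, \<open>L(1) = B\<close>. Testing
the equation with \<open>w - L\<close> gives, for \<open>\<Psi> = \<integral> \<rho>\<^sup>m\<^sup>+\<^sup>1 / (m + 1) - L \<rho>\<close>,
\<open>\<Psi>' + \<integral> (\<partial>\<^sub>u w)\<^sup>2 + \<kappa> (w(0) - A) (\<rho>(0) - \<alpha>) + \<kappa> (w(1) - B) (\<rho>(1) - \<beta>) = (B - A) (w(1) - w(0))\<close>.
Since \<open>\<Psi>\<close> and \<open>w\<close> are bounded, the dissipation \<open>D\<close> (the time integral of the second, third and fourth
terms) is bounded by a constant that involves \<open>T\<close> only. On the other hand an integration by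
parts turns the linear part of the energy into
\<open>\<integral>\<integral> - H \<partial>\<^sub>u w - \<integral> (w(0) - A) H(0) + \<integral> (w(1) - B) H(1)\<close>. Because \<open>w(0) - A = P (\<rho>(0) - \<alpha>)\<close> with
\<open>P = P\<^sub>m\<^sup>\<alpha>(\<rho>(0))\<close>, and likewise at \<open>1\<close>, Young's inequality bounds this by \<open>D\<close> plus a quarter of the
quadratic part; the weights \<open>P / \<kappa>\<close> of the quadratic part are exactly those for which \<open>\<kappa>\<close> cancels.

The function \<open>w - L\<close> is not smooth, so the computation is carried out for regularizations.
In space, \<open>w\<close> is replaced by its Fejer means in the cosine basis: cosines satisfy the Neumann condition,
so no boundary value of \<open>w\<close> is produced when the equation is tested, and the Dirichlet form becomes
a finite sum of products of cosine coefficients with nonnegative weights. The means are positive operators, which keeps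
them between \<open>0\<close> and \<open>1\<close> and makes them converge at the end points too, once it is known that
elements of \<open>H\<^sup>1\<close> have a continuous representative (\<open>H1_continuous_representative\<close>).
In time, increments \<open>\<rho>\<^sub>t - \<rho>\<^sub>r\<close> are paired with \<open>w\<^sub>t\<close> and averaged over the triangle
\<open>r \<le> s \<le> t \<le> r + h\<close>. There the Dirichlet form symmetrizes to half the Dirichlet form of the time average
of \<open>w\<close>, a square (\<open>dirichlet_sum_eq\<close>), while convexity of \<open>x\<^sup>m\<^sup>+\<^sup>1\<close> gives
\<open>\<integral> (\<rho>\<^sub>t - \<rho>\<^sub>r) (w\<^sub>t - L) \<ge> \<Psi>\<^sub>t - \<Psi>\<^sub>r\<close> (\<open>\<Psi>_convexity\<close>). Letting the
number of modes tend to infinity for fixed \<open>r\<close> and \<open>h\<close> yields \<open>energy_step\<close>; integrating over \<open>r\<close> and letting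
\<open>h \<rightarrow> 0\<close>, where \<open>triangle_mean_tendsto\<close> identifies the boundary terms, yields \<open>energy_inequality\<close>.\<close>

section \<open>Bounded measurable functions on intervals\<close>

text \<open>All time and space averages below are integrals of bounded Lebesgue measurable functions over compact
intervals. For these the Lebesgue and the gauge integral agree, so the calculus of the latter
(additivity over adjacent intervals, primitives) and the convergence theorems of the former are both at hand.\<close>

definition bmeas :: "real set \<Rightarrow> (real \<Rightarrow> real) \<Rightarrow> bool" where
  "bmeas S f \<longleftrightarrow> f \<in> borel_measurable (lebesgue_on S) \<and> (\<exists>B. \<forall>x\<in>S. \<bar>f x\<bar> \<le> B)"

lemma bmeasI: "f \<in> borel_measurable (lebesgue_on S) \<Longrightarrow> (\<And>x. x \<in> S \<Longrightarrow> \<bar>f x\<bar> \<le> B) \<Longrightarrow> bmeas S f"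
  by (auto simp: bmeas_def)

lemma bmeas_measurable: "bmeas S f \<Longrightarrow> f \<in> borel_measurable (lebesgue_on S)"
  by (simp add: bmeas_def)

lemma bmeas_bound:
  assumes "bmeas S f" obtains B where "B > 0" "\<And>x. x \<in> S \<Longrightarrow> \<bar>f x\<bar> \<le> B"
proof -
  obtain B where "\<forall>x\<in>S. \<bar>f x\<bar> \<le> B" using assms by (auto simp: bmeas_def)
  then show thesis using that[of "max B 1"] by force
qed

lemma bmeas_continuous: "continuous_on {a..b} f \<Longrightarrow> bmeas {a..b} f"
proof -
  assume c: "continuous_on {a..b} f"
  have "bounded (f ` {a..b})"
    using c compact_continuous_image compact_imp_bounded by blast
  then obtain B where "\<forall>x\<in>{a..b}. norm (f x) \<le> B"
    by (auto simp: bounded_iff)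
  then show "bmeas {a..b} f"
    using c by (intro bmeasI[of _ _ B] continuous_imp_measurable_on_sets_lebesgue) auto
qed

lemma bmeas_const: "bmeas S (\<lambda>_. c)"
  by (rule bmeasI[of _ _ "\<bar>c\<bar>"]) auto

lemma bmeas_add: assumes "bmeas S f" "bmeas S g" shows "bmeas S (\<lambda>x. f x + g x)"
proof -
  obtain A B where "\<forall>x\<in>S. \<bar>f x\<bar> \<le> A" "\<forall>x\<in>S. \<bar>g x\<bar> \<le> B" using assms by (auto simp: bmeas_def)
  then show ?thesis using assms[THEN bmeas_measurable]
    by (intro bmeasI[of _ _ "A + B"]) (auto intro: order.trans[OF abs_triangle_ineq add_mono])
qed

lemma bmeas_mult: assumes "bmeas S f" "bmeas S g" shows "bmeas S (\<lambda>x. f x * g x)"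
proof -
  obtain A where A: "A > 0" "\<And>x. x \<in> S \<Longrightarrow> \<bar>f x\<bar> \<le> A" using bmeas_bound[OF assms(1)] by blast
  obtain B where B: "B > 0" "\<And>x. x \<in> S \<Longrightarrow> \<bar>g x\<bar> \<le> B" using bmeas_bound[OF assms(2)] by blast
  show ?thesis using assms[THEN bmeas_measurable] A B
    by (intro bmeasI[of _ _ "A * B"]) (auto simp: abs_mult intro!: mult_mono)
qed

lemma bmeas_uminus: "bmeas S f \<Longrightarrow> bmeas S (\<lambda>x. - f x)"
  using bmeas_mult[OF bmeas_const[of S "-1"]] by simp

lemma bmeas_diff: "bmeas S f \<Longrightarrow> bmeas S g \<Longrightarrow> bmeas S (\<lambda>x. f x - g x)"
  using bmeas_add[OF _ bmeas_uminus] by simp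

lemma bmeas_abs: assumes "bmeas S f" shows "bmeas S (\<lambda>x. \<bar>f x\<bar>)"
  using assms by (auto simp: bmeas_def)

lemma bmeas_power: "bmeas S f \<Longrightarrow> bmeas S (\<lambda>x. f x ^ n)"
  by (induction n) (auto intro: bmeas_const bmeas_mult)

lemma bmeas_sum: "(\<And>i. i \<in> I \<Longrightarrow> bmeas S (f i)) \<Longrightarrow> bmeas S (\<lambda>x. \<Sum>i\<in>I. f i x)"
  by (induction I rule: infinite_finite_induct) (auto intro: bmeas_const bmeas_add)

lemma bmeas_divide_const: "bmeas S f \<Longrightarrow> bmeas S (\<lambda>x. f x / c)"
  using bmeas_mult[OF _ bmeas_const[of S "inverse c"]] by (simp add: field_class.field_divide_inverse)

lemma bmeas_subset: "bmeas S f \<Longrightarrow> S' \<subseteq> S \<Longrightarrow> bmeas S' f"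
  by (auto simp: bmeas_def intro: measurable_restrict_mono)

lemmas bmeas_intros = bmeas_const bmeas_add bmeas_mult bmeas_uminus bmeas_diff bmeas_abs
  bmeas_power bmeas_sum bmeas_divide_const

lemma bmeas_cong: "bmeas S f \<Longrightarrow> (\<And>x. x \<in> S \<Longrightarrow> f x = g x) \<Longrightarrow> bmeas S g"
  unfolding bmeas_def
  using measurable_cong[of "lebesgue_on S" f g borel] by auto

lemma bmeas_lebesgue_integrable:
  assumes "bmeas {a..b} f" shows "integrable (lebesgue_on {a..b}) f"
proof -
  obtain B where "\<And>x. x \<in> {a..b} \<Longrightarrow> \<bar>f x\<bar> \<le> B" using bmeas_bound[OF assms] by blast
  then show ?thesis using bmeas_measurable[OF assms]
    by (intro finite_measure.integrable_const_bound[where B = B] finite_measure_lebesgue_on) auto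
qed

lemma bmeas_integrable: "bmeas {a..b} f \<Longrightarrow> f integrable_on {a..b}"
  using bmeas_lebesgue_integrable[of a b f]
  by (simp add: integrable_on_lebesgue_on)

lemma bmeas_integral_eq: "bmeas {a..b} f \<Longrightarrow> integral\<^sup>L (lebesgue_on {a..b}) f = integral {a..b} f"
  by (simp add: bmeas_lebesgue_integrable lebesgue_integral_eq_integral)

lemma bmeas_integral_mono_AE:
  assumes "bmeas {a..b} f" "bmeas {a..b} g" "AE x in lebesgue_on {a..b}. f x \<le> g x"
  shows "integral {a..b} f \<le> integral {a..b} g"
  using assms by (auto simp flip: bmeas_integral_eq intro!: integral_mono_AE bmeas_lebesgue_integrable)

lemma bmeas_integral_abs_le:
  assumes "bmeas {a..b} f" "a \<le> b" "\<And>x. x \<in> {a..b} \<Longrightarrow> \<bar>f x\<bar> \<le> B"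
  shows "\<bar>integral {a..b} f\<bar> \<le> B * (b - a)"
proof -
  have "\<bar>integral {a..b} f\<bar> \<le> integral {a..b} (\<lambda>_. B)"
    using assms integral_norm_bound_integral[of f "{a..b}" "\<lambda>_. B"] bmeas_integrable by auto
  then show ?thesis using assms(2) by (simp add: mult.commute)
qed

lemma bmeas_abs_integral_le:
  assumes "bmeas {a..b} f"
  shows "\<bar>integral {a..b} f\<bar> \<le> integral {a..b} (\<lambda>x. \<bar>f x\<bar>)"
  using integral_norm_bound_integral[of f "{a..b}" "\<lambda>x. \<bar>f x\<bar>"] assms bmeas_integrable bmeas_abs by auto

lemma bmeas_tendsto_integral:
  assumes fn: "\<And>n. bmeas {a..b} (f n)" and f: "bmeas {a..b} g"
    and lim: "AE x in lebesgue_on {a..b}. (\<lambda>n. f n x) \<longlonglongrightarrow> g x"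
    and B: "\<And>n. AE x in lebesgue_on {a..b}. \<bar>f n x\<bar> \<le> B"
  shows "(\<lambda>n. integral {a..b} (f n)) \<longlonglongrightarrow> integral {a..b} g"
proof -
  have "(\<lambda>n. integral\<^sup>L (lebesgue_on {a..b}) (f n)) \<longlonglongrightarrow> integral\<^sup>L (lebesgue_on {a..b}) g"
    by (rule integral_dominated_convergence[where w = "\<lambda>_. B"])
       (use assms in \<open>auto intro!: bmeas_measurable bmeas_lebesgue_integrable bmeas_const\<close>)
  then show ?thesis using fn f by (simp add: bmeas_integral_eq)
qed

text \<open>Lebesgue measure is complete, so the limit needs to exist only almost everywhere.\<close>

lemma bmeas_limit_AE:
  assumes fn: "\<And>n. f n \<in> borel_measurable (lebesgue_on S)" and S: "S \<in> sets lebesgue"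
    and lim: "AE x in lebesgue_on S. (\<lambda>n. f n x) \<longlonglongrightarrow> g x"
  shows "(g :: real \<Rightarrow> real) \<in> borel_measurable (lebesgue_on S)"
proof -
  have m: "(\<lambda>x. if x \<in> S then f n x else 0) \<in> borel_measurable lebesgue" for n
    using fn S borel_measurable_if by blast
  have "(\<lambda>x. lim (\<lambda>n. if x \<in> S then f n x else 0)) \<in> borel_measurable lebesgue"
    using m by (rule borel_measurable_lim_metric)
  moreover have "AE x in lebesgue. lim (\<lambda>n. if x \<in> S then f n x else 0) = (if x \<in> S then g x else 0)"
    using lim S by (auto simp: AE_restrict_space_iff limI elim!: AE_mp)
  ultimately have "(\<lambda>x. if x \<in> S then g x else 0) \<in> borel_measurable lebesgue"
    by (rule borel_measurable_AE)
  then show ?thesis using S borel_measurable_if by blast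
qed

text \<open>Joint Lebesgue measurability is weaker than measurability for the product of the
Lebesgue sigma-algebras, so Fubini's theorem applies only after passing to a Borel function that agrees
with \<open>F\<close> almost everywhere; on almost every slice the integrals then coincide.\<close>

lemma slice_integral_measurable:
  fixes F :: "real \<Rightarrow> real \<Rightarrow> real"
  assumes F: "(\<lambda>(t, u). F t u) \<in> borel_measurable (lebesgue_on ({a..b} \<times> {c..d}))"
    and slice: "\<And>t. t \<in> {a..b} \<Longrightarrow> F t \<in> borel_measurable (lebesgue_on {c..d})"
  shows "(\<lambda>t. \<integral>u. F t u \<partial>lebesgue_on {c..d}) \<in> borel_measurable (lebesgue_on {a..b})"
proof -
  define F0 where "F0 = (\<lambda>z. if z \<in> {a..b} \<times> {c..d} then (\<lambda>(t, u). F t u) z else 0)"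
  have box: "{a..b} \<times> {c..d} = cbox (a, c) (b, d)"
    by (auto simp: cbox_Pair_iff)
  have "F0 \<in> borel_measurable lebesgue"
    using F unfolding F0_def by (subst borel_measurable_if) (auto simp: box)
  then obtain F' where F': "F' \<in> borel_measurable lborel" and ae: "AE z in lborel. F0 z = F' z"
    using completion_ex_borel_measurable_real by blast
  have ae2: "AE t in lborel. AE u in lborel. F0 (t, u) = F' (t, u)"
    using lborel_pair.AE_pair[of "\<lambda>z. F0 z = F' z", unfolded lborel_prod, OF ae] .
  have F'p: "(\<lambda>(t, u). F' (t, u)) \<in> borel_measurable (lborel \<Otimes>\<^sub>M lborel)"
    using F' by (simp add: lborel_prod)
  have "(\<lambda>t. \<integral>u. F' (t, u) \<partial>lborel) \<in> borel_measurable lborel"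
    by (rule lborel.borel_measurable_lebesgue_integral[OF F'p])
  then have m: "(\<lambda>t. \<integral>u. F' (t, u) \<partial>lborel) \<in> borel_measurable lebesgue"
    by (rule measurable_completion)
  have "AE t in lborel. (\<integral>u. F' (t, u) \<partial>lborel) =
      (if t \<in> {a..b} then \<integral>u. F t u \<partial>lebesgue_on {c..d} else 0)"
    using ae2
  proof (rule AE_mp, intro AE_I2 impI)
    fix t assume t: "AE u in lborel. F0 (t, u) = F' (t, u)"
    have F't: "(\<lambda>u. F' (t, u)) \<in> borel_measurable lborel"
      using F' measurable_Pair2 by (simp add: lborel_prod[symmetric])
    have eq: "F0 (t, u) = (if t \<in> {a..b} then indicator {c..d} u *\<^sub>R F t u else 0)" for u
      by (auto simp: F0_def indicator_def)
    have F0t: "(\<lambda>u. F0 (t, u)) \<in> borel_measurable lebesgue"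
    proof (cases "t \<in> {a..b}")
      case True
      have "(\<lambda>u. if u \<in> {c..d} then F t u else 0) \<in> borel_measurable lebesgue"
        using slice[OF True] by (subst borel_measurable_if) auto
      then show ?thesis using True by (simp add: F0_def cong: if_cong)
    next
      case False
      then have "(\<lambda>u. F0 (t, u)) = (\<lambda>_. 0)" by (auto simp: F0_def fun_eq_iff)
      then show ?thesis by simp
    qed
    have "(\<integral>u. F' (t, u) \<partial>lborel) = (\<integral>u. F' (t, u) \<partial>lebesgue)"
      using F't by (simp add: integral_completion)
    also have "\<dots> = (\<integral>u. F0 (t, u) \<partial>lebesgue)"
      using AE_completion[OF t] F0t measurable_completion[OF F't] by (intro integral_cong_AE) auto
    also have "\<dots> = (if t \<in> {a..b} then \<integral>u. F t u \<partial>lebesgue_on {c..d} else 0)"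
    proof (cases "t \<in> {a..b}")
      case True
      then show ?thesis by (simp add: eq integral_restrict_space del: real_scaleR_def)
    next
      case False
      then show ?thesis by (simp only: eq False if_False) simp
    qed
    finally show "(\<integral>u. F' (t, u) \<partial>lborel) =
      (if t \<in> {a..b} then \<integral>u. F t u \<partial>lebesgue_on {c..d} else 0)" .
  qed
  then have "AE t in lebesgue. (\<integral>u. F' (t, u) \<partial>lborel) =
      (if t \<in> {a..b} then \<integral>u. F t u \<partial>lebesgue_on {c..d} else 0)"
    by (rule AE_completion)
  with m have "(\<lambda>t. if t \<in> {a..b} then \<integral>u. F t u \<partial>lebesgue_on {c..d} else 0) \<in> borel_measurable lebesgue"
    by (rule borel_measurable_AE)
  then show ?thesis by (subst (asm) borel_measurable_if) auto
qed

lemma bmeas_slice_integral: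
  fixes F :: "real \<Rightarrow> real \<Rightarrow> real"
  assumes F: "(\<lambda>(t, u). F t u) \<in> borel_measurable (lebesgue_on ({a..b} \<times> {c..d}))"
    and slice: "\<And>t. t \<in> {a..b} \<Longrightarrow> F t \<in> borel_measurable (lebesgue_on {c..d})"
    and B: "\<And>t u. t \<in> {a..b} \<Longrightarrow> u \<in> {c..d} \<Longrightarrow> \<bar>F t u\<bar> \<le> B" and cd: "c \<le> d"
  shows "bmeas {a..b} (\<lambda>t. integral {c..d} (F t))"
proof -
  have b: "bmeas {c..d} (F t)" if "t \<in> {a..b}" for t
    using slice[OF that] B[OF that] by (rule bmeasI)
  have "bmeas {a..b} (\<lambda>t. \<integral>u. F t u \<partial>lebesgue_on {c..d})"
    using slice_integral_measurable[OF F slice]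
  proof (rule bmeasI)
    fix t assume t: "t \<in> {a..b}"
    then show "\<bar>\<integral>u. F t u \<partial>lebesgue_on {c..d}\<bar> \<le> B * (d - c)"
      using bmeas_integral_abs_le[OF b[OF t] cd, of B] B by (simp add: bmeas_integral_eq b)
  qed
  then show ?thesis
    by (rule bmeas_cong) (simp add: bmeas_integral_eq b)
qed

text \<open>Truncation at the level \<open>B\<close> keeps the approximating continuous functions bounded, so that this convergence can be used under integrals.\<close>

lemma bmeas_approx_continuous:
  assumes f: "bmeas {a..b} f" and B: "\<And>x. x \<in> {a..b} \<Longrightarrow> \<bar>f x\<bar> \<le> B"
  obtains g :: "nat \<Rightarrow> real \<Rightarrow> real" where "\<And>n. continuous_on UNIV (g n)" "\<And>n x. \<bar>g n x\<bar> \<le> \<bar>B\<bar>"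
    "AE x in lebesgue_on {a..b}. (\<lambda>n. g n x) \<longlonglongrightarrow> f x"
proof -
  have "f measurable_on {a..b}"
    using bmeas_measurable[OF f] by (subst measurable_on_iff_borel_measurable) auto
  then obtain N g where N: "negligible N" and g: "\<And>n. continuous_on UNIV (g n)"
    and lim: "\<And>x. x \<notin> N \<Longrightarrow> (\<lambda>n. g n x) \<longlonglongrightarrow> (if x \<in> {a..b} then f x else 0)"
    unfolding measurable_on_def by blast
  define h where "h n x = max (- \<bar>B\<bar>) (min \<bar>B\<bar> (g n x))" for n x
  show thesis
  proof
    show "continuous_on UNIV (h n)" for n
      unfolding h_def by (intro continuous_intros g)
    show "\<bar>h n x\<bar> \<le> \<bar>B\<bar>" for n x
      by (auto simp: h_def)
    have "N \<in> null_sets lebesgue" using N by (simp add: negligible_iff_null_sets)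
    then have "AE x in lebesgue. x \<notin> N" by (rule AE_not_in)
    then show "AE x in lebesgue_on {a..b}. (\<lambda>n. h n x) \<longlonglongrightarrow> f x"
    proof (subst AE_restrict_space_iff, simp, elim AE_mp, intro AE_I2 impI)
      fix x assume x: "x \<notin> N" "x \<in> {a..b}"
      have "(\<lambda>n. max (- \<bar>B\<bar>) (min \<bar>B\<bar> (g n x))) \<longlonglongrightarrow> max (- \<bar>B\<bar>) (min \<bar>B\<bar> (f x))"
        using lim[OF x(1)] x(2) by (intro tendsto_intros) auto
      moreover have "max (- \<bar>B\<bar>) (min \<bar>B\<bar> (f x)) = f x"
        using B[OF x(2)] by auto
      ultimately show "(\<lambda>n. h n x) \<longlonglongrightarrow> f x" by (simp add: h_def)
    qed
  qed
qed

section \<open>Fejer means of cosine series on the unit interval\<close>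

definition cosine_coeff :: "(real \<Rightarrow> real) \<Rightarrow> nat \<Rightarrow> real" where
  "cosine_coeff w k = integral {0..1} (\<lambda>r. w r * cos (real k * pi * r))"

definition fejer_weight :: "nat \<Rightarrow> nat \<Rightarrow> real" where
  "fejer_weight N k = (if k = 0 then 1 else 2 * (1 - real k / real N))"

definition fejer_kernel :: "nat \<Rightarrow> real \<Rightarrow> real \<Rightarrow> real" where
  "fejer_kernel N u r = (\<Sum>k<N. fejer_weight N k * (cos (real k * pi * u) * cos (real k * pi * r)))"

text \<open>For \<open>k \<ge> 1\<close> the function \<open>cos (k \<pi> u)\<close> has square integral \<open>1 / 2\<close> on the unit interval, which is the origin of the factor
\<open>2\<close> in the weights: this is the Cesaro mean of the Neumann cosine series of \<open>w\<close>.\<close>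

definition fejer :: "nat \<Rightarrow> (real \<Rightarrow> real) \<Rightarrow> real \<Rightarrow> real" where
  "fejer N w u = (\<Sum>k<N. fejer_weight N k * cosine_coeff w k * cos (real k * pi * u))"

lemma fejer_weight_nonneg: "k < N \<Longrightarrow> 0 \<le> fejer_weight N k"
  by (auto simp: fejer_weight_def field_simps)

lemma fejer_weight_le_2: "fejer_weight N k \<le> 2"
  by (auto simp: fejer_weight_def)

text \<open>The Fejer kernel is the squared modulus of a geometric sum; written with real functions, this identity is
the reason for its positivity.\<close>

lemma sum_of_squares_trig:
  "(\<Sum>j<N. cos (real j * x))\<^sup>2 + (\<Sum>j<N. sin (real j * x))\<^sup>2 =
    real N * (\<Sum>k<N. fejer_weight N k * cos (real k * x))"
proof -
  define S where "S n = (\<Sum>k<n. (if k = 0 then real n else 2 * (real n - real k)) * cos (real k * x))" for n :: nat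
  have step: "S (Suc n) = S n + (1 + 2 * (\<Sum>j<n. cos (real (n - j) * x)))" for n
  proof -
    have "S (Suc n) = S n + (\<Sum>k<Suc n. (if k = 0 then 1 else 2) * cos (real k * x))"
    proof -
      have "S n = (\<Sum>k<Suc n. (if k = 0 then real n else 2 * (real n - real k)) * cos (real k * x))"
        by (simp add: S_def)
      then have "S n + (\<Sum>k<Suc n. (if k = 0 then 1 else 2) * cos (real k * x)) =
          (\<Sum>k<Suc n. (if k = 0 then real n else 2 * (real n - real k)) * cos (real k * x) +
            (if k = 0 then 1 else 2) * cos (real k * x))"
        by (simp only: sum.distrib)
      also have "\<dots> = S (Suc n)"
        unfolding S_def by (intro sum.cong refl) (simp add: algebra_simps)
      finally show ?thesis by (rule sym)
    qed
    also have "(\<Sum>k<Suc n. (if k = 0 then 1 else 2) * cos (real k * x)) = 1 + 2 * (\<Sum>k<n. cos (real (Suc k) * x))"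
      by (subst sum.lessThan_Suc_shift) (simp add: sum_distrib_left)
    also have "(\<Sum>k<n. cos (real (Suc k) * x)) = (\<Sum>j<n. cos (real (n - j) * x))"
      by (subst sum.nat_diff_reindex[symmetric]) (auto intro!: sum.cong simp: Suc_diff_Suc)
    finally show ?thesis .
  qed
  have main: "(\<Sum>j<n. cos (real j * x))\<^sup>2 + (\<Sum>j<n. sin (real j * x))\<^sup>2 = S n" for n
  proof (induction n)
    case 0 show ?case by (simp add: S_def)
  next
    case (Suc n)
    let ?C = "\<Sum>j<n. cos (real j * x)" and ?S = "\<Sum>j<n. sin (real j * x)"
    have *: "(\<Sum>j<n. cos (real (n - j) * x)) = cos (real n * x) * ?C + sin (real n * x) * ?S"
      by (simp add: sum_distrib_left flip: sum.distrib)
         (auto intro!: sum.cong simp: of_nat_diff left_diff_distrib cos_diff)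
    have "(?C + cos (real n * x))\<^sup>2 + (?S + sin (real n * x))\<^sup>2 =
        (?C\<^sup>2 + ?S\<^sup>2) + ((sin (real n * x))\<^sup>2 + (cos (real n * x))\<^sup>2) + 2 * (cos (real n * x) * ?C + sin (real n * x) * ?S)"
      by (simp add: power2_eq_square algebra_simps)
    then show ?case unfolding step Suc.IH[symmetric] * by simp
  qed
  show ?thesis
    unfolding main S_def sum_distrib_left
    by (intro sum.cong refl) (auto simp: fejer_weight_def field_simps)
qed

text \<open>By the product formula for cosines, the kernel on the unit interval is the Fejer kernel
at \<open>\<pi> (u - r)\<close> averaged with its value at \<open>\<pi> (u + r)\<close>, that is, the kernel of the even reflection.\<close>

lemma fejer_kernel_nonneg: "0 \<le> fejer_kernel N u r"
proof (cases "N = 0")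
  case False
  have pos: "0 \<le> (\<Sum>k<N. fejer_weight N k * cos (real k * x))" for x
  proof -
    have "0 \<le> real N * (\<Sum>k<N. fejer_weight N k * cos (real k * x))"
      unfolding sum_of_squares_trig[symmetric] by simp
    then show ?thesis using False by (simp add: zero_le_mult_iff)
  qed
  have "fejer_kernel N u r = ((\<Sum>k<N. fejer_weight N k * cos (real k * (pi * (u - r)))) +
      (\<Sum>k<N. fejer_weight N k * cos (real k * (pi * (u + r))))) / 2"
    unfolding fejer_kernel_def sum.distrib[symmetric] sum_divide_distrib
  proof (intro sum.cong refl)
    fix k
    have "cos x * cos y = (cos (x - y) + cos (x + y)) / 2" for x y :: real
      by (simp add: cos_diff cos_add)
    from this[of "real k * pi * u" "real k * pi * r"]
    show "fejer_weight N k * (cos (real k * pi * u) * cos (real k * pi * r)) =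
      (fejer_weight N k * cos (real k * (pi * (u - r))) + fejer_weight N k * cos (real k * (pi * (u + r)))) / 2"
      by (simp add: right_diff_distrib distrib_left mult.assoc)
  qed
  then show ?thesis using pos[of "pi * (u - r)"] pos[of "pi * (u + r)"] by simp
qed (simp add: fejer_kernel_def)

lemma bmeas_cos: "bmeas {a..b} (\<lambda>r. cos (c * r))"
  by (intro bmeas_continuous continuous_intros)

lemma bmeas_sin: "bmeas {a..b} (\<lambda>r. sin (c * r))"
  by (intro bmeas_continuous continuous_intros)

lemma integral_cos_int:
  "integral {0..1} (\<lambda>r. cos (of_int n * pi * r)) = (if n = 0 then 1 else (0::real))"
proof (cases "n = 0")
  case False
  have "((\<lambda>r. cos (of_int n * pi * r)) has_integral
      (sin (of_int n * pi * 1) / (of_int n * pi) - sin (of_int n * pi * 0) / (of_int n * pi))) {0..1}"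
    using False
    by (intro fundamental_theorem_of_calculus)
       (auto intro!: derivative_eq_intros simp flip: has_real_derivative_iff_has_vector_derivative)
  then show ?thesis using False
    by (auto simp: integral_unique sin_zero_iff_int2)
qed simp

lemma integral_cos_cos:
  "integral {0..1} (\<lambda>r. cos (real k * pi * r) * cos (real j * pi * r)) =
    (if k = j then if k = 0 then 1 else 1 / 2 else 0)"
proof -
  have "(\<lambda>r. cos (real k * pi * r) * cos (real j * pi * r)) =
     (\<lambda>r. (1/2) * cos (of_int (int k - int j) * pi * r) + (1/2) * cos (of_int (int k + int j) * pi * r))"
  proof
    fix r
    have "cos x * cos y = (1/2) * cos (x - y) + (1/2) * cos (x + y)" for x y :: real
      by (simp add: cos_diff cos_add field_simps)
    from this[of "real k * pi * r" "real j * pi * r"]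
    show "cos (real k * pi * r) * cos (real j * pi * r) =
      (1/2) * cos (of_int (int k - int j) * pi * r) + (1/2) * cos (of_int (int k + int j) * pi * r)"
      by (simp add: left_diff_distrib distrib_right)
  qed
  then have "integral {0..1} (\<lambda>r. cos (real k * pi * r) * cos (real j * pi * r)) =
     (1/2) * integral {0..1} (\<lambda>r. cos (of_int (int k - int j) * pi * r)) +
     (1/2) * integral {0..1} (\<lambda>r. cos (of_int (int k + int j) * pi * r))"
    by (simp only:) (subst integral_add; (intro bmeas_integrable bmeas_intros bmeas_cos)?; simp)
  then show ?thesis unfolding integral_cos_int by auto
qed

lemma integral_sin_sin:
  assumes "k \<noteq> 0" "j \<noteq> 0"
  shows "integral {0..1} (\<lambda>r. sin (real k * pi * r) * sin (real j * pi * r)) = (if k = j then 1 / 2 else 0)"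
proof -
  have "(\<lambda>r. sin (real k * pi * r) * sin (real j * pi * r)) =
     (\<lambda>r. (1/2) * cos (of_int (int k - int j) * pi * r) - (1/2) * cos (of_int (int k + int j) * pi * r))"
  proof
    fix r
    have "sin x * sin y = (1/2) * cos (x - y) - (1/2) * cos (x + y)" for x y :: real
      by (simp add: cos_diff cos_add field_simps)
    from this[of "real k * pi * r" "real j * pi * r"]
    show "sin (real k * pi * r) * sin (real j * pi * r) =
      (1/2) * cos (of_int (int k - int j) * pi * r) - (1/2) * cos (of_int (int k + int j) * pi * r)"
      by (simp add: left_diff_distrib distrib_right)
  qed
  then have "integral {0..1} (\<lambda>r. sin (real k * pi * r) * sin (real j * pi * r)) =
     (1/2) * integral {0..1} (\<lambda>r. cos (of_int (int k - int j) * pi * r)) -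
     (1/2) * integral {0..1} (\<lambda>r. cos (of_int (int k + int j) * pi * r))"
    by (simp only:) (subst integral_diff; (intro bmeas_integrable bmeas_intros bmeas_cos)?; simp)
  then show ?thesis unfolding integral_cos_int using assms by auto
qed

lemma cosine_coeff_add: "bmeas {0..1} f \<Longrightarrow> bmeas {0..1} g \<Longrightarrow> cosine_coeff (\<lambda>x. f x + g x) k = cosine_coeff f k + cosine_coeff g k"
  unfolding cosine_coeff_def distrib_right
  by (intro integral_add bmeas_integrable bmeas_intros bmeas_cos)

lemma cosine_coeff_cmult: "cosine_coeff (\<lambda>x. c * f x) k = c * cosine_coeff f k"
  unfolding cosine_coeff_def by (simp add: mult.assoc)

lemma fejer_add: "bmeas {0..1} f \<Longrightarrow> bmeas {0..1} g \<Longrightarrow> fejer N (\<lambda>x. f x + g x) u = fejer N f u + fejer N g u"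
  by (simp add: fejer_def cosine_coeff_add algebra_simps sum.distrib)

lemma fejer_cmult: "fejer N (\<lambda>x. c * f x) u = c * fejer N f u"
  by (simp add: fejer_def cosine_coeff_cmult sum_distrib_left algebra_simps)

lemma fejer_cos: "j < N \<Longrightarrow> fejer N (\<lambda>r. cos (real j * pi * r)) u = (1 - real j / real N) * cos (real j * pi * u)"
  unfolding fejer_def cosine_coeff_def integral_cos_cos
  by (simp add: if_distrib[of "\<lambda>z. _ * z"] if_distrib[of "\<lambda>z. z * _"] fejer_weight_def cong: if_cong)

lemma fejer_eq_integral:
  assumes "bmeas {0..1} w"
  shows "fejer N w u = integral {0..1} (\<lambda>r. fejer_kernel N u r * w r)"
proof -
  have "fejer N w u = (\<Sum>k<N. integral {0..1} (\<lambda>r. fejer_weight N k * cos (real k * pi * u) * (w r * cos (real k * pi * r))))"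
    unfolding fejer_def cosine_coeff_def by (intro sum.cong refl) simp
  also have "\<dots> = integral {0..1} (\<lambda>r. \<Sum>k<N. fejer_weight N k * cos (real k * pi * u) * (w r * cos (real k * pi * r)))"
    using assms by (intro integral_sum[symmetric] bmeas_integrable bmeas_intros bmeas_cos) auto
  also have "(\<lambda>r. \<Sum>k<N. fejer_weight N k * cos (real k * pi * u) * (w r * cos (real k * pi * r))) =
      (\<lambda>r. fejer_kernel N u r * w r)"
    unfolding fejer_kernel_def sum_distrib_right by (intro ext sum.cong refl) simp
  finally show ?thesis .
qed

lemma bmeas_fejer_kernel: "bmeas {a..b} (fejer_kernel N u)"
  unfolding fejer_kernel_def by (intro bmeas_intros bmeas_cos)

lemma fejer_mono:
  assumes "bmeas {0..1} f" "bmeas {0..1} g" "AE x in lebesgue_on {0..1}. f x \<le> g x"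
  shows "fejer N f u \<le> fejer N g u"
  unfolding fejer_eq_integral[OF assms(1)] fejer_eq_integral[OF assms(2)]
  using assms by (intro bmeas_integral_mono_AE bmeas_intros bmeas_fejer_kernel)
     (auto elim!: AE_mp intro!: mult_left_mono fejer_kernel_nonneg)

lemma fejer_const: "0 < N \<Longrightarrow> fejer N (\<lambda>_. c) u = c"
  using fejer_cmult[of N c "\<lambda>_. 1"] fejer_cos[of 0 N] by simp

lemma fejer_bounds:
  assumes "bmeas {0..1} f" "AE x in lebesgue_on {0..1}. A \<le> f x \<and> f x \<le> B" "0 < N"
  shows "A \<le> fejer N f u" "fejer N f u \<le> B"
  using fejer_mono[OF bmeas_const assms(1), of A N u] fejer_mono[OF assms(1) bmeas_const, of B N u] assms
  by (auto simp: fejer_const elim: AE_mp)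

lemma fejer_AE_cong:
  assumes "bmeas {0..1} f" "bmeas {0..1} g" "AE x in lebesgue_on {0..1}. f x = g x"
  shows "fejer N f u = fejer N g u"
proof (rule antisym)
  show "fejer N f u \<le> fejer N g u" using assms by (intro fejer_mono) (auto elim: AE_mp)
  show "fejer N g u \<le> fejer N f u" using assms by (intro fejer_mono) (auto elim: AE_mp)
qed

text \<open>The test function is a combination of the first three cosine modes, on each of which the Fejer mean acts
by multiplication with \<open>1 - k / N\<close>.\<close>

lemma fejer_korovkin:
  assumes "2 \<le> N"
  shows "fejer N (\<lambda>r. (cos (pi * r) - cos (pi * u))\<^sup>2) u = 1 / real N"
proof -
  have c2: "cos (2 * pi * r) = 2 * (cos (pi * r))\<^sup>2 - 1" for r
    using cos_double_cos[of "pi * r"] by (simp add: mult.assoc)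
  have "(\<lambda>r. (cos (pi * r) - cos (pi * u))\<^sup>2) =
     (\<lambda>r. (1/2 + (cos (pi * u))\<^sup>2) + ((1/2) * cos (real 2 * pi * r) + (- 2 * cos (pi * u)) * cos (real 1 * pi * r)))"
  proof
    fix r
    have "(x - y)\<^sup>2 = (1/2 + y\<^sup>2) + ((1/2) * (2 * x\<^sup>2 - 1) + (- 2 * y) * x)" for x y :: real
      by (simp add: power2_eq_square algebra_simps)
    from this[of "cos (pi * r)" "cos (pi * u)", folded c2[of r]]
    show "(cos (pi * r) - cos (pi * u))\<^sup>2 =
     (1/2 + (cos (pi * u))\<^sup>2) + ((1/2) * cos (real 2 * pi * r) + (- 2 * cos (pi * u)) * cos (real 1 * pi * r))"
      by simp
  qed
  then have "fejer N (\<lambda>r. (cos (pi * r) - cos (pi * u))\<^sup>2) u =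
     fejer N (\<lambda>r. 1/2 + (cos (pi * u))\<^sup>2) u + ((1/2) * fejer N (\<lambda>r. cos (real 2 * pi * r)) u +
       (- 2 * cos (pi * u)) * fejer N (\<lambda>r. cos (real 1 * pi * r)) u)"
    by (simp only: fejer_add bmeas_const bmeas_mult bmeas_add bmeas_cos fejer_cmult)
  also have "fejer N (\<lambda>r. cos (real 2 * pi * r)) u = (1 - 2 / real N) * cos (2 * pi * u)"
  proof (cases "N = 2")
    case True
    have "fejer N (\<lambda>r. cos (real 2 * pi * r)) u = 0"
      unfolding fejer_def cosine_coeff_def integral_cos_cos using True by (intro sum.neutral) auto
    then show ?thesis using True by simp
  next
    case False
    then show ?thesis using fejer_cos[of 2 N u] assms by simp
  qed
  also have "fejer N (\<lambda>r. cos (real 1 * pi * r)) u = (1 - 1 / real N) * cos (pi * u)"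
    using fejer_cos[of 1 N u] assms by simp
  finally have eq: "fejer N (\<lambda>r. (cos (pi * r) - cos (pi * u))\<^sup>2) u =
    (1/2 + (cos (pi * u))\<^sup>2) + ((1/2) * ((1 - 2 / real N) * (2 * (cos (pi * u))\<^sup>2 - 1)) +
      (- 2 * cos (pi * u)) * ((1 - 1 / real N) * cos (pi * u)))"
    using assms by (simp only: fejer_const c2)
  have "(1/2 + x\<^sup>2) + ((1/2) * ((1 - 2 * y) * (2 * x\<^sup>2 - 1)) + (- 2 * x) * ((1 - y) * x)) = y" for x y :: real
    by (simp add: power2_eq_square algebra_simps)
  from this[of "cos (pi * u)" "1 / real N"] show ?thesis unfolding eq by simp
qed

text \<open>Korovkin's argument: \<open>cos (\<pi> r)\<close> is injective on the unit interval, so \<open>|W r - W u|\<close> is at most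
\<open>e / 2\<close> plus a multiple of \<open>(cos (\<pi> r) - cos (\<pi> u))\<^sup>2\<close>, and the Fejer mean of the latter at \<open>u\<close> is \<open>1 / N\<close>.
The argument includes the end points \<open>u = 0\<close> and \<open>u = 1\<close>.\<close>

lemma fejer_tendsto:
  assumes W: "continuous_on {0..1} W" and u: "u \<in> {0..1}"
  shows "(\<lambda>N. fejer N W u) \<longlonglongrightarrow> W u"
proof (rule LIMSEQ_I)
  fix e :: real assume e: "0 < e"
  obtain d where d: "d > 0" "\<And>r. r \<in> {0..1} \<Longrightarrow> \<bar>r - u\<bar> < d \<Longrightarrow> \<bar>W r - W u\<bar> < e / 2"
  proof -
    have "\<exists>d>0. \<forall>r\<in>{0..1}. dist r u < d \<longrightarrow> dist (W r) (W u) < e / 2"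
    proof -
      have "0 < e / 2" using e by simp
      then show ?thesis using bspec[OF W[unfolded continuous_on_iff] u] by blast
    qed
    then show thesis using that by (auto simp: dist_real_def)
  qed
  obtain B where B: "B > 0" "\<And>r. r \<in> {0..1} \<Longrightarrow> \<bar>W r\<bar> \<le> B"
    using bmeas_bound[OF bmeas_continuous[OF W]] by blast
  let ?q = "\<lambda>r. (cos (pi * r) - cos (pi * u))\<^sup>2"
  let ?S = "{r \<in> {0..1}. d \<le> \<bar>r - u\<bar>}"
  have "compact ({0..1} \<inter> {r. d \<le> \<bar>r - u\<bar>})"
    by (intro compact_Int_closed compact_Icc closed_Collect_le continuous_intros)
  moreover have "?S = {0..1} \<inter> {r. d \<le> \<bar>r - u\<bar>}" by blast
  ultimately have S: "compact ?S" by (simp only:)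
  have "\<exists>\<mu>>0. \<forall>r\<in>?S. \<mu> \<le> ?q r"
  proof (cases "?S = {}")
    case False
    have "\<exists>r0\<in>?S. \<forall>r\<in>?S. ?q r0 \<le> ?q r"
      by (rule continuous_attains_inf[OF S False]) (intro continuous_intros)
    then obtain r0 where r0: "r0 \<in> ?S" "\<forall>r\<in>?S. ?q r0 \<le> ?q r" by (elim bexE)
    have "cos (pi * r0) \<noteq> cos (pi * u)"
    proof
      assume "cos (pi * r0) = cos (pi * u)"
      then have "pi * r0 = pi * u"
        using r0(1) u by (rule_tac cos_inj_pi) (auto simp: mult_left_le)
      then show False using r0(1) d(1) by simp
    qed
    then show ?thesis using r0(2) by (intro exI[of _ "?q r0"]) auto
  qed (auto intro: exI[of _ 1])
  then obtain \<mu> where \<mu>: "\<mu> > 0" "\<And>r. r \<in> ?S \<Longrightarrow> \<mu> \<le> ?q r" by blast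
  \<comment> \<open>Chosen so that \<open>C * ?q r \<ge> 2 * B\<close> away from \<open>u\<close>, where only the crude bound \<open>2 * B\<close> is used.\<close>
  define C where "C = 2 * B / \<mu>"
  have C: "C \<ge> 0" using B \<mu> by (simp add: C_def)
  have bound: "\<bar>W r - W u\<bar> \<le> e / 2 + C * ?q r" if r: "r \<in> {0..1}" for r
  proof (cases "\<bar>r - u\<bar> < d")
    case True
    moreover have "0 \<le> C * ?q r" using C by simp
    ultimately show ?thesis using d(2)[OF r] by linarith
  next
    case False
    then have "\<mu> \<le> ?q r" using r \<mu>(2)[of r] by simp
    then have "C * \<mu> \<le> C * ?q r" using C by (rule mult_left_mono)
    then have "2 * B \<le> C * ?q r" using \<mu>(1) by (simp add: C_def)
    then show ?thesis using B(2)[OF r] B(2)[OF u] e by linarith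
  qed
  have q: "bmeas {0..1} ?q" by (intro bmeas_continuous continuous_intros)
  have close: "\<bar>fejer N W u - W u\<bar> \<le> e / 2 + C / real N" if N: "2 \<le> N" for N
  proof -
    have W': "bmeas {0..1} W" by (rule bmeas_continuous[OF W])
    have "fejer N W u \<le> fejer N (\<lambda>r. (W u + e / 2) + C * ?q r) u"
    proof (intro fejer_mono W' bmeas_intros q bmeas_cos AE_I2)
      fix r :: real assume "r \<in> space (lebesgue_on {0..1})"
      then show "W r \<le> (W u + e / 2) + C * ?q r" using bound[of r] by (simp add: abs_le_iff)
    qed
    also have "\<dots> = (W u + e / 2) + C * (1 / real N)"
      using N by (simp only: fejer_add bmeas_const bmeas_mult q fejer_cmult fejer_korovkin fejer_const)
    finally have up: "fejer N W u \<le> (W u + e / 2) + C * (1 / real N)" .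
    have "fejer N W u \<ge> fejer N (\<lambda>r. (W u - e / 2) + (- C) * ?q r) u"
    proof (intro fejer_mono W' bmeas_intros q bmeas_cos AE_I2)
      fix r :: real assume "r \<in> space (lebesgue_on {0..1})"
      then show "(W u - e / 2) + (- C) * ?q r \<le> W r" using bound[of r] by (simp add: abs_le_iff)
    qed
    also have "fejer N (\<lambda>r. (W u - e / 2) + (- C) * ?q r) u = (W u - e / 2) + (- C) * (1 / real N)"
      using N by (simp only: fejer_add bmeas_const bmeas_mult q fejer_cmult fejer_korovkin fejer_const)
    finally show ?thesis using up by (simp add: abs_le_iff)
  qed
  obtain N0 where N0: "real N0 > 2 * C / e" using reals_Archimedean2 by blast
  show "\<exists>no. \<forall>N\<ge>no. norm (fejer N W u - W u) < e"
  proof (intro exI allI impI)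
    fix N assume "N \<ge> max 2 N0"
    then have N: "2 \<le> N" "real N0 \<le> real N" by auto
    have "real N > 2 * C / e" using N N0 by linarith
    then have "C / real N < e / 2" using e N by (auto simp: field_simps)
    then show "norm (fejer N W u - W u) < e" using close[OF N(1)] unfolding real_norm_def by linarith
  qed
qed

text \<open>Such an \<open>f\<close> is orthogonal to all Fejer means, hence to all continuous functions, hence to itself.\<close>

lemma cosine_coeff_unique:
  assumes f: "bmeas {0..1} f" and 0: "\<And>k. cosine_coeff f k = 0"
  shows "AE x in lebesgue_on {0..1}. f x = 0"
proof -
  obtain B where B: "\<And>x. x \<in> {0..1} \<Longrightarrow> \<bar>f x\<bar> \<le> B" using bmeas_bound[OF f] by blast
  have orth: "integral {0..1} (\<lambda>x. f x * g x) = 0" if g: "continuous_on {0..1} g" for g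
  proof -
    obtain C where C: "\<And>x. x \<in> {0..1} \<Longrightarrow> \<bar>g x\<bar> \<le> C"
      using bmeas_bound[OF bmeas_continuous[OF g]] by blast
    have mf: "bmeas {0..1} (fejer N g)" for N
      unfolding fejer_def by (intro bmeas_intros bmeas_cos)
    have z: "integral {0..1} (\<lambda>x. f x * fejer (Suc N) g x) = 0" for N
    proof -
      have "integral {0..1} (\<lambda>x. f x * fejer (Suc N) g x) =
        integral {0..1} (\<lambda>x. \<Sum>k<Suc N. fejer_weight (Suc N) k * cosine_coeff g k * (f x * cos (real k * pi * x)))"
        unfolding fejer_def sum_distrib_left by (intro arg_cong2[where f = integral] ext sum.cong refl) simp
      also have "\<dots> = (\<Sum>k<Suc N. integral {0..1} (\<lambda>x. fejer_weight (Suc N) k * cosine_coeff g k * (f x * cos (real k * pi * x))))"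
        by (intro integral_sum bmeas_integrable bmeas_intros bmeas_cos f) auto
      also have "\<dots> = 0" using 0 by (simp add: cosine_coeff_def)
      finally show ?thesis .
    qed
    have "(\<lambda>N. integral {0..1} (\<lambda>x. f x * fejer (Suc N) g x)) \<longlonglongrightarrow> integral {0..1} (\<lambda>x. f x * g x)"
    proof (rule bmeas_tendsto_integral[where B = "\<bar>B\<bar> * \<bar>C\<bar>"])
      show "AE x in lebesgue_on {0..1}. (\<lambda>N. f x * fejer (Suc N) g x) \<longlonglongrightarrow> f x * g x"
      proof (rule AE_I2)
        fix x :: real assume "x \<in> space (lebesgue_on {0..1})"
        then show "(\<lambda>N. f x * fejer (Suc N) g x) \<longlonglongrightarrow> f x * g x"
          by (intro tendsto_mult tendsto_const LIMSEQ_Suc[OF fejer_tendsto] g) auto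
      qed
      show "AE x in lebesgue_on {0..1}. \<bar>f x * fejer (Suc n) g x\<bar> \<le> \<bar>B\<bar> * \<bar>C\<bar>" for n
      proof (rule AE_I2)
        fix x :: real assume x: "x \<in> space (lebesgue_on {0..1})"
        have "AE y in lebesgue_on {0..1}. - C \<le> g y \<and> g y \<le> C"
          using C by (intro AE_I2) (auto simp: abs_le_iff minus_le_iff)
        from fejer_bounds[OF bmeas_continuous[OF g] this, of "Suc n" x]
        have "\<bar>fejer (Suc n) g x\<bar> \<le> \<bar>C\<bar>" by auto
        moreover have "\<bar>f x\<bar> \<le> \<bar>B\<bar>" using B[of x] x by auto
        ultimately show "\<bar>f x * fejer (Suc n) g x\<bar> \<le> \<bar>B\<bar> * \<bar>C\<bar>"
          by (simp add: abs_mult mult_mono)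
      qed
    qed (intro bmeas_intros f mf bmeas_continuous g)+
    then show ?thesis unfolding z by (simp add: LIMSEQ_const_iff)
  qed
  obtain g where g: "\<And>n. continuous_on UNIV (g n)" "\<And>n x. \<bar>g n x\<bar> \<le> \<bar>B\<bar>"
    "AE x in lebesgue_on {0..1}. (\<lambda>n. g n x) \<longlonglongrightarrow> f x"
    using bmeas_approx_continuous[OF f B] by blast
  have gc: "continuous_on {0..1} (g n)" for n using g(1) continuous_on_subset by blast
  have "(\<lambda>n. integral {0..1} (\<lambda>x. f x * g n x)) \<longlonglongrightarrow> integral {0..1} (\<lambda>x. f x * f x)"
  proof (rule bmeas_tendsto_integral[where B = "\<bar>B\<bar> * \<bar>B\<bar>"])
    show "AE x in lebesgue_on {0..1}. (\<lambda>n. f x * g n x) \<longlonglongrightarrow> f x * f x"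
      using g(3) by eventually_elim (intro tendsto_mult tendsto_const)
    show "AE x in lebesgue_on {0..1}. \<bar>f x * g n x\<bar> \<le> \<bar>B\<bar> * \<bar>B\<bar>" for n
    proof (rule AE_I2)
      fix x :: real assume x: "x \<in> space (lebesgue_on {0..1})"
      have "\<bar>f x\<bar> \<le> \<bar>B\<bar>" using B[of x] x by auto
      then show "\<bar>f x * g n x\<bar> \<le> \<bar>B\<bar> * \<bar>B\<bar>" using g(2)[of n x]
        unfolding abs_mult by (intro mult_mono) auto
    qed
  qed (intro bmeas_intros f bmeas_continuous gc)+
  then have "integral {0..1} (\<lambda>x. f x * f x) = 0"
    unfolding orth[OF gc] by (simp add: LIMSEQ_const_iff)
  moreover have ff: "bmeas {0..1} (\<lambda>x. f x * f x)" by (intro bmeas_intros f)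
  ultimately have "(\<integral>x. f x * f x \<partial>lebesgue_on {0..1}) = 0" by (simp add: bmeas_integral_eq)
  then have "AE x in lebesgue_on {0..1}. f x * f x = 0"
    using integral_nonneg_eq_0_iff_AE[OF bmeas_lebesgue_integrable[OF ff]] by simp
  then show ?thesis by simp
qed

lemma square_integrable_mult_bounded:
  assumes f: "f \<in> borel_measurable (lebesgue_on {0..1})" "integrable (lebesgue_on {0..1}) (\<lambda>x. (f x)\<^sup>2)"
    and g: "bmeas {0..1} g"
  shows "integrable (lebesgue_on {0..1}) (\<lambda>x. f x * g x)"
proof -
  obtain B where B: "B > 0" "\<And>x. x \<in> {0..1} \<Longrightarrow> \<bar>g x\<bar> \<le> B" using bmeas_bound[OF g] by blast
  have "integrable (lebesgue_on {0..1}) (\<lambda>x. ((f x)\<^sup>2 + 1) * B)"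
    using f(2) bmeas_lebesgue_integrable[OF bmeas_const] by (intro integrable_mult_left Bochner_Integration.integrable_add) auto
  then show ?thesis
  proof (rule Bochner_Integration.integrable_bound)
    show "(\<lambda>x. f x * g x) \<in> borel_measurable (lebesgue_on {0..1})"
      using f(1) bmeas_measurable[OF g] by measurable
    show "AE x in lebesgue_on {0..1}. norm (f x * g x) \<le> norm (((f x)\<^sup>2 + 1) * B)"
    proof (rule AE_I2)
      fix x :: real assume "x \<in> space (lebesgue_on {0..1})"
      then have "\<bar>g x\<bar> \<le> B" using B by simp
      moreover have "\<bar>f x\<bar> \<le> (f x)\<^sup>2 + 1"
        using sum_power2_ge_zero[of "\<bar>f x\<bar> - 1" 0] zero_le_power2[of "f x"] by (simp add: power2_eq_square algebra_simps)
      ultimately show "norm (f x * g x) \<le> norm (((f x)\<^sup>2 + 1) * B)"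
        using B(1) by (simp add: abs_mult mult_mono)
    qed
  qed
qed

text \<open>The squared distance of \<open>f\<close> to its sine polynomial is nonnegative; the factor \<open>2\<close> is due to \<open>\<integral> sin\<^sup>2 (k \<pi> x) = 1 / 2\<close>.\<close>

lemma sine_bessel:
  assumes f: "f \<in> borel_measurable (lebesgue_on {0..1})" "integrable (lebesgue_on {0..1}) (\<lambda>x. (f x)\<^sup>2)"
  shows "2 * (\<Sum>k=1..n. (\<integral>x. f x * sin (real k * pi * x) \<partial>lebesgue_on {0..1})\<^sup>2)
    \<le> (\<integral>x. (f x)\<^sup>2 \<partial>lebesgue_on {0..1})"
proof -
  let ?M = "lebesgue_on {0..1::real}"
  define s where "s k x = sin (real k * pi * x)" for k :: nat and x :: real
  define h where "h k = (\<integral>x. f x * s k x \<partial>?M)" for k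
  define p where "p x = (\<Sum>k=1..n. 2 * h k * s k x)" for x
  have s: "bmeas {0..1} (s k)" for k unfolding s_def by (rule bmeas_sin)
  have p: "bmeas {0..1} p" unfolding p_def by (intro bmeas_intros s)
  have fs: "integrable ?M (\<lambda>x. f x * g x)" if "bmeas {0..1} g" for g
    using square_integrable_mult_bounded[OF f that] .
  have "(\<integral>x. f x * p x \<partial>?M) = (\<integral>x. (\<Sum>k=1..n. 2 * h k * (f x * s k x)) \<partial>?M)"
    unfolding p_def sum_distrib_left by (intro Bochner_Integration.integral_cong refl sum.cong) simp
  also have "\<dots> = (\<Sum>k=1..n. 2 * h k * h k)"
    by (subst Bochner_Integration.integral_sum) (auto simp: h_def intro!: fs s)
  finally have fp: "(\<integral>x. f x * p x \<partial>?M) = 2 * (\<Sum>k=1..n. (h k)\<^sup>2)"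
    by (simp add: sum_distrib_left power2_eq_square mult.assoc)
  have "integral {0..1} (\<lambda>x. p x * p x) = integral {0..1} (\<lambda>x. \<Sum>k=1..n. \<Sum>j=1..n. (2 * h k) * (2 * h j) * (s k x * s j x))"
    unfolding p_def sum_product by (intro arg_cong2[where f = integral] ext sum.cong refl) simp
  also have "\<dots> = (\<Sum>k=1..n. \<Sum>j=1..n. (2 * h k) * (2 * h j) * integral {0..1} (\<lambda>x. s k x * s j x))"
    by (subst integral_sum | intro finite_atLeastAtMost bmeas_integrable bmeas_intros s sum.cong refl)+ simp
  also have "\<dots> = (\<Sum>k=1..n. \<Sum>j=1..n. if k = j then 2 * (h k)\<^sup>2 else 0)"
    unfolding s_def by (intro sum.cong refl) (auto simp: integral_sin_sin power2_eq_square)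
  also have "\<dots> = 2 * (\<Sum>k=1..n. (h k)\<^sup>2)"
    by (simp add: sum_distrib_left)
  finally have pp: "(\<integral>x. p x * p x \<partial>?M) = 2 * (\<Sum>k=1..n. (h k)\<^sup>2)"
    by (simp add: bmeas_integral_eq bmeas_mult p)
  have "0 \<le> (\<integral>x. (f x - p x)\<^sup>2 \<partial>?M)" by simp
  also have "(\<integral>x. (f x - p x)\<^sup>2 \<partial>?M) = (\<integral>x. ((f x)\<^sup>2 - 2 * (f x * p x)) + p x * p x \<partial>?M)"
    by (intro Bochner_Integration.integral_cong refl) (simp add: power2_eq_square algebra_simps)
  also have "\<dots> = (\<integral>x. (f x)\<^sup>2 \<partial>?M) - 2 * (\<integral>x. f x * p x \<partial>?M) + (\<integral>x. p x * p x \<partial>?M)"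
    using f(2) fs[OF p] bmeas_lebesgue_integrable[OF bmeas_mult[OF p p]] by simp
  finally show ?thesis unfolding fp pp by (simp add: h_def s_def)
qed

section \<open>Continuous representatives and boundary values in \<open>H\<^sup>1\<close>\<close>

lemma tendsto_dominated:
  fixes x :: "nat \<Rightarrow> real"
  assumes "\<And>n. \<bar>x n - l\<bar> \<le> y n" "y \<longlonglongrightarrow> 0"
  shows "x \<longlonglongrightarrow> l"
  by (rule LIM_zero_cancel, rule Lim_null_comparison[OF always_eventually assms(2)]) (simp add: assms(1))

text \<open>This produces admissible test functions in the definition of the weak derivative:
the vanishing mean of \<open>q\<close> makes the primitive vanish again near \<open>1\<close>.\<close>

lemma compactly_supported_primitive:
  fixes q :: "real \<Rightarrow> real"
  assumes q: "continuous_on UNIV q" and d: "0 < d" "d < 1/2"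
    and supp: "\<And>u. u \<notin> {d..1 - d} \<Longrightarrow> q u = 0" and zero: "integral {0..1} q = 0"
  defines "h \<equiv> \<lambda>u. if u \<in> {0..1} then integral {0..u} q else 0"
  shows "(h has_real_derivative q u) (at u)" "u \<notin> {d..1 - d} \<Longrightarrow> h u = 0"
proof -
  have qi: "q integrable_on {a..b}" for a b
    using q continuous_on_subset by (blast intro: integrable_continuous_interval)
  have left: "h u = 0" if "u < d" for u
  proof (cases "u \<in> {0..1}")
    case True
    have "integral {0..u} q = integral {0..u} (\<lambda>_. 0)"
      using that by (intro integral_cong supp) auto
    then show ?thesis by (simp add: h_def)
  qed (auto simp: h_def)
  have right: "h u = 0" if "u > 1 - d" for u
  proof (cases "u \<in> {0..1}")
    case True
    have "integral {0..u} q + integral {u..1} q = integral {0..1} q"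
      using True by (intro Henstock_Kurzweil_Integration.integral_combine qi) auto
    moreover have "integral {u..1} q = integral {u..1} (\<lambda>_. 0)"
      using that by (intro integral_cong supp) auto
    ultimately show ?thesis using zero by (simp add: h_def)
  qed (auto simp: h_def)
  show "u \<notin> {d..1 - d} \<Longrightarrow> h u = 0"
    using left right by (auto simp: not_le)
  consider "u < d" | "u > 1 - d" | "u \<in> {d..1 - d}" by force
  then show "(h has_real_derivative q u) (at u)"
  proof cases
    case 1
    have "((\<lambda>_. 0) has_real_derivative 0) (at u)" by simp
    then have "(h has_real_derivative 0) (at u)"
      using 1 left by (rule_tac has_field_derivative_transform_within_open[of "\<lambda>_. 0" _ _ "{..<d}"]) auto
    then show ?thesis using supp[of u] 1 by simp
  next
    case 2
    have "((\<lambda>_. 0) has_real_derivative 0) (at u)" by simp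
    then have "(h has_real_derivative 0) (at u)"
      using 2 right by (rule_tac has_field_derivative_transform_within_open[of "\<lambda>_. 0" _ _ "{1-d<..}"]) auto
    then show ?thesis using supp[of u] 2 by simp
  next
    case 3
    have "((\<lambda>x. integral {0..x} q) has_real_derivative q u) (at u within {0..1})"
      using 3 d q by (intro integral_has_real_derivative) (auto intro: continuous_on_subset)
    then have "((\<lambda>x. integral {0..x} q) has_real_derivative q u) (at u)"
      using 3 d by (subst (asm) at_within_interior) auto
    then show ?thesis
      using 3 d by (rule_tac has_field_derivative_transform_within_open[of "\<lambda>x. integral {0..x} q" _ _ "{0<..<1}"]) (auto simp: h_def)
  qed
qed

lemma lebesgue_integral_open_closed:
  fixes f :: "real \<Rightarrow> real"
  assumes "f \<in> borel_measurable (lebesgue_on {0..1})"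
  shows "(\<integral>u. f u \<partial>lebesgue_on {0<..<1}) = (\<integral>u. f u \<partial>lebesgue_on {0..1::real}) "
proof -
  have f1: "f \<in> borel_measurable (lebesgue_on {0<..<1})"
    using assms by (rule measurable_restrict_mono) auto
  have m: "(\<lambda>u. if u \<in> {0..1} then f u else 0) \<in> borel_measurable lebesgue"
    "(\<lambda>u. if u \<in> {0<..<1} then f u else 0) \<in> borel_measurable lebesgue"
    subgoal using assms by (subst borel_measurable_if) auto
    subgoal using f1 by (subst borel_measurable_if) auto
    done
  have "(\<integral>u. (if u \<in> {0<..<1} then f u else 0) \<partial>lebesgue) = (\<integral>u. (if u \<in> {0..1} then f u else 0) \<partial>lebesgue)"
  proof (rule integral_cong_AE[OF m(2) m(1)])
    have "{0, 1::real} \<in> null_sets lebesgue" by (simp add: null_sets_completionI)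
    then have "AE u in lebesgue. u \<notin> {0, 1::real}" by (rule AE_not_in)
    then show "AE u in lebesgue. (if u \<in> {0<..<1} then f u else 0) = (if u \<in> {0..1} then f u else 0)"
      by eventually_elim auto
  qed
  moreover have "indicator S u *\<^sub>R f u = (if u \<in> S then f u else 0)" for S u by simp
  ultimately show ?thesis by (simp add: integral_restrict_space del: real_scaleR_def)
qed

text \<open>Formally this is an integration by parts against \<open>sin (k \<pi> u) / (k \<pi>)\<close>, which vanishes at both ends but not
near them. Its derivative \<open>cos (k \<pi> u)\<close> is cut off by plateau functions, a multiple of a fixed
bump restores the mean value zero, and the primitives of the resulting functions are admissible and converge uniformly.\<close>

lemma cosine_coeff_weak_deriv:
  assumes \<phi>: "bmeas {0..1} \<phi>" and \<psi>: "square_summable \<psi>" and wd: "is_weak_deriv \<phi> \<psi>"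
  shows "real k * pi * cosine_coeff \<phi> k = - (\<integral>u. \<psi> u * sin (real k * pi * u) \<partial>lebesgue_on {0..1})"
proof (cases "k = 0")
  case False
  note \<psi>m = \<psi>[unfolded square_summable_def]
  \<comment> \<open>Plateau functions that vanish near the end points and increase to \<open>1\<close> on the open interval.\<close>
  define \<eta> where "\<eta> n u = max 0 (min 1 (real (n + 3) * min u (1 - u) - 1))" for n :: nat and u :: real
  have \<eta>c: "continuous_on UNIV (\<eta> n)" for n unfolding \<eta>_def by (intro continuous_intros)
  have \<eta>b: "\<bar>\<eta> n u\<bar> \<le> 1" for n u by (auto simp: \<eta>_def)
  have \<eta>supp: "\<eta> n u = 0" if "u \<notin> {1 / real (n + 3)..1 - 1 / real (n + 3)}" for n u
  proof -
    have "min u (1 - u) \<le> 1 / real (n + 3)" using that by auto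
    then have "real (n + 3) * min u (1 - u) \<le> real (n + 3) * (1 / real (n + 3))"
      by (intro mult_left_mono) auto
    then have "real (n + 3) * min u (1 - u) \<le> 1" by simp
    then show ?thesis unfolding \<eta>_def by linarith
  qed
  have \<eta>lim: "(\<lambda>n. \<eta> n u) \<longlonglongrightarrow> 1" if "u \<in> {0<..<1}" for u
  proof (rule tendsto_eventually)
    have m: "0 < min u (1 - u)" using that by auto
    obtain N where N: "real N * min u (1 - u) \<ge> 2"
      using reals_Archimedean2[of "2 / min u (1 - u)"] m by (auto simp: field_simps intro: less_imp_le)
    show "\<forall>\<^sub>F n in sequentially. \<eta> n u = 1"
    proof (rule eventually_sequentiallyI[of N])
      fix n assume "n \<ge> N"
      then have "real N * min u (1 - u) \<le> real (n + 3) * min u (1 - u)"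
        using m by (intro mult_right_mono) auto
      then show "\<eta> n u = 1" using N by (simp add: \<eta>_def)
    qed
  qed
  have lim1: "(\<lambda>n. integral {0..1} (\<lambda>u. g u * \<eta> n u)) \<longlonglongrightarrow> integral {0..1} g" if g: "bmeas {0..1} g" for g
  proof -
    obtain B where B: "\<And>u. u \<in> {0..1} \<Longrightarrow> \<bar>g u\<bar> \<le> B" using bmeas_bound[OF g] by blast
    show ?thesis
    proof (rule bmeas_tendsto_integral[where B = B])
      show "AE u in lebesgue_on {0..1}. (\<lambda>n. g u * \<eta> n u) \<longlonglongrightarrow> g u"
      proof -
        have "{0, 1::real} \<in> null_sets lebesgue" by (simp add: null_sets_completionI)
        then have "AE u in lebesgue. u \<notin> {0, 1::real}" by (rule AE_not_in)
        then have "AE u in lebesgue. u \<in> {0..1} \<longrightarrow> (\<lambda>n. g u * \<eta> n u) \<longlonglongrightarrow> g u"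
        proof eventually_elim
          case (elim u)
          then show ?case using tendsto_mult[OF tendsto_const[of "g u"] \<eta>lim[of u]] by auto
        qed
        then show ?thesis by (subst AE_restrict_space_iff) auto
      qed
      show "AE u in lebesgue_on {0..1}. \<bar>g u * \<eta> n u\<bar> \<le> B" for n
        using B \<eta>b by (intro AE_I2) (force simp: abs_mult intro: order.trans[OF mult_left_le])
    qed (intro bmeas_intros g bmeas_continuous continuous_on_subset[OF \<eta>c] subset_UNIV)+
  qed
  have \<eta>m: "bmeas {0..1} (\<eta> n)" for n
    by (intro bmeas_continuous continuous_on_subset[OF \<eta>c] subset_UNIV)
  define e where "e u = cos (real k * pi * u)" for u
  have ec: "continuous_on UNIV e" unfolding e_def by (intro continuous_intros)
  have em: "bmeas {0..1} e" unfolding e_def by (rule bmeas_cos)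
  obtain N where N: "integral {0..1} (\<eta> N) > 1/2"
  proof -
    have "(\<lambda>n. integral {0..1} (\<eta> n)) \<longlonglongrightarrow> 1" using lim1[OF bmeas_const[of _ 1]] by simp
    then have "\<forall>\<^sub>F n in sequentially. integral {0..1} (\<eta> n) > 1/2" by (rule order_tendstoD) simp
    then show thesis using that by (auto simp: eventually_sequentially)
  qed
  \<comment> \<open>A bump of mean one; one fixed plateau function can serve because its mean is positive.\<close>
  define b where "b u = \<eta> N u / integral {0..1} (\<eta> N)" for u
  define I where "I n = integral {0..1} (\<lambda>u. e u * \<eta> n u)" for n
  \<comment> \<open>The cut-off cosine, corrected to mean zero; the correction vanishes in the limit since the cosine has mean zero.\<close>
  define q where "q n u = e u * \<eta> n u - I n * b u" for n u
  define h where "h n u = (if u \<in> {0..1} then integral {0..u} (q n) else 0)" for n and u :: real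
  have I0: "I \<longlonglongrightarrow> 0"
  proof -
    have "integral {0..1} e = 0"
      using integral_cos_int[of "int k"] False by (simp add: e_def[abs_def])
    then show ?thesis using lim1[OF em] by (simp add: I_def[abs_def])
  qed
  have bm: "bmeas {0..1} b" unfolding b_def by (intro bmeas_intros \<eta>m)
  have qm: "bmeas {0..1} (q n)" for n unfolding q_def by (intro bmeas_intros em \<eta>m bm)
  have bint: "integral {0..1} b = 1" using N by (simp add: b_def[abs_def])
  have qint: "integral {0..1} (q n) = 0" for n
  proof -
    have "integral {0..1} (q n) = I n - integral {0..1} (\<lambda>u. I n * b u)"
      unfolding q_def I_def by (intro integral_diff bmeas_integrable bmeas_intros em \<eta>m bm)
    then show ?thesis using bint by simp
  qed
  have qc: "continuous_on UNIV (q n)" for n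
    unfolding q_def b_def by (intro continuous_intros ec \<eta>c) (use N in auto)
  define d where "d n = 1 / real (max n N + 3)" for n
  have d: "0 < d n" "d n < 1/2" for n by (auto simp: d_def)
  have qsupp: "q n u = 0" if "u \<notin> {d n..1 - d n}" for n u
  proof -
    have "d n \<le> 1 / real (n + 3)" "d n \<le> 1 / real (N + 3)" by (auto simp: d_def intro!: divide_left_mono)
    then have "u \<notin> {1 / real (n + 3)..1 - 1 / real (n + 3)}" "u \<notin> {1 / real (N + 3)..1 - 1 / real (N + 3)}"
      using that by auto
    then show ?thesis using \<eta>supp by (simp add: q_def b_def)
  qed
  have hder: "(h n has_real_derivative q n u) (at u)" and hsupp: "u \<notin> {d n..1 - d n} \<Longrightarrow> h n u = 0" for n u
    unfolding h_def using compactly_supported_primitive[OF qc d qsupp qint] by blast+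
  have hm: "bmeas {0..1} (h n)" for n
    by (intro bmeas_continuous DERIV_continuous_on[OF has_field_derivative_at_within[OF hder]])
  have weak: "integral {0..1} (\<lambda>u. \<phi> u * q n u) = - (\<integral>u. \<psi> u * h n u \<partial>lebesgue_on {0..1})" for n
  proof -
    have "(\<integral>u. \<phi> u * q n u \<partial>lebesgue_on {0<..<1}) = - (\<integral>u. \<psi> u * h n u \<partial>lebesgue_on {0<..<1})"
    proof -
      have "0 < d n \<and> 1 - d n < 1 \<and> (\<forall>u. u \<notin> {d n..1 - d n} \<longrightarrow> h n u = 0) \<and>
          (\<forall>u. (h n has_real_derivative q n u) (at u)) \<and> continuous_on UNIV (q n)"
        by (intro conjI allI impI d(1) hder hsupp qc) (use d(1)[of n] in auto)
      then show ?thesis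
        using wd[unfolded is_weak_deriv_def, THEN spec, of "h n", THEN spec, of "q n", THEN spec, of "d n", THEN spec, of "1 - d n"]
        by (rule rev_mp)
    qed
    moreover have "(\<lambda>u. \<psi> u * h n u) \<in> borel_measurable (lebesgue_on {0..1})"
      using \<psi>m bmeas_measurable[OF hm[of n]] by (intro borel_measurable_times) auto
    ultimately show ?thesis
      using bmeas_measurable[OF bmeas_mult[OF \<phi> qm]]
      by (simp add: lebesgue_integral_open_closed bmeas_integral_eq[OF bmeas_mult[OF \<phi> qm]])
  qed
  have E: "(\<lambda>n. integral {0..1} (\<lambda>u. \<bar>q n u - e u\<bar>)) \<longlonglongrightarrow> 0"
  proof -
    have le: "integral {0..1} (\<lambda>u. \<bar>q n u - e u\<bar>) \<le> integral {0..1} (\<lambda>u. (1 - 1 * \<eta> n u) + \<bar>I n\<bar> * \<bar>b u\<bar>)" for n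
    proof (rule bmeas_integral_mono_AE)
      show "AE u in lebesgue_on {0..1}. \<bar>q n u - e u\<bar> \<le> (1 - 1 * \<eta> n u) + \<bar>I n\<bar> * \<bar>b u\<bar>"
      proof (rule AE_I2)
        fix u :: real
        have "q n u - e u = - (e u * (1 - \<eta> n u)) - I n * b u" by (simp add: q_def algebra_simps)
        then have "\<bar>q n u - e u\<bar> \<le> \<bar>e u\<bar> * \<bar>1 - \<eta> n u\<bar> + \<bar>I n\<bar> * \<bar>b u\<bar>"
          by (metis abs_minus_cancel abs_mult abs_triangle_ineq4)
        moreover have "\<bar>e u\<bar> * \<bar>1 - \<eta> n u\<bar> \<le> 1 * \<bar>1 - \<eta> n u\<bar>"
          by (intro mult_right_mono) (auto simp: e_def)
        moreover have "\<bar>1 - \<eta> n u\<bar> = 1 - \<eta> n u" using \<eta>b[of n u] by auto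
        ultimately show "\<bar>q n u - e u\<bar> \<le> (1 - 1 * \<eta> n u) + \<bar>I n\<bar> * \<bar>b u\<bar>" by simp
      qed
    qed (intro bmeas_intros qm em \<eta>m bm)+
    have eq: "integral {0..1} (\<lambda>u. (1 - 1 * \<eta> n u) + \<bar>I n\<bar> * \<bar>b u\<bar>) =
      (1 - integral {0..1} (\<lambda>u. 1 * \<eta> n u)) + \<bar>I n\<bar> * integral {0..1} (\<lambda>u. \<bar>b u\<bar>)" for n
      by (subst integral_add integral_diff | intro bmeas_integrable bmeas_intros \<eta>m bm)+ simp
    have lim: "(\<lambda>n. (1 - integral {0..1} (\<lambda>u. 1 * \<eta> n u)) + \<bar>I n\<bar> * integral {0..1} (\<lambda>u. \<bar>b u\<bar>))
      \<longlonglongrightarrow> (1 - integral {0..1} (\<lambda>u::real. 1::real)) + \<bar>0\<bar> * integral {0..1} (\<lambda>u. \<bar>b u\<bar>)"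
      by (intro tendsto_add tendsto_diff tendsto_mult tendsto_const tendsto_rabs I0 lim1[OF bmeas_const])
    show ?thesis
    proof (rule tendsto_dominated)
      have "0 \<le> integral {0..1} (\<lambda>u. \<bar>q n u - e u\<bar>)" for n
        by (intro integral_nonneg bmeas_integrable bmeas_intros qm em) auto
      then show "\<bar>integral {0..1} (\<lambda>u. \<bar>q n u - e u\<bar>) - 0\<bar> \<le>
          (1 - integral {0..1} (\<lambda>u. 1 * \<eta> n u)) + \<bar>I n\<bar> * integral {0..1} (\<lambda>u. \<bar>b u\<bar>)" for n
        using le[of n] unfolding eq by simp
      show "(\<lambda>n. (1 - integral {0..1} (\<lambda>u. 1 * \<eta> n u)) + \<bar>I n\<bar> * integral {0..1} (\<lambda>u. \<bar>b u\<bar>)) \<longlonglongrightarrow> 0"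
        using lim by simp
    qed
  qed
  define s where "s u = sin (real k * pi * u) / (real k * pi)" for u
  have sm: "bmeas {0..1} s" unfolding s_def by (intro bmeas_intros bmeas_sin)
  have hs: "\<bar>h n u - s u\<bar> \<le> integral {0..1} (\<lambda>u. \<bar>q n u - e u\<bar>)" if u: "u \<in> {0..1}" for n u
  proof -
    have "(e has_integral (s u - s 0)) {0..u}"
      unfolding e_def s_def using u False
      by (intro fundamental_theorem_of_calculus)
         (auto intro!: derivative_eq_intros simp flip: has_real_derivative_iff_has_vector_derivative)
    then have su: "s u = integral {0..u} e" by (simp add: integral_unique s_def)
    have sub: "bmeas {0..u} (q n)" "bmeas {0..u} e" using u by (auto intro!: bmeas_subset[OF qm] bmeas_subset[OF em])
    have "h n u - s u = integral {0..u} (\<lambda>x. q n x - e x)"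
      using u sub by (simp add: h_def su integral_diff bmeas_integrable)
    also have "\<bar>\<dots>\<bar> \<le> integral {0..u} (\<lambda>x. \<bar>q n x - e x\<bar>)"
      by (intro bmeas_abs_integral_le bmeas_intros sub)
    also have "\<dots> \<le> integral {0..1} (\<lambda>x. \<bar>q n x - e x\<bar>)"
      using u by (intro integral_subset_le bmeas_integrable bmeas_intros sub qm em) auto
    finally show ?thesis .
  qed
  have lhs: "(\<lambda>n. integral {0..1} (\<lambda>u. \<phi> u * q n u)) \<longlonglongrightarrow> cosine_coeff \<phi> k"
  proof -
    obtain B where B: "B > 0" "\<And>u. u \<in> {0..1} \<Longrightarrow> \<bar>\<phi> u\<bar> \<le> B" using bmeas_bound[OF \<phi>] by blast
    have "\<bar>integral {0..1} (\<lambda>u. \<phi> u * q n u) - cosine_coeff \<phi> k\<bar> \<le> B * integral {0..1} (\<lambda>u. \<bar>q n u - e u\<bar>)" for n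
    proof -
      have "integral {0..1} (\<lambda>u. \<phi> u * q n u) - cosine_coeff \<phi> k = integral {0..1} (\<lambda>u. \<phi> u * (q n u - e u))"
        unfolding cosine_coeff_def e_def[symmetric] right_diff_distrib
        by (intro integral_diff[symmetric] bmeas_integrable bmeas_intros \<phi> qm em)
      also have "\<bar>\<dots>\<bar> \<le> integral {0..1} (\<lambda>u. \<bar>\<phi> u * (q n u - e u)\<bar>)"
        by (intro bmeas_abs_integral_le bmeas_intros \<phi> qm em)
      also have "\<dots> \<le> integral {0..1} (\<lambda>u. B * \<bar>q n u - e u\<bar>)"
        by (intro integral_le bmeas_integrable bmeas_intros \<phi> qm em) (auto simp: abs_mult intro!: mult_right_mono B)
      finally show ?thesis by simp
    qed
    then show ?thesis
    proof (rule tendsto_dominated)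
      show "(\<lambda>n. B * integral {0..1} (\<lambda>u. \<bar>q n u - e u\<bar>)) \<longlonglongrightarrow> 0"
        using tendsto_mult[OF tendsto_const[of B] E] by simp
    qed
  qed
  have rhs: "(\<lambda>n. \<integral>u. \<psi> u * h n u \<partial>lebesgue_on {0..1}) \<longlonglongrightarrow> (\<integral>u. \<psi> u * s u \<partial>lebesgue_on {0..1})"
  proof -
    obtain C where C: "\<And>n. \<bar>integral {0..1} (\<lambda>u. \<bar>q n u - e u\<bar>)\<bar> \<le> C"
    proof -
      have "Bseq (\<lambda>n. integral {0..1} (\<lambda>u. \<bar>q n u - e u\<bar>))"
        using convergentI[OF E] by (rule convergent_imp_Bseq)
      then obtain K where "\<forall>n. norm (integral {0..1} (\<lambda>u. \<bar>q n u - e u\<bar>)) \<le> K"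
        by (auto elim: BseqE)
      then show thesis by (intro that[of K]) auto
    qed
    obtain D where D: "\<And>u. u \<in> {0..1} \<Longrightarrow> \<bar>s u\<bar> \<le> D" using bmeas_bound[OF sm] by blast
    have "integrable (lebesgue_on {0..1}) (\<lambda>u. \<psi> u * 1)"
      using \<psi>m by (intro square_integrable_mult_bounded bmeas_const) auto
    then have \<psi>i: "integrable (lebesgue_on {0..1}) (\<lambda>u. \<bar>\<psi> u\<bar> * (C + D))" by simp
    show ?thesis
    proof (rule integral_dominated_convergence[OF _ _ \<psi>i])
      show "(\<lambda>u. \<psi> u * s u) \<in> borel_measurable (lebesgue_on {0..1})"
        using \<psi>m bmeas_measurable[OF sm] by (intro borel_measurable_times) auto
      show "(\<lambda>u. \<psi> u * h n u) \<in> borel_measurable (lebesgue_on {0..1})" for n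
        using \<psi>m bmeas_measurable[OF hm[of n]] by (intro borel_measurable_times) auto
      show "AE u in lebesgue_on {0..1}. (\<lambda>n. \<psi> u * h n u) \<longlonglongrightarrow> \<psi> u * s u"
      proof (rule AE_I2)
        fix u :: real assume "u \<in> space (lebesgue_on {0..1})"
        then have "(\<lambda>n. h n u) \<longlonglongrightarrow> s u"
          using hs[of u] by (intro tendsto_dominated[OF _ E]) simp
        then show "(\<lambda>n. \<psi> u * h n u) \<longlonglongrightarrow> \<psi> u * s u" by (intro tendsto_intros)
      qed
      show "AE u in lebesgue_on {0..1}. norm (\<psi> u * h n u) \<le> \<bar>\<psi> u\<bar> * (C + D)" for n
      proof (rule AE_I2)
        fix u :: real assume "u \<in> space (lebesgue_on {0..1})"
        then have "\<bar>h n u\<bar> \<le> C + D" using hs[of u n] C[of n] D[of u] by auto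
        then show "norm (\<psi> u * h n u) \<le> \<bar>\<psi> u\<bar> * (C + D)" by (simp add: abs_mult mult_left_mono)
      qed
    qed
  qed
  have "cosine_coeff \<phi> k = - (\<integral>u. \<psi> u * s u \<partial>lebesgue_on {0..1})"
    using LIMSEQ_unique[OF lhs] tendsto_minus[OF rhs] unfolding weak by blast
  also have "\<dots> = - ((\<integral>u. \<psi> u * sin (real k * pi * u) \<partial>lebesgue_on {0..1}) / (real k * pi))"
    by (simp add: s_def)
  finally show ?thesis using False by simp
qed simp

text \<open>By Bessel's inequality for the weak derivative, \<open>k \<pi>\<close> times the cosine coefficients is square summable, so the
coefficients are absolutely summable; the cosine series then converges uniformly, and its sum has the same
coefficients as \<open>\<phi>\<close>.\<close>

lemma H1_continuous_representative:
  assumes H: "\<phi> \<in> H1" and \<phi>: "bmeas {0..1} \<phi>"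
  obtains W where "continuous_on {0..1} W" "AE u in lebesgue_on {0..1}. \<phi> u = W u"
proof -
  obtain \<psi> where \<psi>: "square_summable \<psi>" "is_weak_deriv \<phi> \<psi>" using H by (auto simp: H1_def)
  define c where "c k = cosine_coeff \<phi> k" for k
  define E where "E = (\<integral>u. (\<psi> u)\<^sup>2 \<partial>lebesgue_on {0..1})"
  have bessel: "2 * (\<Sum>k=1..n. (real k * pi * c k)\<^sup>2) \<le> E" for n
    using sine_bessel[of \<psi> n] \<psi>(1) cosine_coeff_weak_deriv[OF \<phi> \<psi>]
    by (simp add: c_def E_def square_summable_def)
  have "summable (\<lambda>k. (real k * pi * c k)\<^sup>2)"
  proof (rule summableI_nonneg_bounded[where x = E])
    fix n
    have "(\<Sum>k<n. (real k * pi * c k)\<^sup>2) = (\<Sum>k\<in>{..<n} - {0}. (real k * pi * c k)\<^sup>2)"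
      by (rule sum.mono_neutral_right) auto
    also have "\<dots> \<le> (\<Sum>k=1..n. (real k * pi * c k)\<^sup>2)"
      by (rule sum_mono2) auto
    also have "\<dots> \<le> 2 * (\<Sum>k=1..n. (real k * pi * c k)\<^sup>2)"
      using sum_nonneg[of "{1..n}" "\<lambda>k. (real k * pi * c k)\<^sup>2"] by simp
    also have "\<dots> \<le> E" by (rule bessel)
    finally show "(\<Sum>k<n. (real k * pi * c k)\<^sup>2) \<le> E" .
  qed simp
  then have sm: "summable (\<lambda>k. (real k * pi * c k)\<^sup>2 + 1 / real k ^ 2)"
    using inverse_power_summable[of 2, where 'a = real] by (intro summable_add) (auto simp: field_simps)
  define a where "a k = (if k = 0 then 1 else 2) * c k" for k :: nat
  have "\<bar>a k\<bar> \<le> (real k * pi * c k)\<^sup>2 + 1 / real k ^ 2" if "k \<ge> 1" for k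
  proof -
    \<comment> \<open>Absolute summability comes from \<open>2 x y \<le> x\<^sup>2 + y\<^sup>2\<close> with \<open>x = k |c k|\<close> and \<open>y = 1 / k\<close>.\<close>
    have "0 \<le> (real k * \<bar>c k\<bar> - 1 / real k)\<^sup>2" by simp
    then have "2 * \<bar>c k\<bar> \<le> (real k * \<bar>c k\<bar>)\<^sup>2 + 1 / real k ^ 2"
      using that by (simp add: power2_diff power_divide)
    also have "(real k * \<bar>c k\<bar>)\<^sup>2 \<le> (real k * pi * \<bar>c k\<bar>)\<^sup>2"
      using pi_ge_two by (intro power_mono mult_right_mono mult_left_le_one_le) (auto simp: mult_le_cancel_left1)
    finally show ?thesis using that by (simp add: a_def abs_mult power_mult_distrib)
  qed
  then have suma: "summable (\<lambda>k. \<bar>a k\<bar>)"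
    using sm by (intro summable_comparison_test[OF _ sm]) (auto intro!: exI[of _ 1])
  define P where "P n u = (\<Sum>k<n. a k * cos (real k * pi * u))" for n u
  define W where "W u = (\<Sum>k. a k * cos (real k * pi * u))" for u
  have ul: "uniform_limit UNIV P W sequentially"
    unfolding P_def W_def
    by (rule Weierstrass_m_test[OF _ suma]) (auto simp: abs_mult mult_left_le)
  have Pc: "continuous_on UNIV (P n)" for n unfolding P_def by (intro continuous_intros)
  have Wc: "continuous_on UNIV W"
    by (rule uniform_limit_theorem[OF _ ul]) (use Pc in auto)
  have Wm: "bmeas {0..1} W" and Pm: "bmeas {0..1} (P n)" for n
    using Wc Pc by (auto intro!: bmeas_continuous intro: continuous_on_subset)
  have PB: "\<bar>P n u\<bar> \<le> (\<Sum>k. \<bar>a k\<bar>)" for n u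
  proof -
    have "\<bar>P n u\<bar> \<le> (\<Sum>k<n. \<bar>a k * cos (real k * pi * u)\<bar>)" unfolding P_def by (rule sum_abs)
    also have "\<dots> \<le> (\<Sum>k<n. \<bar>a k\<bar>)" by (intro sum_mono) (simp add: abs_mult mult_left_le)
    also have "\<dots> \<le> (\<Sum>k. \<bar>a k\<bar>)" by (rule sum_le_suminf[OF suma]) auto
    finally show ?thesis .
  qed
  have coeff: "cosine_coeff W j = c j" for j
  proof -
    have lim: "(\<lambda>n. cosine_coeff (P n) j) \<longlonglongrightarrow> cosine_coeff W j"
      unfolding cosine_coeff_def
    proof (rule bmeas_tendsto_integral[where B = "\<Sum>k. \<bar>a k\<bar>"])
      show "AE x in lebesgue_on {0..1}. (\<lambda>n. P n x * cos (real j * pi * x)) \<longlonglongrightarrow> W x * cos (real j * pi * x)"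
        using tendsto_uniform_limitI[OF ul] by (intro AE_I2 tendsto_mult tendsto_const) auto
      show "AE x in lebesgue_on {0..1}. \<bar>P n x * cos (real j * pi * x)\<bar> \<le> (\<Sum>k. \<bar>a k\<bar>)" for n
        using PB by (intro AE_I2) (auto simp: abs_mult intro: order.trans[OF mult_left_le])
    qed (intro bmeas_intros Wm Pm bmeas_cos)+
    have ev: "\<forall>\<^sub>F n in sequentially. cosine_coeff (P n) j = c j"
    proof (rule eventually_sequentiallyI[of "Suc j"])
      fix n assume n: "Suc j \<le> n"
      have "cosine_coeff (P n) j = (\<Sum>k<n. a k * integral {0..1} (\<lambda>x. cos (real k * pi * x) * cos (real j * pi * x)))"
      proof -
        have "cosine_coeff (P n) j = integral {0..1} (\<lambda>x. \<Sum>k<n. a k * (cos (real k * pi * x) * cos (real j * pi * x)))"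
          unfolding cosine_coeff_def P_def sum_distrib_right by (simp add: mult.assoc)
        also have "\<dots> = (\<Sum>k<n. integral {0..1} (\<lambda>x. a k * (cos (real k * pi * x) * cos (real j * pi * x))))"
          by (intro integral_sum finite_lessThan bmeas_integrable bmeas_intros bmeas_cos)
        finally show ?thesis by simp
      qed
      also have "\<dots> = (\<Sum>k<n. if k = j then c j else 0)"
        unfolding integral_cos_cos by (intro sum.cong) (auto simp: a_def)
      also have "\<dots> = c j" using n by simp
      finally show "cosine_coeff (P n) j = c j" .
    qed
    show ?thesis by (rule LIMSEQ_unique[OF lim tendsto_eventually[OF ev]])
  qed
  have "AE x in lebesgue_on {0..1}. \<phi> x + (-1) * W x = 0"
  proof (rule cosine_coeff_unique)
    show "bmeas {0..1} (\<lambda>x. \<phi> x + (-1) * W x)" by (intro bmeas_intros \<phi> Wm)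
    show "cosine_coeff (\<lambda>x. \<phi> x + (-1) * W x) k = 0" for k
      unfolding cosine_coeff_add[OF \<phi> bmeas_mult[OF bmeas_const Wm]]
      using cosine_coeff_cmult[of "-1" W k] coeff[of k] by (simp add: c_def)
  qed
  then have "AE u in lebesgue_on {0..1}. \<phi> u = W u" by eventually_elim simp
  then show thesis using that continuous_on_subset[OF Wc] by blast
qed

lemma continuous_AE_eq_imp_eq:
  fixes v W :: "real \<Rightarrow> real"
  assumes "continuous_on {0<..<1} v" "continuous_on {0<..<1} W"
    and ae: "AE u in lebesgue_on {0<..<1}. v u = W u" and u: "u \<in> {0<..<1}"
  shows "v u = W u"
proof (rule ccontr)
  assume ne: "v u \<noteq> W u"
  let ?S = "{x \<in> {0<..<1}. v x - W x \<in> - {0}}"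
  have "continuous_on {0<..<1} (\<lambda>x. v x - W x)" using assms by (intro continuous_intros)
  then have "open ({0<..<1} \<inter> (\<lambda>x. v x - W x) -` (- {0}))"
    by (rule continuous_open_preimage) auto
  then have "open ?S" by (simp add: vimage_def Int_def)
  moreover have "?S \<noteq> {}" using ne u by auto
  ultimately have nn: "\<not> negligible ?S" by (rule open_not_negligible)
  have "AE x in lebesgue. x \<in> {0<..<1} \<longrightarrow> v x = W x"
    using ae by (subst (asm) AE_restrict_space_iff) auto
  then obtain N where N: "N \<in> null_sets lebesgue" "{x. \<not> (x \<in> {0<..<1} \<longrightarrow> v x = W x)} \<subseteq> N"
    unfolding completion.AE_iff_null_sets by auto
  then have "negligible N" by (simp add: negligible_iff_null_sets)
  then have "negligible ?S" by (rule negligible_subset) (use N(2) in auto)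
  with nn show False by simp
qed

text \<open>Two continuous representatives agree on the open interval, so the limit that defines the boundary value
does not depend on the representative.\<close>

lemma boundary_value_eq:
  assumes W: "continuous_on {0..1} W" and ae: "AE u in lebesgue_on {0..1}. \<phi> u = W u"
    and F: "F \<noteq> bot" "\<forall>\<^sub>F u in F. u \<in> {0<..<1}" and lim: "(W \<longlongrightarrow> l) F"
  shows "boundary_value F \<phi> = l"
proof -
  have W': "continuous_on {0<..<1} W" using W by (rule continuous_on_subset) auto
  have ae': "AE u in lebesgue_on {0<..<1}. \<phi> u = W u"
  proof -
    have "AE u in lebesgue. u \<in> {0..1} \<longrightarrow> \<phi> u = W u"
      using ae by (subst (asm) AE_restrict_space_iff) auto
    then have "AE u in lebesgue. u \<in> {0<..<1} \<longrightarrow> \<phi> u = W u" by eventually_elim auto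
    then show ?thesis by (subst AE_restrict_space_iff) auto
  qed
  show ?thesis
    unfolding boundary_value_def
  proof (rule the_equality)
    have "AE u in lebesgue_on {0<..<1}. W u = \<phi> u" using ae' by eventually_elim simp
    then show "\<exists>v. continuous_on {0<..<1} v \<and> (AE u in lebesgue_on {0<..<1}. v u = \<phi> u) \<and> (v \<longlongrightarrow> l) F"
      using W' lim by blast
  next
    fix l' assume "\<exists>v. continuous_on {0<..<1} v \<and> (AE u in lebesgue_on {0<..<1}. v u = \<phi> u) \<and> (v \<longlongrightarrow> l') F"
    then obtain v where v: "continuous_on {0<..<1} v" "AE u in lebesgue_on {0<..<1}. v u = \<phi> u" "(v \<longlongrightarrow> l') F"
      by blast
    have "AE u in lebesgue_on {0<..<1}. v u = W u" using v(2) ae' by eventually_elim simp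
    then have "\<forall>\<^sub>F u in F. v u = W u"
      by (intro eventually_mono[OF F(2) continuous_AE_eq_imp_eq[OF v(1) W']])
    then have "(W \<longlongrightarrow> l') F" by (rule Lim_transform_eventually[OF v(3)])
    then show "l' = l" using lim F(1) tendsto_unique by blast
  qed
qed

lemma boundary_value_ends:
  assumes W: "continuous_on {0..1} W" and ae: "AE u in lebesgue_on {0..1}. \<phi> u = W u"
  shows "boundary_value (at_right 0) \<phi> = W 0" "boundary_value (at_left 1) \<phi> = W 1"
proof -
  have "(W \<longlongrightarrow> W 0) (at 0 within {0..1})" "(W \<longlongrightarrow> W 1) (at 1 within {0..1})"
    using W by (auto simp: continuous_on)
  then have lim: "(W \<longlongrightarrow> W 0) (at_right 0)" "(W \<longlongrightarrow> W 1) (at_left 1)"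
    by (simp_all add: at_within_Icc_at_right at_within_Icc_at_left)
  have ev: "\<forall>\<^sub>F u in at_right 0. u \<in> {0<..<1::real}" "\<forall>\<^sub>F u in at_left 1. u \<in> {0<..<1::real}"
    by (rule eventually_at_right_real eventually_at_left_real, simp)+
  show "boundary_value (at_right 0) \<phi> = W 0"
    by (rule boundary_value_eq[OF W ae trivial_limit_at_right_real ev(1) lim(1)])
  show "boundary_value (at_left 1) \<phi> = W 1"
    by (rule boundary_value_eq[OF W ae trivial_limit_at_left_real ev(2) lim(2)])
qed

section \<open>Averages over time windows and triangles\<close>

lemma continuous_primitive:
  assumes "bmeas {a..b} f" shows "continuous_on {a..b} (\<lambda>t. integral {a..t} f)"
  by (rule indefinite_integral_continuous_1[OF bmeas_integrable[OF assms]])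

lemma bmeas_primitive: "bmeas {a..b} f \<Longrightarrow> bmeas {a..b} (\<lambda>t. integral {a..t} f)"
  by (rule bmeas_continuous[OF continuous_primitive])

lemma primitive_diff:
  assumes f: "bmeas {a..b} f" and st: "a \<le> s" "s \<le> t" "t \<le> b"
  shows "integral {a..t} f - integral {a..s} f = integral {s..t} f"
proof -
  have "integral {a..s} f + integral {s..t} f = integral {a..t} f"
    using st by (intro Henstock_Kurzweil_Integration.integral_combine bmeas_integrable bmeas_subset[OF f]) auto
  then show ?thesis by simp
qed

lemma primitive_lipschitz:
  assumes f: "bmeas {a..b} f" and st: "a \<le> s" "s \<le> t" "t \<le> b" and C: "\<And>x. x \<in> {a..b} \<Longrightarrow> \<bar>f x\<bar> \<le> C"
  shows "\<bar>integral {a..t} f - integral {a..s} f\<bar> \<le> C * (t - s)"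
  unfolding primitive_diff[OF f st]
  using st C by (intro bmeas_integral_abs_le bmeas_subset[OF f]) auto

text \<open>Such a function has derivative zero everywhere.\<close>

lemma quadratic_modulus_imp_constant:
  fixes f :: "real \<Rightarrow> real"
  assumes K: "\<And>s t. a \<le> s \<Longrightarrow> s \<le> t \<Longrightarrow> t \<le> b \<Longrightarrow> \<bar>f t - f s\<bar> \<le> K * (t - s)\<^sup>2" and ab: "a \<le> b"
  shows "f b = f a"
proof -
  have K': "\<bar>f y - f x\<bar> \<le> K * (y - x)\<^sup>2" if "x \<in> {a..b}" "y \<in> {a..b}" for x y
    using K[of x y] K[of y x] that by (cases "x \<le> y") (auto simp: abs_minus_commute power2_commute)
  have "(f has_field_derivative 0) (at x within {a..b})" if x: "x \<in> {a..b}" for x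
    unfolding has_field_derivative_iff
  proof (rule Lim_null_comparison)
    show "\<forall>\<^sub>F y in at x within {a..b}. norm ((f y - f x) / (y - x)) \<le> K * \<bar>y - x\<bar>"
      unfolding eventually_at_filter
    proof (intro always_eventually allI impI)
      fix y assume y: "y \<noteq> x" "y \<in> {a..b}"
      have "norm ((f y - f x) / (y - x)) \<le> (K * (y - x)\<^sup>2) / \<bar>y - x\<bar>"
        unfolding real_norm_def abs_divide using K'[OF x y(2)] by (intro divide_right_mono) auto
      also have "(K * (y - x)\<^sup>2) / \<bar>y - x\<bar> = K * \<bar>y - x\<bar>"
        using y(1) by (simp add: nonzero_divide_eq_eq mult.assoc power2_eq_square)
      finally show "norm ((f y - f x) / (y - x)) \<le> K * \<bar>y - x\<bar>" .
    qed
    have "((\<lambda>y. K * \<bar>y - x\<bar>) \<longlongrightarrow> K * \<bar>x - x\<bar>) (at x within {a..b})"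
      by (intro tendsto_intros)
    then show "((\<lambda>y. K * \<bar>y - x\<bar>) \<longlongrightarrow> 0) (at x within {a..b})" by simp
  qed
  then have "\<exists>c. \<forall>x\<in>{a..b}. f x = c"
    by (intro has_field_derivative_zero_constant convex_real_interval)
  then show ?thesis using ab by auto
qed

text \<open>This is the chain rule for \<open>D\<^sup>2\<close>, where \<open>D\<close> is the primitive of a function that is merely bounded and measurable.
The difference of the two sides, as a function of the upper limit, changes by at most a
multiple of the squared step, hence not at all. The identity is what turns the
one-sided average of a symmetric form into a square.\<close>

lemma square_of_primitive:
  assumes d: "bmeas {a..b} d" and ab: "a \<le> b"
  shows "(integral {a..b} d)\<^sup>2 = 2 * integral {a..b} (\<lambda>t. d t * integral {a..t} d)"
proof -
  define D where "D t = integral {a..t} d" for t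
  obtain C where C: "C > 0" "\<And>x. x \<in> {a..b} \<Longrightarrow> \<bar>d x\<bar> \<le> C" using bmeas_bound[OF d] by blast
  have Dm: "bmeas {a..b} D" unfolding D_def by (rule bmeas_primitive[OF d])
  have dD: "bmeas {a..b} (\<lambda>t. d t * D t)" by (intro bmeas_intros d Dm)
  define f where "f t = (D t)\<^sup>2 - 2 * integral {a..t} (\<lambda>s. d s * D s)" for t
  have "f b = f a"
  proof (rule quadratic_modulus_imp_constant[OF _ ab])
    fix s t assume st: "a \<le> s" "s \<le> t" "t \<le> b"
    have lip: "\<bar>D x - D s\<bar> \<le> C * (t - s)" if "x \<in> {s..t}" for x
    proof -
      have "\<bar>D x - D s\<bar> \<le> C * (x - s)"
        unfolding D_def using st that C by (intro primitive_lipschitz[OF d]) auto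
      also have "\<dots> \<le> C * (t - s)" using that C by (intro mult_left_mono) auto
      finally show ?thesis .
    qed
    have sub: "bmeas {s..t} d" "bmeas {s..t} D" using st by (auto intro!: bmeas_subset[OF d] bmeas_subset[OF Dm])
    have "integral {a..t} (\<lambda>s. d s * D s) - integral {a..s} (\<lambda>s. d s * D s) = integral {s..t} (\<lambda>x. d x * D x)"
      using primitive_diff[OF dD st] .
    also have "\<dots> = integral {s..t} (\<lambda>x. d x * (D x - D s)) + integral {s..t} (\<lambda>x. D s * d x)"
      by (subst integral_add[symmetric]) (auto intro!: bmeas_integrable bmeas_intros sub simp: algebra_simps)
    also have "integral {s..t} (\<lambda>x. D s * d x) = D s * (D t - D s)"
      using primitive_diff[OF d st] by (simp add: D_def)
    finally have e: "f t - f s = (D t - D s)\<^sup>2 - 2 * integral {s..t} (\<lambda>x. d x * (D x - D s))"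
      by (simp add: f_def power2_eq_square algebra_simps)
    define M where "M = C\<^sup>2 * (t - s)\<^sup>2"
    have "\<bar>integral {s..t} (\<lambda>x. d x * (D x - D s))\<bar> \<le> (C * (C * (t - s))) * (t - s)"
    proof (rule bmeas_integral_abs_le[OF _ st(2)])
      show "\<bar>d x * (D x - D s)\<bar> \<le> C * (C * (t - s))" if "x \<in> {s..t}" for x
        unfolding abs_mult using lip[OF that] C st that by (intro mult_mono) auto
    qed (intro bmeas_intros sub)
    also have "\<dots> = M" by (simp add: M_def power2_eq_square)
    finally have 1: "\<bar>integral {s..t} (\<lambda>x. d x * (D x - D s))\<bar> \<le> M" .
    have "\<bar>D t - D s\<bar>\<^sup>2 \<le> (C * (t - s))\<^sup>2"
      using lip[of t] st by (intro power_mono) auto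
    then have 2: "(D t - D s)\<^sup>2 \<le> M" by (simp add: M_def power_mult_distrib)
    have 3: "0 \<le> (D t - D s)\<^sup>2" by simp
    have "\<bar>f t - f s\<bar> \<le> 3 * M" unfolding e using 1 2 3 by linarith
    then show "\<bar>f t - f s\<bar> \<le> (3 * C\<^sup>2) * (t - s)\<^sup>2" by (simp add: M_def)
  qed
  then show ?thesis by (simp add: f_def D_def)
qed

text \<open>The window integral is an increment of the primitive, so all but the two boundary layers of width \<open>h\<close> cancel.\<close>

lemma integral_of_increments:
  assumes p: "bmeas {0..T} p" and h: "0 \<le> h" "h \<le> T"
  shows "integral {0..T - h} (\<lambda>r. integral {r..r + h} p) =
    integral {T - h..T} (\<lambda>t. integral {0..t} p) - integral {0..h} (\<lambda>t. integral {0..t} p)"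
    and "continuous_on {0..T - h} (\<lambda>r. integral {r..r + h} p)"
proof -
  define P where "P t = integral {0..t} p" for t
  have P: "bmeas {0..T} P" and Pc: "continuous_on {0..T} P"
    unfolding P_def by (rule bmeas_primitive[OF p], rule continuous_primitive[OF p])
  have eq: "integral {r..r + h} p = P (r + h) - P r" if "r \<in> {0..T - h}" for r
    unfolding P_def using that h by (intro primitive_diff[OF p, symmetric]) auto
  have c1: "continuous_on {0..T - h} (\<lambda>r. P (r + h))"
    by (rule continuous_on_compose2[OF Pc]) (use h in \<open>auto intro!: continuous_intros\<close>)
  have c2: "continuous_on {0..T - h} P" using Pc by (rule continuous_on_subset) (use h in auto)
  show "continuous_on {0..T - h} (\<lambda>r. integral {r..r + h} p)"
    by (rule continuous_on_eq[where f = "\<lambda>r. P (r + h) - P r"]) (auto simp: eq intro!: continuous_intros c1 c2)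
  have "integral {0..T - h} (\<lambda>r. integral {r..r + h} p) = integral {0..T - h} (\<lambda>r. P (r + h) - P r)"
    by (intro integral_cong eq)
  also have "\<dots> = integral {0..T - h} (\<lambda>r. P (r + h)) - integral {0..T - h} P"
    by (intro integral_diff bmeas_integrable bmeas_continuous c1 c2)
  also have "integral {0..T - h} (\<lambda>r. P (r + h)) = integral {h..T} P"
    using integral_shift_real_ivl[of h h T P] by simp
  also have "integral {h..T} P = integral {0..T} P - integral {0..h} P"
    using primitive_diff[OF P, of h T] h by simp
  also have "integral {0..T - h} P = integral {0..T} P - integral {T - h..T} P"
    using primitive_diff[OF P, of "T - h" T] h by simp
  finally show "integral {0..T - h} (\<lambda>r. integral {r..r + h} p) =
    integral {T - h..T} (\<lambda>t. integral {0..t} p) - integral {0..h} (\<lambda>t. integral {0..t} p)"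
    by (simp add: P_def[abs_def])
qed

lemma integral_of_increments_bounds:
  assumes p: "bmeas {0..T} p" and h: "0 \<le> h" "h \<le> T" and C: "\<And>t. t \<in> {0..T} \<Longrightarrow> \<bar>p t\<bar> \<le> C"
  shows "\<bar>integral {0..T - h} (\<lambda>r. integral {r..r + h} p) - h * integral {0..T} p\<bar> \<le> 2 * C * h\<^sup>2"
proof -
  define P where "P t = integral {0..t} p" for t
  have P: "bmeas {0..T} P" unfolding P_def by (rule bmeas_primitive[OF p])
  have C0: "0 \<le> C" using C[of 0] h by auto
  have P0: "bmeas {T - h..T} P" "bmeas {0..h} P" using h by (auto intro!: bmeas_subset[OF P])
  have "\<bar>integral {T - h..T} (\<lambda>t. P t - P T)\<bar> \<le> (C * h) * (T - (T - h))"
  proof (rule bmeas_integral_abs_le)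
    fix t assume t: "t \<in> {T - h..T}"
    have "\<bar>P T - P t\<bar> \<le> C * (T - t)" unfolding P_def
      using t h C by (intro primitive_lipschitz[OF p]) auto
    also have "\<dots> \<le> C * h" using t C0 by (intro mult_left_mono) auto
    finally show "\<bar>P t - P T\<bar> \<le> C * h" by (simp add: abs_minus_commute)
  qed (use h in \<open>auto intro!: bmeas_intros P0\<close>)
  moreover have "integral {T - h..T} (\<lambda>t. P t - P T) = integral {T - h..T} P - h * P T"
    using h by (subst integral_diff) (auto intro!: bmeas_integrable bmeas_intros P0)
  moreover have "\<bar>integral {0..h} P\<bar> \<le> (C * h) * (h - 0)"
  proof (rule bmeas_integral_abs_le)
    fix t assume t: "t \<in> {0..h}"
    have "\<bar>P t - P 0\<bar> \<le> C * (t - 0)" unfolding P_def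
      using t h C by (intro primitive_lipschitz[OF p]) auto
    also have "\<dots> \<le> C * h" using t C0 by (intro mult_left_mono) auto
    finally show "\<bar>P t\<bar> \<le> C * h" by (simp add: P_def)
  qed (use h in \<open>auto intro!: bmeas_intros P0\<close>)
  ultimately show ?thesis
    unfolding integral_of_increments(1)[OF p h] P_def[symmetric]
    by (simp add: power2_eq_square P_def[abs_def] abs_le_iff algebra_simps)
qed

lemma integral_of_increments_nonneg:
  assumes p: "bmeas {0..T} p" and h: "0 \<le> h" "h \<le> T" and p0: "\<And>t. t \<in> {0..T} \<Longrightarrow> 0 \<le> p t"
  shows "integral {0..T - h} (\<lambda>r. integral {r..r + h} p) \<le> h * integral {0..T} p"
proof -
  define P where "P t = integral {0..t} p" for t
  have P: "bmeas {0..T} P" unfolding P_def by (rule bmeas_primitive[OF p])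
  have mono: "P s \<le> P t" if "0 \<le> s" "s \<le> t" "t \<le> T" for s t
  proof -
    have "0 \<le> integral {s..t} p"
      using that p0 by (intro integral_nonneg bmeas_integrable bmeas_subset[OF p]) auto
    then show ?thesis using primitive_diff[OF p that] by (simp add: P_def)
  qed
  have P0: "bmeas {T - h..T} P" "bmeas {0..h} P" using h by (auto intro!: bmeas_subset[OF P])
  have "integral {T - h..T} P \<le> integral {T - h..T} (\<lambda>_. P T)"
    using h by (intro integral_le bmeas_integrable bmeas_intros P0 mono) auto
  then have "integral {T - h..T} P \<le> h * P T" using h by simp
  moreover have "0 \<le> integral {0..h} P"
    using h mono[of 0] by (intro integral_nonneg bmeas_integrable P0) (auto simp: P_def)
  ultimately show ?thesis
    unfolding integral_of_increments(1)[OF p h] P_def[symmetric] by (simp add: P_def[abs_def])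
qed

definition triangle_int :: "(real \<Rightarrow> real) \<Rightarrow> (real \<Rightarrow> real) \<Rightarrow> real \<Rightarrow> real \<Rightarrow> real" where
  "triangle_int f g h r = integral {r..r + h} (\<lambda>t. f t * integral {r..t} g)"

text \<open>The triangle \<open>r \<le> s \<le> t \<le> r + h\<close> has area \<open>h\<^sup>2 / 2\<close>, hence the normalization.\<close>

definition triangle_mean :: "real \<Rightarrow> (real \<Rightarrow> real) \<Rightarrow> (real \<Rightarrow> real) \<Rightarrow> real \<Rightarrow> real" where
  "triangle_mean T f g h = 2 / h\<^sup>2 * integral {0..T - h} (triangle_int f g h)"

lemma bmeas_times_primitive:
  assumes "bmeas {0..T} f" "bmeas {0..T} g" "0 \<le> r" "s \<le> T"
  shows "bmeas {r..s} (\<lambda>t. f t * integral {r..t} g)"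
  using assms by (intro bmeas_mult bmeas_primitive bmeas_subset[of "{0..T}" _ "{r..s}"]) auto

lemma continuous_triangle_int:
  assumes f: "bmeas {0..T} f" and g: "bmeas {0..T} g" and h: "0 \<le> h" "h \<le> T"
  shows "continuous_on {0..T - h} (triangle_int f g h)"
proof -
  define F where "F t = integral {0..t} f" for t
  define G where "G t = integral {0..t} g" for t
  have Gm: "bmeas {0..T} G" unfolding G_def by (rule bmeas_primitive[OF g])
  define K where "K t = integral {0..t} (\<lambda>s. f s * G s)" for t
  have fG: "bmeas {0..T} (\<lambda>s. f s * G s)" by (intro bmeas_intros f Gm)
  have eq: "triangle_int f g h r = (K (r + h) - K r) - G r * (F (r + h) - F r)" if r: "r \<in> {0..T - h}" for r
  proof -
    have sub: "bmeas {r..r + h} f" "bmeas {r..r + h} G"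
      using r h by (auto intro!: bmeas_subset[OF f] bmeas_subset[OF Gm])
    have "triangle_int f g h r = integral {r..r + h} (\<lambda>t. f t * G t - G r * f t)"
      unfolding triangle_int_def
    proof (intro integral_cong)
      fix t assume t: "t \<in> {r..r + h}"
      have "integral {r..t} g = G t - G r"
        unfolding G_def using t r h by (intro primitive_diff[OF g, symmetric]) auto
      then show "f t * integral {r..t} g = f t * G t - G r * f t" by (simp add: right_diff_distrib mult.commute)
    qed
    also have "\<dots> = integral {r..r + h} (\<lambda>t. f t * G t) - integral {r..r + h} (\<lambda>t. G r * f t)"
      by (intro integral_diff bmeas_integrable bmeas_intros sub)
    also have "integral {r..r + h} (\<lambda>t. f t * G t) = K (r + h) - K r"
      unfolding K_def using r h by (intro primitive_diff[OF fG, symmetric]) auto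
    also have "integral {r..r + h} (\<lambda>t. G r * f t) = G r * (F (r + h) - F r)"
      unfolding F_def using r h by (simp add: primitive_diff[OF f])
    finally show ?thesis .
  qed
  have shift: "continuous_on {0..T - h} (\<lambda>r. P (r + h))" "continuous_on {0..T - h} P"
    if "continuous_on {0..T} P" for P :: "real \<Rightarrow> real"
    by (rule continuous_on_compose2[OF that] continuous_on_subset[OF that];
        use h in \<open>auto intro!: continuous_intros\<close>)+
  have cF: "continuous_on {0..T} F" unfolding F_def by (rule continuous_primitive[OF f])
  have cG: "continuous_on {0..T} G" unfolding G_def by (rule continuous_primitive[OF g])
  have cK: "continuous_on {0..T} K" unfolding K_def by (rule continuous_primitive[OF fG])
  show ?thesis
    by (rule continuous_on_eq[where f = "\<lambda>r. (K (r + h) - K r) - G r * (F (r + h) - F r)"])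
       (auto simp: eq intro!: continuous_on_diff continuous_on_mult shift(1)[OF cK] shift(2)[OF cK] shift(2)[OF cG] shift(1)[OF cF] shift(2)[OF cF])
qed

lemma bmeas_triangle_int:
  "bmeas {0..T} f \<Longrightarrow> bmeas {0..T} g \<Longrightarrow> 0 \<le> h \<Longrightarrow> h \<le> T \<Longrightarrow> bmeas {0..T - h} (triangle_int f g h)"
  by (rule bmeas_continuous[OF continuous_triangle_int])

lemma triangle_int_diff_left:
  assumes f: "bmeas {0..T} f" "bmeas {0..T} f'" and g: "bmeas {0..T} g" and r: "0 \<le> r" "r + h \<le> T"
  shows "triangle_int (\<lambda>t. f t - f' t) g h r = triangle_int f g h r - triangle_int f' g h r"
  unfolding triangle_int_def left_diff_distrib
  by (intro integral_diff bmeas_integrable bmeas_times_primitive[OF f(1) g r] bmeas_times_primitive[OF f(2) g r])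

lemma triangle_int_diff_right:
  assumes f: "bmeas {0..T} f" and g: "bmeas {0..T} g" "bmeas {0..T} g'" and r: "0 \<le> r" "r + h \<le> T"
  shows "triangle_int f (\<lambda>t. g t - g' t) h r = triangle_int f g h r - triangle_int f g' h r"
proof -
  have "triangle_int f (\<lambda>t. g t - g' t) h r = integral {r..r + h} (\<lambda>t. f t * integral {r..t} g - f t * integral {r..t} g')"
    unfolding triangle_int_def
  proof (intro integral_cong)
    fix t assume t: "t \<in> {r..r + h}"
    have "integral {r..t} (\<lambda>t. g t - g' t) = integral {r..t} g - integral {r..t} g'"
      using t r by (intro integral_diff bmeas_integrable bmeas_subset[OF g(1)] bmeas_subset[OF g(2)]) auto
    then show "f t * integral {r..t} (\<lambda>t. g t - g' t) = f t * integral {r..t} g - f t * integral {r..t} g'"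
      by (simp add: right_diff_distrib)
  qed
  also have "\<dots> = triangle_int f g h r - triangle_int f g' h r"
    unfolding triangle_int_def
    by (intro integral_diff bmeas_integrable bmeas_times_primitive[OF f g(1) r] bmeas_times_primitive[OF f g(2) r])
  finally show ?thesis .
qed

lemma triangle_mean_diff_left:
  assumes f: "bmeas {0..T} f" "bmeas {0..T} f'" and g: "bmeas {0..T} g" and h: "0 \<le> h" "h \<le> T"
  shows "triangle_mean T (\<lambda>t. f t - f' t) g h = triangle_mean T f g h - triangle_mean T f' g h"
proof -
  have "integral {0..T - h} (triangle_int (\<lambda>t. f t - f' t) g h) =
      integral {0..T - h} (\<lambda>r. triangle_int f g h r - triangle_int f' g h r)"
    by (intro integral_cong triangle_int_diff_left[OF f g]) auto
  also have "\<dots> = integral {0..T - h} (triangle_int f g h) - integral {0..T - h} (triangle_int f' g h)"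
    by (intro integral_diff bmeas_integrable bmeas_triangle_int f g h)
  finally show ?thesis by (simp add: triangle_mean_def right_diff_distrib)
qed

lemma triangle_mean_diff_right:
  assumes f: "bmeas {0..T} f" and g: "bmeas {0..T} g" "bmeas {0..T} g'" and h: "0 \<le> h" "h \<le> T"
  shows "triangle_mean T f (\<lambda>t. g t - g' t) h = triangle_mean T f g h - triangle_mean T f g' h"
proof -
  have "integral {0..T - h} (triangle_int f (\<lambda>t. g t - g' t) h) =
      integral {0..T - h} (\<lambda>r. triangle_int f g h r - triangle_int f g' h r)"
    by (intro integral_cong triangle_int_diff_right[OF f g]) auto
  also have "\<dots> = integral {0..T - h} (triangle_int f g h) - integral {0..T - h} (triangle_int f g' h)"
    by (intro integral_diff bmeas_integrable bmeas_triangle_int f g h)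
  finally show ?thesis by (simp add: triangle_mean_def right_diff_distrib)
qed

lemma triangle_int_bound:
  assumes f: "bmeas {0..T} f" and g: "bmeas {0..T} g" and r: "0 \<le> r" "r + h \<le> T" "0 \<le> h"
  shows "(\<And>t. t \<in> {0..T} \<Longrightarrow> \<bar>f t\<bar> \<le> A) \<Longrightarrow>
      \<bar>triangle_int f g h r\<bar> \<le> (A * h) * integral {r..r + h} (\<lambda>s. \<bar>g s\<bar>)"
    and "(\<And>t. t \<in> {0..T} \<Longrightarrow> \<bar>g t\<bar> \<le> B) \<Longrightarrow>
      \<bar>triangle_int f g h r\<bar> \<le> (B * h) * integral {r..r + h} (\<lambda>s. \<bar>f s\<bar>)"
proof -
  have sub: "bmeas {r..t} f" "bmeas {r..t} g" if "t \<le> r + h" for t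
    using that r by (auto intro!: bmeas_subset[OF f] bmeas_subset[OF g])
  have m: "bmeas {r..r + h} (\<lambda>t. f t * integral {r..t} g)"
    using r by (intro bmeas_times_primitive[OF f g]) auto
  {
    assume A: "\<And>t. t \<in> {0..T} \<Longrightarrow> \<bar>f t\<bar> \<le> A"
    let ?I = "integral {r..r + h} (\<lambda>s. \<bar>g s\<bar>)"
    have A0: "0 \<le> A" using A[of r] r by auto
    have "\<bar>triangle_int f g h r\<bar> \<le> (A * ?I) * ((r + h) - r)"
      unfolding triangle_int_def
    proof (rule bmeas_integral_abs_le[OF m])
      fix t assume t: "t \<in> {r..r + h}"
      have "\<bar>integral {r..t} g\<bar> \<le> integral {r..t} (\<lambda>s. \<bar>g s\<bar>)"
        using t by (intro bmeas_abs_integral_le sub) auto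
      also have "\<dots> \<le> ?I"
        using t by (intro integral_subset_le bmeas_integrable bmeas_abs sub) auto
      finally show "\<bar>f t * integral {r..t} g\<bar> \<le> A * ?I"
        unfolding abs_mult using A[of t] A0 t r by (intro mult_mono) auto
    qed (use r in auto)
    then show "\<bar>triangle_int f g h r\<bar> \<le> (A * h) * ?I" by (simp add: mult_ac)
  }
  {
    assume B: "\<And>t. t \<in> {0..T} \<Longrightarrow> \<bar>g t\<bar> \<le> B"
    have B0: "0 \<le> B" using B[of r] r by auto
    have "\<bar>triangle_int f g h r\<bar> \<le> integral {r..r + h} (\<lambda>t. \<bar>f t * integral {r..t} g\<bar>)"
      unfolding triangle_int_def by (rule bmeas_abs_integral_le[OF m])
    also have "\<dots> \<le> integral {r..r + h} (\<lambda>t. (B * h) * \<bar>f t\<bar>)"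
    proof (intro integral_le bmeas_integrable bmeas_abs m bmeas_mult bmeas_const sub order_refl)
      fix t assume t: "t \<in> {r..r + h}"
      have "\<bar>integral {r..t} g\<bar> \<le> B * (t - r)"
        using t r B by (intro bmeas_integral_abs_le sub) auto
      also have "\<dots> \<le> B * h" using t B0 by (intro mult_left_mono) auto
      finally have "\<bar>f t\<bar> * \<bar>integral {r..t} g\<bar> \<le> \<bar>f t\<bar> * (B * h)" by (rule mult_left_mono) simp
      then show "\<bar>f t * integral {r..t} g\<bar> \<le> (B * h) * \<bar>f t\<bar>" by (simp add: abs_mult mult_ac)
    qed
    finally show "\<bar>triangle_int f g h r\<bar> \<le> (B * h) * integral {r..r + h} (\<lambda>s. \<bar>f s\<bar>)" by simp
  }
qed

text \<open>The hypothesis on \<open>triangle_int\<close> is available with \<open>p = f\<close> and with \<open>p = g\<close>, by bounding the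
other factor uniformly. The conclusion is the continuity of the mean in the \<open>L\<^sup>1\<close> norm of either factor.\<close>

lemma triangle_mean_bound:
  assumes f: "bmeas {0..T} f" and g: "bmeas {0..T} g" and h: "0 < h" "h \<le> T" and C: "0 \<le> C"
    and p: "bmeas {0..T} p"
    and bd: "\<And>r. 0 \<le> r \<Longrightarrow> r + h \<le> T \<Longrightarrow> \<bar>triangle_int f g h r\<bar> \<le> (C * h) * integral {r..r + h} (\<lambda>s. \<bar>p s\<bar>)"
  shows "\<bar>triangle_mean T f g h\<bar> \<le> 2 * C * integral {0..T} (\<lambda>s. \<bar>p s\<bar>)"
proof -
  have h': "0 \<le> h" using h by simp
  note ti = bmeas_triangle_int[OF f g h' h(2)]
  have pa: "bmeas {0..T} (\<lambda>s. \<bar>p s\<bar>)" by (intro bmeas_abs p)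
  have "\<bar>integral {0..T - h} (triangle_int f g h)\<bar> \<le> integral {0..T - h} (\<lambda>r. \<bar>triangle_int f g h r\<bar>)"
    by (rule bmeas_abs_integral_le[OF ti])
  also have "\<dots> \<le> integral {0..T - h} (\<lambda>r. (C * h) * integral {r..r + h} (\<lambda>s. \<bar>p s\<bar>))"
    by (intro integral_le bmeas_integrable bmeas_abs ti bmeas_mult bmeas_const
        bmeas_continuous[OF integral_of_increments(2)[OF pa h' h(2)]] bd) auto
  also have "\<dots> = (C * h) * integral {0..T - h} (\<lambda>r. integral {r..r + h} (\<lambda>s. \<bar>p s\<bar>))" by simp
  also have "\<dots> \<le> (C * h) * (h * integral {0..T} (\<lambda>s. \<bar>p s\<bar>))"
    using C h by (intro mult_left_mono integral_of_increments_nonneg[OF pa h' h(2)]) auto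
  finally have "\<bar>integral {0..T - h} (triangle_int f g h)\<bar> \<le> h\<^sup>2 * (C * integral {0..T} (\<lambda>s. \<bar>p s\<bar>))"
    by (simp add: power2_eq_square mult_ac)
  then have "2 / h\<^sup>2 * \<bar>integral {0..T - h} (triangle_int f g h)\<bar> \<le> 2 / h\<^sup>2 * (h\<^sup>2 * (C * integral {0..T} (\<lambda>s. \<bar>p s\<bar>)))"
    by (intro mult_left_mono) auto
  then show ?thesis using h by (simp add: triangle_mean_def abs_mult)
qed

text \<open>By uniform continuity \<open>f t * g s\<close> is close to \<open>f r * g r\<close> on the whole triangle based at \<open>r\<close>.\<close>

lemma triangle_mean_continuous:
  assumes f: "continuous_on {0..T} f" and g: "continuous_on {0..T} g"
    and h: "\<And>n. 0 < h n" "\<And>n. h n \<le> T" "h \<longlonglongrightarrow> 0"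
  shows "(\<lambda>n. triangle_mean T f g (h n)) \<longlonglongrightarrow> integral {0..T} (\<lambda>t. f t * g t)"
proof (rule LIMSEQ_I)
  fix e :: real assume e: "0 < e"
  have T: "0 < T" using h(1)[of 0] h(2)[of 0] by linarith
  have fm: "bmeas {0..T} f" and gm: "bmeas {0..T} g" using f g by (auto intro: bmeas_continuous)
  have fgm: "bmeas {0..T} (\<lambda>t. f t * g t)" by (intro bmeas_mult fm gm)
  obtain A where A: "A > 0" "\<And>x. x \<in> {0..T} \<Longrightarrow> \<bar>f x\<bar> \<le> A" using bmeas_bound[OF fm] by blast
  obtain B where B: "B > 0" "\<And>x. x \<in> {0..T} \<Longrightarrow> \<bar>g x\<bar> \<le> B" using bmeas_bound[OF gm] by blast
  define \<epsilon> where "\<epsilon> = e / (4 * T)"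
  have \<epsilon>: "\<epsilon> > 0" using e T by (simp add: \<epsilon>_def)
  have "uniformly_continuous_on ({0..T} \<times> {0..T}) (\<lambda>z. f (fst z) * g (snd z))"
    by (intro compact_uniformly_continuous compact_Times compact_Icc continuous_on_mult
        continuous_on_compose2[OF f continuous_on_fst[OF continuous_on_id]]
        continuous_on_compose2[OF g continuous_on_snd[OF continuous_on_id]]) auto
  then obtain d where d: "d > 0" and dd: "\<And>z z'. z \<in> {0..T} \<times> {0..T} \<Longrightarrow> z' \<in> {0..T} \<times> {0..T} \<Longrightarrow>
      dist z' z < d \<Longrightarrow> \<bar>f (fst z') * g (snd z') - f (fst z) * g (snd z)\<bar> < \<epsilon>"
    unfolding uniformly_continuous_on_def dist_real_def using \<epsilon> by metis
  \<comment> \<open>The second bound makes the boundary layer \<open>[T - h, T]\<close>, which the means do not see, negligible.\<close>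
  define d' where "d' = min (d / 2) (e / (4 * A * B))"
  have d': "d' > 0" using d e A B by (simp add: d'_def)
  have "\<forall>\<^sub>F n in sequentially. h n < d'" using h(3) d' by (rule order_tendstoD)
  then obtain N where N: "\<And>n. n \<ge> N \<Longrightarrow> h n < d'" by (auto simp: eventually_sequentially)
  show "\<exists>no. \<forall>n\<ge>no. norm (triangle_mean T f g (h n) - integral {0..T} (\<lambda>t. f t * g t)) < e"
  proof (intro exI allI impI)
    fix n assume n: "n \<ge> N"
    define k where "k = h n"
    have k: "0 < k" "k \<le> T" "k < d / 2" "k < e / (4 * A * B)"
      using h N[OF n] by (auto simp: k_def d'_def)
    have ti: "bmeas {0..T - k} (triangle_int f g k)" using k by (intro bmeas_triangle_int fm gm) auto
    have fg': "bmeas {0..T - k} (\<lambda>t. f t * g t)" using k by (intro bmeas_subset[OF fgm]) auto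
    have point: "\<bar>2 / k\<^sup>2 * triangle_int f g k r - f r * g r\<bar> \<le> 2 * \<epsilon>" if r: "r \<in> {0..T - k}" for r
    proof -
      have sub: "bmeas {r..t} g" if "t \<in> {r..r + k}" for t
        using that r by (intro bmeas_subset[OF gm]) auto
      have tri: "integral {r..r + k} (\<lambda>t. f r * g r * (t - r)) = f r * g r * (k\<^sup>2 / 2)"
      proof -
        have "((\<lambda>t. t - r) has_integral ((r + k - r)\<^sup>2 / 2 - (r - r)\<^sup>2 / 2)) {r..r + k}"
          using k by (intro fundamental_theorem_of_calculus)
            (auto intro!: derivative_eq_intros simp flip: has_real_derivative_iff_has_vector_derivative)
        then show ?thesis by (simp add: integral_unique)
      qed
      have m1: "bmeas {r..r + k} (\<lambda>t. f t * integral {r..t} g)"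
        using r by (intro bmeas_times_primitive[OF fm gm]) auto
      have m2: "bmeas {r..r + k} (\<lambda>t. f r * g r * (t - r))"
        by (intro bmeas_continuous continuous_intros)
      have "triangle_int f g k r - f r * g r * (k\<^sup>2 / 2) =
          integral {r..r + k} (\<lambda>t. f t * integral {r..t} g - f r * g r * (t - r))"
        unfolding triangle_int_def tri[symmetric] by (intro integral_diff[symmetric] bmeas_integrable m1 m2)
      also have "\<bar>\<dots>\<bar> \<le> (\<epsilon> * k) * ((r + k) - r)"
      proof (rule bmeas_integral_abs_le)
        fix t assume t: "t \<in> {r..r + k}"
        have "f t * integral {r..t} g - f r * g r * (t - r) = integral {r..t} (\<lambda>s. f t * g s - f r * g r)"
          using t sub[OF t] by (subst integral_diff) (auto intro!: bmeas_integrable bmeas_intros)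
        also have "\<bar>\<dots>\<bar> \<le> \<epsilon> * (t - r)"
        proof (rule bmeas_integral_abs_le)
          fix s assume s: "s \<in> {r..t}"
          have "dist (t, s) (r, r) \<le> \<bar>t - r\<bar> + \<bar>s - r\<bar>"
            by (simp add: dist_Pair_Pair dist_real_def sqrt_sum_squares_le_sum_abs)
          also have "\<dots> < d" using s t k by auto
          finally show "\<bar>f t * g s - f r * g r\<bar> \<le> \<epsilon>"
            using dd[of "(r, r)" "(t, s)"] s t r k by auto
        qed (use t sub[OF t] in \<open>auto intro!: bmeas_intros\<close>)
        also have "\<dots> \<le> \<epsilon> * k" using t \<epsilon> by (intro mult_left_mono) auto
        finally show "\<bar>f t * integral {r..t} g - f r * g r * (t - r)\<bar> \<le> \<epsilon> * k" .
      qed (use k in \<open>auto intro!: bmeas_diff m1 m2\<close>)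
      finally have "\<bar>triangle_int f g k r - f r * g r * (k\<^sup>2 / 2)\<bar> \<le> \<epsilon> * k\<^sup>2"
        by (simp add: power2_eq_square mult_ac)
      then have "2 / k\<^sup>2 * \<bar>triangle_int f g k r - f r * g r * (k\<^sup>2 / 2)\<bar> \<le> 2 / k\<^sup>2 * (\<epsilon> * k\<^sup>2)"
        by (intro mult_left_mono) auto
      moreover have "2 / k\<^sup>2 * (\<epsilon> * k\<^sup>2) = 2 * \<epsilon>" using k by simp
      moreover have "2 / k\<^sup>2 * triangle_int f g k r - f r * g r = 2 / k\<^sup>2 * (triangle_int f g k r - f r * g r * (k\<^sup>2 / 2))"
        using k by (simp add: right_diff_distrib)
      moreover have "\<bar>2 / k\<^sup>2 * X\<bar> = 2 / k\<^sup>2 * \<bar>X\<bar>" for X by (simp add: abs_mult)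
      ultimately show ?thesis by (simp only:)
    qed
    have "triangle_mean T f g k - integral {0..T - k} (\<lambda>t. f t * g t) =
        integral {0..T - k} (\<lambda>r. 2 / k\<^sup>2 * triangle_int f g k r - f r * g r)"
      by (subst integral_diff) (auto simp: triangle_mean_def intro!: bmeas_integrable bmeas_intros ti fg')
    also have "\<bar>\<dots>\<bar> \<le> (2 * \<epsilon>) * ((T - k) - 0)"
      using k by (intro bmeas_integral_abs_le point bmeas_diff bmeas_mult bmeas_const ti fg') auto
    also have "\<dots> \<le> (2 * \<epsilon>) * T" using \<epsilon> k by (intro mult_left_mono) auto
    also have "\<dots> = e / 2" using T by (simp add: \<epsilon>_def)
    finally have 1: "\<bar>triangle_mean T f g k - integral {0..T - k} (\<lambda>t. f t * g t)\<bar> \<le> e / 2" .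
    have "\<bar>integral {0..T} (\<lambda>t. f t * g t) - integral {0..T - k} (\<lambda>t. f t * g t)\<bar> \<le> (A * B) * (T - (T - k))"
      using k A B by (intro primitive_lipschitz[OF fgm]) (auto simp: abs_mult intro!: mult_mono)
    also have "\<dots> < e / 2"
    proof -
      have "A * B * k < A * B * (e / (4 * A * B))" using k A B by (intro mult_strict_left_mono) auto
      also have "\<dots> = e / 4" using A B by simp
      finally show ?thesis using e by simp
    qed
    finally show "norm (triangle_mean T f g (h n) - integral {0..T} (\<lambda>t. f t * g t)) < e"
      using 1 unfolding k_def[symmetric] real_norm_def by linarith
  qed
qed

lemma L1_approx_continuous:
  assumes f: "bmeas {a..b} f" and A: "\<And>x. x \<in> {a..b} \<Longrightarrow> \<bar>f x\<bar> \<le> A" and e: "0 < e"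
  obtains g where "continuous_on UNIV g" "\<And>x. \<bar>g x\<bar> \<le> \<bar>A\<bar>" "integral {a..b} (\<lambda>x. \<bar>f x - g x\<bar>) < e"
proof -
  obtain g where g: "\<And>n. continuous_on UNIV (g n)" "\<And>n x. \<bar>g n x\<bar> \<le> \<bar>A\<bar>"
    "AE x in lebesgue_on {a..b}. (\<lambda>n. g n x) \<longlonglongrightarrow> f x"
    using bmeas_approx_continuous[OF f A] by blast
  have gm: "bmeas {a..b} (g n)" for n using g(1) by (intro bmeas_continuous) (auto intro: continuous_on_subset)
  have "(\<lambda>n. integral {a..b} (\<lambda>x. \<bar>f x - g n x\<bar>)) \<longlonglongrightarrow> integral {a..b} (\<lambda>x. 0)"
  proof (rule bmeas_tendsto_integral[where B = "2 * \<bar>A\<bar>"])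
    show "AE x in lebesgue_on {a..b}. (\<lambda>n. \<bar>f x - g n x\<bar>) \<longlonglongrightarrow> 0"
      using g(3)
    proof eventually_elim
      case (elim x)
      then show ?case using tendsto_rabs[OF tendsto_diff[OF tendsto_const elim, of "f x"]] by simp
    qed
    show "AE x in lebesgue_on {a..b}. \<bar>\<bar>f x - g n x\<bar>\<bar> \<le> 2 * \<bar>A\<bar>" for n
    proof (rule AE_I2)
      fix x :: real assume "x \<in> space (lebesgue_on {a..b})"
      then show "\<bar>\<bar>f x - g n x\<bar>\<bar> \<le> 2 * \<bar>A\<bar>" using A[of x] g(2)[of n x] by auto
    qed
  qed (intro bmeas_intros f gm)+
  then have "(\<lambda>n. integral {a..b} (\<lambda>x. \<bar>f x - g n x\<bar>)) \<longlonglongrightarrow> 0" by simp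
  then have "\<forall>\<^sub>F n in sequentially. integral {a..b} (\<lambda>x. \<bar>f x - g n x\<bar>) < e" using e by (rule order_tendstoD)
  then obtain n where "integral {a..b} (\<lambda>x. \<bar>f x - g n x\<bar>) < e" by (auto simp: eventually_sequentially)
  then show thesis by (rule that[OF g(1) g(2)])
qed

text \<open>Continuous functions are dense in \<open>L\<^sup>1\<close>, and the means are continuous in \<open>L\<^sup>1\<close> uniformly in \<open>h\<close>. The lemma will be
applied to boundary values of the solution, which are merely measurable in time.\<close>

lemma triangle_mean_tendsto:
  assumes f: "bmeas {0..T} f" and g: "bmeas {0..T} g"
    and h: "\<And>n. 0 < h n" "\<And>n. h n \<le> T" "h \<longlonglongrightarrow> 0"
  shows "(\<lambda>n. triangle_mean T f g (h n)) \<longlonglongrightarrow> integral {0..T} (\<lambda>t. f t * g t)"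
proof (rule LIMSEQ_I)
  fix e :: real assume e: "0 < e"
  obtain A where A: "A > 0" "\<And>x. x \<in> {0..T} \<Longrightarrow> \<bar>f x\<bar> \<le> A" using bmeas_bound[OF f] by blast
  obtain B where B: "B > 0" "\<And>x. x \<in> {0..T} \<Longrightarrow> \<bar>g x\<bar> \<le> B" using bmeas_bound[OF g] by blast
  \<comment> \<open>The approximation errors add up to at most \<open>2 (A + B) \<epsilon> = e / 4\<close> for the means and \<open>e / 8\<close> for the integral.\<close>
  define \<epsilon> where "\<epsilon> = e / (8 * (A + B))"
  have \<epsilon>: "0 < \<epsilon>" using A B e by (simp add: \<epsilon>_def)
  obtain f' where f': "continuous_on UNIV f'" "\<And>x. \<bar>f' x\<bar> \<le> \<bar>A\<bar>" "integral {0..T} (\<lambda>x. \<bar>f x - f' x\<bar>) < \<epsilon>"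
    by (rule L1_approx_continuous[OF f A(2) \<epsilon>]) (assumption | rule that)+
  obtain g' where g': "continuous_on UNIV g'" "\<And>x. \<bar>g' x\<bar> \<le> \<bar>B\<bar>" "integral {0..T} (\<lambda>x. \<bar>g x - g' x\<bar>) < \<epsilon>"
    by (rule L1_approx_continuous[OF g B(2) \<epsilon>]) (assumption | rule that)+
  have c: "continuous_on {0..T} f'" "continuous_on {0..T} g'"     by (rule continuous_on_subset[OF f'(1)] continuous_on_subset[OF g'(1)], simp)+
  note m = bmeas_continuous[OF c(1)] bmeas_continuous[OF c(2)]
  let ?D = "A * integral {0..T} (\<lambda>x. \<bar>g x - g' x\<bar>) + B * integral {0..T} (\<lambda>x. \<bar>f x - f' x\<bar>)"
  have D: "?D \<le> e / 8"
  proof -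
    have "?D \<le> A * \<epsilon> + B * \<epsilon>" using f'(3) g'(3) A B by (intro add_mono mult_left_mono) auto
    also have "\<dots> = (A + B) * \<epsilon>" by (simp add: distrib_right)
    also have "\<dots> = e / 8"
    proof -
      have "A + B \<noteq> 0" using A B by linarith
      then show ?thesis by (simp only: \<epsilon>_def) (simp add: divide_simps)
    qed
    finally show ?thesis .
  qed
  have mean: "\<bar>triangle_mean T f g k - triangle_mean T f' g' k\<bar> \<le> 2 * ?D" if k: "0 < k" "k \<le> T" for k
  proof -
    have k': "0 \<le> k" using k by simp
    have "triangle_mean T f g k - triangle_mean T f' g' k =
        triangle_mean T (\<lambda>t. f t - f' t) g k + triangle_mean T f' (\<lambda>t. g t - g' t) k"
      using triangle_mean_diff_left[OF f m(1) g k' k(2)] triangle_mean_diff_right[OF m(1) g m(2) k' k(2)] by simp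
    moreover have "\<bar>triangle_mean T (\<lambda>t. f t - f' t) g k\<bar> \<le> 2 * B * integral {0..T} (\<lambda>x. \<bar>f x - f' x\<bar>)"
      using B k by (intro triangle_mean_bound triangle_int_bound(2)[OF bmeas_diff[OF f m(1)] g] bmeas_diff f m g) auto
    moreover have "\<bar>triangle_mean T f' (\<lambda>t. g t - g' t) k\<bar> \<le> 2 * A * integral {0..T} (\<lambda>x. \<bar>g x - g' x\<bar>)"
      using A f'(2) k by (intro triangle_mean_bound triangle_int_bound(1)[OF m(1) bmeas_diff[OF g m(2)]] bmeas_diff f m g) auto
    ultimately show ?thesis by (simp add: abs_le_iff)
  qed
  have int: "\<bar>integral {0..T} (\<lambda>t. f t * g t) - integral {0..T} (\<lambda>t. f' t * g' t)\<bar> \<le> ?D"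
  proof -
    have "integral {0..T} (\<lambda>t. f t * g t) - integral {0..T} (\<lambda>t. f' t * g' t) =
        integral {0..T} (\<lambda>t. f t * g t - f' t * g' t)"
      by (intro integral_diff[symmetric] bmeas_integrable bmeas_mult f g m)
    also have "\<bar>\<dots>\<bar> \<le> integral {0..T} (\<lambda>t. \<bar>f t * g t - f' t * g' t\<bar>)"
      by (intro bmeas_abs_integral_le bmeas_diff bmeas_mult f g m)
    also have "\<dots> \<le> integral {0..T} (\<lambda>t. A * \<bar>g t - g' t\<bar> + B * \<bar>f t - f' t\<bar>)"
    proof (intro integral_le bmeas_integrable bmeas_abs bmeas_add bmeas_diff bmeas_mult bmeas_const f g m)
      fix t assume t: "t \<in> {0..T}"
      have "f t * g t - f' t * g' t = f' t * (g t - g' t) + (f t - f' t) * g t" by (simp add: algebra_simps)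
      then have "\<bar>f t * g t - f' t * g' t\<bar> \<le> \<bar>f' t\<bar> * \<bar>g t - g' t\<bar> + \<bar>f t - f' t\<bar> * \<bar>g t\<bar>"
        by (metis abs_mult abs_triangle_ineq)
      also have "\<dots> \<le> A * \<bar>g t - g' t\<bar> + \<bar>f t - f' t\<bar> * B"
        using f'(2)[of t] A B(2)[OF t] by (intro add_mono mult_mono) auto
      finally show "\<bar>f t * g t - f' t * g' t\<bar> \<le> A * \<bar>g t - g' t\<bar> + B * \<bar>f t - f' t\<bar>" by (simp add: mult.commute)
    qed
    also have "\<dots> = ?D"
      by (subst integral_add) (auto intro!: bmeas_integrable bmeas_abs bmeas_diff bmeas_mult bmeas_const f g m)
    finally show ?thesis .
  qed
  obtain N where N: "\<And>n. n \<ge> N \<Longrightarrow>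
      norm (triangle_mean T f' g' (h n) - integral {0..T} (\<lambda>t. f' t * g' t)) < e / 2"
    using LIMSEQ_D[OF triangle_mean_continuous[OF c h], of "e / 2"] e by auto
  show "\<exists>no. \<forall>n\<ge>no. norm (triangle_mean T f g (h n) - integral {0..T} (\<lambda>t. f t * g t)) < e"
  proof (intro exI allI impI)
    fix n assume n: "n \<ge> N"
    show "norm (triangle_mean T f g (h n) - integral {0..T} (\<lambda>t. f t * g t)) < e"
    proof -
      have 1: "\<bar>triangle_mean T f g (h n) - triangle_mean T f' g' (h n)\<bar> \<le> e / 4"
        using order.trans[OF mean[OF h(1)[of n] h(2)[of n]] mult_left_mono[OF D, of 2]] by simp
      have 2: "\<bar>integral {0..T} (\<lambda>t. f t * g t) - integral {0..T} (\<lambda>t. f' t * g' t)\<bar> \<le> e / 8"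
        using int D by (rule order.trans)
      show ?thesis using N[OF n] 1 2 e unfolding real_norm_def by linarith
    qed
  qed
qed

section \<open>Weak solutions tested with stationary functions\<close>

lemma AE_lebesgue_on_subset:
  assumes "AE x in lebesgue_on S. P x" "S \<in> sets lebesgue" "S' \<in> sets lebesgue" "S' \<subseteq> S"
  shows "AE x in lebesgue_on S'. P x"
proof -
  have "AE x in lebesgue. x \<in> S \<longrightarrow> P x" using assms(1,2) by (subst (asm) AE_restrict_space_iff) auto
  then have "AE x in lebesgue. x \<in> S' \<longrightarrow> P x" by eventually_elim (use assms(4) in blast)
  then show ?thesis using assms(3) by (subst AE_restrict_space_iff) auto
qed

lemma vector_derivative_within_unit:
  assumes "(f has_real_derivative D) (at u)" "u \<in> {0..1}" "\<And>x. x \<in> {0..1} \<Longrightarrow> g x = f x"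
  shows "(g has_vector_derivative D) (at u within {0..1})" "vector_derivative g (at u within {0..1}) = D"
proof -
  have "(f has_vector_derivative D) (at u within {0..1})"
    using assms(1) has_field_derivative_at_within has_real_derivative_iff_has_vector_derivative by blast
  then show 1: "(g has_vector_derivative D) (at u within {0..1})"
    by (rule has_vector_derivative_transform[rotated 2]) (use assms in auto)
  have "at u within {0..1} \<noteq> bot" using assms(2) by (simp add: trivial_limit_within islimpt_Icc)
  then show "vector_derivative g (at u within {0..1}) = D"
    using 1 by (rule vector_derivative_within)
qed

text \<open>Everything that is proved in this context is deterministic and concerns a single weak solution.\<close>

locale robin_solution =
  fixes T \<alpha> \<beta> \<kappa> :: real and m :: nat and g :: "real \<Rightarrow> real" and \<rho> :: "real \<Rightarrow> real \<Rightarrow> real"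
  assumes \<alpha>: "0 < \<alpha>" "\<alpha> < 1" and \<beta>: "0 < \<beta>" "\<beta> < 1" and T: "0 < T" and m: "1 \<le> m" and \<kappa>: "0 < \<kappa>"
    and weak: "weak_solution_Robin T \<alpha> \<beta> m \<kappa> g \<rho>"
begin

definition w :: "real \<Rightarrow> real \<Rightarrow> real" where "w t u = \<rho> t u ^ m"

text \<open>The boundary values of \<open>\<rho>\<close> are meaningful for those times only at which \<open>\<rho>\<^sup>m\<close> lies in \<open>H\<^sup>1\<close>;
setting them to \<open>0\<close> at the remaining null set of times makes them bounded everywhere.\<close>

definition left_trace :: "real \<Rightarrow> real" where "left_trace t = (if t \<in> {0..T} \<and> w t \<in> H1 then extend m \<rho> t 0 else 0)"
definition right_trace :: "real \<Rightarrow> real" where "right_trace t = (if t \<in> {0..T} \<and> w t \<in> H1 then extend m \<rho> t 1 else 0)"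

lemma \<rho>_range: "t \<in> {0..T} \<Longrightarrow> u \<in> {0..1} \<Longrightarrow> 0 \<le> \<rho> t u \<and> \<rho> t u \<le> 1"
  using weak by (auto simp: weak_solution_Robin_def)

lemma w_range: "t \<in> {0..T} \<Longrightarrow> u \<in> {0..1} \<Longrightarrow> 0 \<le> w t u \<and> w t u \<le> 1"
  using \<rho>_range[of t u] by (auto simp: w_def intro: power_le_one)

lemma \<rho>_joint: "(\<lambda>(t, u). \<rho> t u) \<in> borel_measurable (lebesgue_on ({0..T} \<times> {0..1}))"
  using weak by (simp add: weak_solution_Robin_def)

lemma \<rho>_slice: "t \<in> {0..T} \<Longrightarrow> bmeas {0..1} (\<rho> t)"
  using weak \<rho>_range[of t] by (intro bmeasI[of _ _ 1]) (auto simp: weak_solution_Robin_def)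

lemma w_slice: "t \<in> {0..T} \<Longrightarrow> bmeas {0..1} (w t)"
  unfolding w_def by (intro bmeas_power \<rho>_slice)

text \<open>The exponent \<open>n = 0\<close> gives norms of test functions, \<open>n = m\<close> the pairings with \<open>\<rho>\<^sup>m\<close>, and \<open>n = 1\<close> together with
\<open>n = m + 1\<close> the functional \<open>\<Psi>\<close>.\<close>

lemma space_integral_bmeas:
  assumes G: "continuous_on ({0..T} \<times> {0..1}) (\<lambda>(t, u). G t u)"
  shows "bmeas {0..T} (\<lambda>t. integral {0..1} (\<lambda>u. \<rho> t u ^ n * G t u))"
proof -
  have "compact ({0..T} \<times> {0..1::real})" by (intro compact_Times compact_Icc)
  then have "bounded ((\<lambda>(t, u). G t u) ` ({0..T} \<times> {0..1}))"
    using G compact_continuous_image compact_imp_bounded by blast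
  then obtain B where B: "\<And>t u. t \<in> {0..T} \<Longrightarrow> u \<in> {0..1} \<Longrightarrow> \<bar>G t u\<bar> \<le> B"
    unfolding bounded_iff by fastforce
  show ?thesis
  proof (rule bmeas_slice_integral[where B = B])
    have box: "{0..T} \<times> {0..1} \<in> sets (lebesgue :: (real \<times> real) measure)"
      by (intro lmeasurable_compact[THEN fmeasurableD] compact_Times compact_Icc)
    have "(\<lambda>z. (case z of (t, u) \<Rightarrow> \<rho> t u) ^ n * (case z of (t, u) \<Rightarrow> G t u))
        \<in> borel_measurable (lebesgue_on ({0..T} \<times> {0..1}))"
      using \<rho>_joint continuous_imp_measurable_on_sets_lebesgue[OF G box] by measurable
    then show "(\<lambda>(t, u). \<rho> t u ^ n * G t u) \<in> borel_measurable (lebesgue_on ({0..T} \<times> {0..1}))"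
      by (simp add: case_prod_unfold)
    show "(\<lambda>u. \<rho> t u ^ n * G t u) \<in> borel_measurable (lebesgue_on {0..1})" if t: "t \<in> {0..T}" for t
    proof -
      have "continuous_on {0..1} (G t)"
      proof -
        have "continuous_on {0..1} (\<lambda>u::real. (t, u))" by (intro continuous_on_Pair continuous_on_const continuous_on_id)
        moreover have "(\<lambda>u. (t, u)) ` {0..1} \<subseteq> {0..T} \<times> {0..1}" using t by auto
        ultimately have "continuous_on {0..1} (\<lambda>u. case (t, u) of (t, u) \<Rightarrow> G t u)"
          by (rule continuous_on_compose2[OF G])
        then show ?thesis by simp
      qed
      then show ?thesis
        by (intro bmeas_measurable bmeas_mult bmeas_power \<rho>_slice t bmeas_continuous)
    qed
    show "\<bar>\<rho> t u ^ n * G t u\<bar> \<le> B" if "t \<in> {0..T}" "u \<in> {0..1}" for t u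
    proof -
      have "\<bar>\<rho> t u ^ n\<bar> \<le> 1" using \<rho>_range[OF that] by (simp add: power_le_one)
      then have "\<bar>\<rho> t u ^ n\<bar> * \<bar>G t u\<bar> \<le> 1 * B" using B[OF that] by (intro mult_mono) auto
      then show ?thesis by (simp add: abs_mult)
    qed
  qed auto
qed

lemma space_integral_bmeas_fixed:
  assumes G: "continuous_on {0..1} G"
  shows "bmeas {0..T} (\<lambda>t. integral {0..1} (\<lambda>u. \<rho> t u ^ n * G u))"
proof (rule space_integral_bmeas)
  have "continuous_on ({0..T} \<times> {0..1}) (\<lambda>z. G (snd z))"
    by (rule continuous_on_compose2[OF G continuous_on_snd[OF continuous_on_id]]) auto
  then show "continuous_on ({0..T} \<times> {0..1}) (\<lambda>(t, u). G u)" by (simp add: case_prod_unfold)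
qed

lemma cosine_coeff_w_bmeas: "bmeas {0..T} (\<lambda>t. cosine_coeff (w t) k)"
  unfolding cosine_coeff_def w_def by (intro space_integral_bmeas_fixed continuous_intros)

lemma fejer_w_bmeas: "bmeas {0..T} (\<lambda>t. fejer N (w t) u)"
  unfolding fejer_def by (intro bmeas_sum bmeas_mult bmeas_const cosine_coeff_w_bmeas)

lemma fejer_w_range: "t \<in> {0..T} \<Longrightarrow> 0 < N \<Longrightarrow> 0 \<le> fejer N (w t) u \<and> fejer N (w t) u \<le> 1"
proof -
  assume t: "t \<in> {0..T}" and N: "0 < N"
  have "AE u in lebesgue_on {0..1}. 0 \<le> w t u \<and> w t u \<le> 1"
    using w_range[OF t] by (intro AE_I2) simp
  from fejer_bounds[OF w_slice[OF t] this N] show ?thesis by blast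
qed

lemma fejer_w_limits:
  assumes t: "t \<in> {0..T}" and H: "w t \<in> H1"
  shows "AE u in lebesgue_on {0..1}. (\<lambda>N. fejer N (w t) u) \<longlonglongrightarrow> w t u"
    and "(\<lambda>N. fejer N (w t) 0) \<longlonglongrightarrow> left_trace t ^ m" and "(\<lambda>N. fejer N (w t) 1) \<longlonglongrightarrow> right_trace t ^ m"
    and "left_trace t \<in> {0..1}" "right_trace t \<in> {0..1}"
proof -
  obtain W where W: "continuous_on {0..1} W" and ae: "AE u in lebesgue_on {0..1}. w t u = W u"
    using H1_continuous_representative[OF H w_slice[OF t]] by blast
  have eq: "fejer N (w t) u = fejer N W u" for N u
    by (rule fejer_AE_cong[OF w_slice[OF t] bmeas_continuous[OF W] ae])
  have lim: "(\<lambda>N. fejer N (w t) u) \<longlonglongrightarrow> W u" if "u \<in> {0..1}" for u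
    unfolding eq using W that by (rule fejer_tendsto)
  have "AE u in lebesgue_on {0..1}. u \<in> {0..1}" by (intro AE_I2) auto
  then show "AE u in lebesgue_on {0..1}. (\<lambda>N. fejer N (w t) u) \<longlonglongrightarrow> w t u"
    using ae by eventually_elim (simp add: lim)
  have W01: "0 \<le> W u \<and> W u \<le> 1" if u: "u \<in> {0..1}" for u
    using LIMSEQ_le_const[OF lim[OF u], of 0] LIMSEQ_le_const2[OF lim[OF u], of 1] fejer_w_range[OF t]
    by (meson less_eq_Suc_le)
  have wt: "w t = (\<lambda>v. \<rho> t v ^ m)" by (simp add: w_def fun_eq_iff)
  have Xt: "left_trace t = root m (W 0)" and Yt: "right_trace t = root m (W 1)"
    using t H boundary_value_ends[OF W ae] by (simp_all add: left_trace_def right_trace_def extend_def wt)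
  have pw: "root m (W u) ^ m = W u" "root m (W u) \<in> {0..1}" if "u \<in> {0..1}" for u
    using W01[OF that] m by (auto simp: real_root_ge_zero)
  show "(\<lambda>N. fejer N (w t) 0) \<longlonglongrightarrow> left_trace t ^ m" "(\<lambda>N. fejer N (w t) 1) \<longlonglongrightarrow> right_trace t ^ m"
    using lim[of 0] lim[of 1] pw(1)[of 0] pw(1)[of 1] by (simp_all add: Xt Yt)
  show "left_trace t \<in> {0..1}" "right_trace t \<in> {0..1}"
    using pw(2)[of 0] pw(2)[of 1] by (simp_all add: Xt Yt)
qed

lemma AE_H1: "AE t in lebesgue_on {0..T}. t \<in> {0..T} \<and> w t \<in> H1"
proof -
  have "AE t in lebesgue_on {0..T}. (\<lambda>u. \<rho> t u ^ m) \<in> H1"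
    using weak by (simp add: weak_solution_Robin_def L2_H1_def)
  moreover have "AE t in lebesgue_on {0..T}. t \<in> {0..T}" by (intro AE_I2) auto
  ultimately show ?thesis by eventually_elim (simp add: w_def[abs_def])
qed

lemma trace_range: "0 \<le> left_trace t \<and> left_trace t \<le> 1" "0 \<le> right_trace t \<and> right_trace t \<le> 1"
  using fejer_w_limits(4,5)[of t] by (cases "t \<in> {0..T} \<and> w t \<in> H1"; auto simp: left_trace_def right_trace_def)+

text \<open>The traces inherit measurability in time from the Fejer means at the end points, of which they are limits.\<close>

lemma trace_bmeas: "bmeas {0..T} left_trace" "bmeas {0..T} right_trace"
proof -
  have root: "bmeas {0..T} Z" if Zm: "AE t in lebesgue_on {0..T}. (\<lambda>N. fejer N (w t) u) \<longlonglongrightarrow> Z t ^ m"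
    and Z: "\<And>t. 0 \<le> Z t \<and> Z t \<le> 1" for Z u
  proof (rule bmeasI[where B = 1])
    have "(\<lambda>t. Z t ^ m) \<in> borel_measurable (lebesgue_on {0..T})"
      by (rule bmeas_limit_AE[OF bmeas_measurable[OF fejer_w_bmeas] _ Zm]) auto
    moreover have "root m \<in> borel_measurable borel"
      by (intro borel_measurable_continuous_onI continuous_on_real_root continuous_on_id)
    ultimately have "(\<lambda>t. root m (Z t ^ m)) \<in> borel_measurable (lebesgue_on {0..T})"
      by (rule measurable_compose)
    then show "Z \<in> borel_measurable (lebesgue_on {0..T})"
      using Z m by (simp add: real_root_power_cancel)
    show "\<bar>Z t\<bar> \<le> 1" for t using Z[of t] by simp
  qed
  have "AE t in lebesgue_on {0..T}. (\<lambda>N. fejer N (w t) 0) \<longlonglongrightarrow> left_trace t ^ m"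
    using AE_H1 by eventually_elim (auto intro: fejer_w_limits)
  from root[OF this] show "bmeas {0..T} left_trace" using trace_range by blast
  have "AE t in lebesgue_on {0..T}. (\<lambda>N. fejer N (w t) 1) \<longlonglongrightarrow> right_trace t ^ m"
    using AE_H1 by eventually_elim (auto intro: fejer_w_limits)
  from root[OF this] show "bmeas {0..T} right_trace" using trace_range by blast
qed

lemma extend_AE: "AE t in lebesgue_on {0..T}. extend m \<rho> t 0 = left_trace t \<and> extend m \<rho> t 1 = right_trace t"
  using AE_H1 by eventually_elim (simp add: left_trace_def right_trace_def)

lemma extend_measurable:
  "(\<lambda>t. extend m \<rho> t 0) \<in> borel_measurable (lebesgue_on {0..T})"
  "(\<lambda>t. extend m \<rho> t 1) \<in> borel_measurable (lebesgue_on {0..T})"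
proof -
  have 0: "AE t in lebesgue_on {0..T}. (\<lambda>N. left_trace t) \<longlonglongrightarrow> extend m \<rho> t 0"
    using extend_AE by eventually_elim simp
  have 1: "AE t in lebesgue_on {0..T}. (\<lambda>N. right_trace t) \<longlonglongrightarrow> extend m \<rho> t 1"
    using extend_AE by eventually_elim simp
  show "(\<lambda>t. extend m \<rho> t 0) \<in> borel_measurable (lebesgue_on {0..T})"
    by (rule bmeas_limit_AE[OF bmeas_measurable[OF trace_bmeas(1)] _ 0]) auto
  show "(\<lambda>t. extend m \<rho> t 1) \<in> borel_measurable (lebesgue_on {0..T})"
    by (rule bmeas_limit_AE[OF bmeas_measurable[OF trace_bmeas(2)] _ 1]) auto
qed

lemma integral_extend:
  assumes t: "t \<in> {0..T}" and m: "bmeas {0..T} (\<lambda>s. F s (left_trace s) (right_trace s))"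
    and mF: "(\<lambda>s. F s (extend m \<rho> s 0) (extend m \<rho> s 1)) \<in> borel_measurable (lebesgue_on {0..T})"
  shows "(\<integral>s. F s (extend m \<rho> s 0) (extend m \<rho> s 1) \<partial>lebesgue_on {0..t}) = integral {0..t} (\<lambda>s. F s (left_trace s) (right_trace s))"
proof -
  have sub: "bmeas {0..t} (\<lambda>s. F s (left_trace s) (right_trace s))" using t by (intro bmeas_subset[OF m]) auto
  have "AE s in lebesgue_on {0..t}. extend m \<rho> s 0 = left_trace s \<and> extend m \<rho> s 1 = right_trace s"
    by (rule AE_lebesgue_on_subset[OF extend_AE]) (use t in auto)
  then have "(\<integral>s. F s (extend m \<rho> s 0) (extend m \<rho> s 1) \<partial>lebesgue_on {0..t}) =
      (\<integral>s. F s (left_trace s) (right_trace s) \<partial>lebesgue_on {0..t})"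
    using t by (intro integral_cong_AE measurable_restrict_mono[OF mF] bmeas_measurable[OF sub])
       (auto elim: eventually_mono)
  then show ?thesis using sub by (simp add: bmeas_integral_eq)
qed

text \<open>For test functions that do not depend on time the weak formulation at two times can be subtracted,
which leaves a balance equation for every time interval.\<close>

lemma weak_form_stationary:
  fixes \<phi> \<phi>' \<phi>'' :: "real \<Rightarrow> real"
  assumes d1: "\<And>u. (\<phi> has_real_derivative \<phi>' u) (at u)" and d2: "\<And>u. (\<phi>' has_real_derivative \<phi>'' u) (at u)"
    and c: "continuous_on UNIV \<phi>''" and rt: "0 \<le> r" "r \<le> t" "t \<le> T"
  shows "integral {0..1} (\<lambda>u. \<rho> t u * \<phi> u) - integral {0..1} (\<lambda>u. \<rho> r u * \<phi> u) =
    integral {r..t} (\<lambda>s. integral {0..1} (\<lambda>u. w s u * \<phi>'' u))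
    - integral {r..t} (\<lambda>s. right_trace s ^ m * \<phi>' 1 - left_trace s ^ m * \<phi>' 0)
    + \<kappa> * integral {r..t} (\<lambda>s. \<phi> 0 * (\<alpha> - left_trace s) + \<phi> 1 * (\<beta> - right_trace s))"
proof -
  \<comment> \<open>The test function, constant in time, together with its one-sided derivatives on the unit square.\<close>
  define G where "G = (\<lambda>(s::real) (u::real). \<phi> u)"
  have c0: "continuous_on S \<phi>" and c1: "continuous_on S \<phi>'" and c2: "continuous_on S \<phi>''" for S
    using DERIV_continuous_on[OF has_field_derivative_at_within[OF d1]]
      DERIV_continuous_on[OF has_field_derivative_at_within[OF d2]] continuous_on_subset[OF c] by auto
  have td: "time_deriv T G s u = 0" if "s \<in> {0..T}" for s u
  proof -
    have "at s within {0..T} \<noteq> bot" using that T by (simp add: trivial_limit_within islimpt_Icc)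
    then show ?thesis
      unfolding time_deriv_def G_def by (rule vector_derivative_within) (rule has_vector_derivative_const)
  qed
  have sd1: "(G s has_vector_derivative \<phi>' u) (at u within {0..1})" "space_deriv G s u = \<phi>' u"
    if "u \<in> {0..1}" for s u
    unfolding space_deriv_def using vector_derivative_within_unit[OF d1 that, of "G s"] by (auto simp: G_def)
  have sd2: "(space_deriv G s has_vector_derivative \<phi>'' u) (at u within {0..1})" "space_deriv (space_deriv G) s u = \<phi>'' u"
    if "u \<in> {0..1}" for s u
    using vector_derivative_within_unit[OF d2 that, of "space_deriv G s"] sd1(2)
    by (auto simp: space_deriv_def[of "space_deriv G"])
  have cc: "continuous_on ({0..T} \<times> {0..1}) (\<lambda>(s, u). K s u)"
    if "\<And>S. continuous_on S \<psi>" "\<And>s u. s \<in> {0..T} \<Longrightarrow> u \<in> {0..1} \<Longrightarrow> K s u = \<psi> u" for K and \<psi> :: "real \<Rightarrow> real"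
    by (rule continuous_on_eq[where f = "\<lambda>z. \<psi> (snd z)"])
       (auto simp: that(2) intro!: continuous_on_compose2[OF that(1) continuous_on_snd[OF continuous_on_id]])
  have G: "G \<in> C_time_space 1 2 T"
    unfolding C_time_space_def
  proof (intro CollectI conjI allI impI ballI)
    fix i :: nat assume "i \<le> 1"
    then consider "i = 0" | "i = 1" by linarith
    then show "continuous_on ({0..T} \<times> {0..1}) (\<lambda>(s, u). (time_deriv T ^^ i) G s u)"
    proof cases
      case 1 show ?thesis unfolding 1 by (rule cc[of \<phi>]) (auto simp: c0 G_def)
    next
      case 2 show ?thesis unfolding 2 by (rule cc[of "\<lambda>_. 0"]) (auto simp: td)
    qed
  next
    fix i :: nat assume "i \<le> 2"
    then consider "i = 0" | "i = 1" | "i = 2" by linarith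
    then show "continuous_on ({0..T} \<times> {0..1}) (\<lambda>(s, u). (space_deriv ^^ i) G s u)"
    proof cases
      case 1 show ?thesis unfolding 1 by (rule cc[of \<phi>]) (auto simp: c0 G_def)
    next
      case 2 show ?thesis unfolding 2 by (rule cc[of \<phi>']) (auto simp: c1 sd1)
    next
      case 3 show ?thesis unfolding 3 by (rule cc[of \<phi>'']) (auto simp: c2 sd2 numeral_2_eq_2)
    qed
  next
    fix i :: nat and s u :: real assume "i < 1"
    then show "(\<lambda>r. (time_deriv T ^^ i) G r u) differentiable at s within {0..T}" by (simp add: G_def)
  next
    fix i :: nat and s u :: real assume i: "i < 2" and u: "u \<in> {0..1}"
    then consider "i = 0" | "i = 1" by linarith
    then show "(\<lambda>v. (space_deriv ^^ i) G s v) differentiable at u within {0..1}"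
    proof cases
      case 1 show ?thesis using differentiableI_vector[OF sd1(1)[OF u, of s]] by (simp add: 1)
    next
      case 2 show ?thesis using differentiableI_vector[OF sd2(1)[OF u, of s]] by (simp add: 2)
    qed
  qed
  define V where "V s = integral {0..1} (\<lambda>u. w s u * \<phi>'' u)" for s
  define U where "U s = right_trace s ^ m * \<phi>' 1 - left_trace s ^ m * \<phi>' 0" for s
  define R where "R s = \<phi> 0 * (\<alpha> - left_trace s) + \<phi> 1 * (\<beta> - right_trace s)" for s
  have V: "bmeas {0..T} V" unfolding V_def w_def by (rule space_integral_bmeas_fixed[OF c2])
  have U: "bmeas {0..T} U" and R: "bmeas {0..T} R"
    unfolding U_def R_def by (intro bmeas_intros trace_bmeas)+
  have id: "integral {0..1} (\<lambda>u. \<rho> \<tau> u * \<phi> u) - L2_inner g \<phi> - integral {0..\<tau>} V + integral {0..\<tau>} U - \<kappa> * integral {0..\<tau>} R = 0"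
    if \<tau>: "\<tau> \<in> {0..T}" for \<tau>
  proof -
    have "L2_inner (\<rho> \<tau>) (G \<tau>) - L2_inner g (G 0)
        - (\<integral>s. L2_inner (\<rho> s)
                 (\<lambda>u. time_deriv T G s u + \<rho> s u ^ (m - 1) * space_deriv (space_deriv G) s u)
             \<partial>lebesgue_on {0..\<tau>})
        + (\<integral>s. (extend m \<rho> s 1) ^ m * space_deriv G s 1 - (extend m \<rho> s 0) ^ m * space_deriv G s 0
             \<partial>lebesgue_on {0..\<tau>})
        - \<kappa> * (\<integral>s. G s 0 * (\<alpha> - extend m \<rho> s 0) + G s 1 * (\<beta> - extend m \<rho> s 1)
             \<partial>lebesgue_on {0..\<tau>}) = 0"
      using weak \<tau> G unfolding weak_solution_Robin_def by blast
    moreover have "L2_inner (\<rho> \<tau>) (G \<tau>) = integral {0..1} (\<lambda>u. \<rho> \<tau> u * \<phi> u)"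
      unfolding L2_inner_def G_def by (intro bmeas_integral_eq bmeas_mult \<rho>_slice \<tau> bmeas_continuous c0)
    moreover have "L2_inner g (G 0) = L2_inner g \<phi>" by (simp add: G_def)
    moreover have "(\<integral>s. L2_inner (\<rho> s)
                 (\<lambda>u. time_deriv T G s u + \<rho> s u ^ (m - 1) * space_deriv (space_deriv G) s u)
             \<partial>lebesgue_on {0..\<tau>}) = integral {0..\<tau>} V"
    proof -
      have "L2_inner (\<rho> s) (\<lambda>u. time_deriv T G s u + \<rho> s u ^ (m - 1) * space_deriv (space_deriv G) s u) = V s"
        if s: "s \<in> {0..T}" for s
      proof -
        have "\<rho> s u * (time_deriv T G s u + \<rho> s u ^ (m - 1) * space_deriv (space_deriv G) s u) = w s u * \<phi>'' u"
          if u: "u \<in> {0..1}" for u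
        proof -
          have "\<rho> s u * \<rho> s u ^ (m - 1) = w s u"
            using m power_Suc[of "\<rho> s u" "m - 1"] by (simp add: w_def)
          then show ?thesis using td[OF s] sd2(2)[OF u] by (simp flip: mult.assoc)
        qed
        then have "L2_inner (\<rho> s) (\<lambda>u. time_deriv T G s u + \<rho> s u ^ (m - 1) * space_deriv (space_deriv G) s u) =
            (\<integral>u. w s u * \<phi>'' u \<partial>lebesgue_on {0..1})"
          unfolding L2_inner_def by (intro Bochner_Integration.integral_cong) auto
        also have "\<dots> = V s"
          unfolding V_def by (intro bmeas_integral_eq bmeas_mult w_slice s bmeas_continuous c2)
        finally show ?thesis .
      qed
      then have "(\<integral>s. L2_inner (\<rho> s)
                 (\<lambda>u. time_deriv T G s u + \<rho> s u ^ (m - 1) * space_deriv (space_deriv G) s u)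
             \<partial>lebesgue_on {0..\<tau>}) = (\<integral>s. V s \<partial>lebesgue_on {0..\<tau>})"
        using \<tau> by (intro Bochner_Integration.integral_cong) auto
      then show ?thesis using \<tau> by (subst bmeas_integral_eq[symmetric]) (auto intro: bmeas_subset[OF V])
    qed
    moreover have "(\<integral>s. (extend m \<rho> s 1) ^ m * space_deriv G s 1 - (extend m \<rho> s 0) ^ m * space_deriv G s 0
             \<partial>lebesgue_on {0..\<tau>}) = integral {0..\<tau>} U"
    proof -
      have "(\<lambda>s. extend m \<rho> s 1 ^ m * \<phi>' 1 - extend m \<rho> s 0 ^ m * \<phi>' 0) \<in> borel_measurable (lebesgue_on {0..T})"
        using extend_measurable by measurable
      then show ?thesis
        using integral_extend[OF \<tau>, of "\<lambda>s x y. y ^ m * \<phi>' 1 - x ^ m * \<phi>' 0"] U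
        by (simp add: sd1 U_def[abs_def])
    qed
    moreover have "(\<integral>s. G s 0 * (\<alpha> - extend m \<rho> s 0) + G s 1 * (\<beta> - extend m \<rho> s 1)
             \<partial>lebesgue_on {0..\<tau>}) = integral {0..\<tau>} R"
    proof -
      have "(\<lambda>s. \<phi> 0 * (\<alpha> - extend m \<rho> s 0) + \<phi> 1 * (\<beta> - extend m \<rho> s 1)) \<in> borel_measurable (lebesgue_on {0..T})"
        using extend_measurable by measurable
      then show ?thesis
        using integral_extend[OF \<tau>, of "\<lambda>s x y. \<phi> 0 * (\<alpha> - x) + \<phi> 1 * (\<beta> - y)"] R
        by (simp add: G_def R_def[abs_def])
    qed
    ultimately show ?thesis by simp
  qed
  have r: "r \<in> {0..T}" and t: "t \<in> {0..T}" using rt by auto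
  show ?thesis
    using id[OF r] id[OF t] primitive_diff[OF V rt] primitive_diff[OF U rt] primitive_diff[OF R rt]
    unfolding V_def[symmetric] U_def[symmetric] R_def[symmetric]
    by (simp add: V_def[abs_def] U_def[abs_def] R_def[abs_def] algebra_simps flip: right_diff_distrib)
qed

end

section \<open>Convexity and the cosine modes of a weak solution\<close>

text \<open>The inequality says that the convex function \<open>y\<^sup>m\<^sup>+\<^sup>1 / (m + 1)\<close> lies above its tangent at \<open>x\<close>.\<close>

lemma power_convexity:
  fixes x y :: real
  assumes "0 \<le> x" "0 \<le> y"
  shows "(x ^ Suc m - y ^ Suc m) / real (Suc m) \<le> (x - y) * x ^ m"
proof -
  have le_p: "(x - y) * (x ^ p * y ^ (m - p)) \<le> (x - y) * x ^ m" if "p < Suc m" for p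
  proof -
    have e: "x ^ m = x ^ p * x ^ (m - p)" using that by (simp flip: power_add)
    show ?thesis
    proof (cases "y \<le> x")
      case True
      then have "x ^ p * y ^ (m - p) \<le> x ^ p * x ^ (m - p)"
        using assms by (intro mult_left_mono power_mono) auto
      then show ?thesis unfolding e by (rule mult_left_mono) (use True in simp)
    next
      case False
      then have "x ^ p * x ^ (m - p) \<le> x ^ p * y ^ (m - p)"
        using assms by (intro mult_left_mono power_mono) auto
      then show ?thesis unfolding e by (rule mult_left_mono_neg) (use False in simp)
    qed
  qed
  have "x ^ Suc m - y ^ Suc m = (\<Sum>p<Suc m. (x - y) * (x ^ p * y ^ (m - p)))"
    unfolding diff_power_eq_sum sum_distrib_left ..
  also have "\<dots> \<le> (\<Sum>p<Suc m. (x - y) * x ^ m)" by (intro sum_mono le_p) simp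
  also have "\<dots> = real (Suc m) * ((x - y) * x ^ m)" by simp
  finally show ?thesis by (simp add: divide_le_eq mult.commute)
qed

context robin_solution begin

text \<open>The boundary values of the affine comparison function \<open>L\<close>, which is what has to be subtracted from \<open>\<rho>\<^sup>m\<close> to make
the boundary terms of the tested equation products of quantities of the same sign.\<close>

definition A :: real where "A = \<alpha> ^ m"
definition B :: real where "B = \<beta> ^ m"
definition L :: "real \<Rightarrow> real" where "L u = A + (B - A) * u"

text \<open>The Lyapunov functional whose first variation at \<open>\<rho>\<close> is \<open>\<rho>\<^sup>m - L\<close>.\<close>

definition \<Psi> :: "real \<Rightarrow> real" where
  "\<Psi> t = integral {0..1} (\<lambda>u. \<rho> t u ^ Suc m / real (Suc m) - L u * \<rho> t u)"

lemma AB_range: "0 \<le> A" "A \<le> 1" "0 \<le> B" "B \<le> 1"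
  using \<alpha> \<beta> by (auto simp: A_def B_def power_le_one)

lemma L_continuous: "continuous_on S L"
  unfolding L_def by (intro continuous_intros)

lemma L_range: "u \<in> {0..1} \<Longrightarrow> 0 \<le> L u \<and> L u \<le> 1"
proof -
  assume u: "u \<in> {0..1}"
  have e: "L u = (1 - u) * A + u * B" by (simp add: L_def algebra_simps)
  have "L u \<le> (1 - u) * 1 + u * 1" unfolding e using u AB_range by (intro add_mono mult_left_mono) auto
  moreover have "0 \<le> L u" unfolding e using u AB_range by simp
  ultimately show ?thesis by simp
qed

lemma \<Psi>_integrand: "t \<in> {0..T} \<Longrightarrow> bmeas {0..1} (\<lambda>u. \<rho> t u ^ Suc m / real (Suc m) - L u * \<rho> t u)"
  by (intro bmeas_intros \<rho>_slice bmeas_continuous L_continuous)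

lemma \<Psi>_range: "t \<in> {0..T} \<Longrightarrow> \<bar>\<Psi> t\<bar> \<le> 1"
proof -
  assume t: "t \<in> {0..T}"
  have "\<bar>\<Psi> t\<bar> \<le> 1 * (1 - 0)"
    unfolding \<Psi>_def
  proof (rule bmeas_integral_abs_le[OF \<Psi>_integrand[OF t]])
    fix u :: real assume u: "u \<in> {0..1}"
    have 1: "0 \<le> \<rho> t u" "\<rho> t u \<le> 1" using \<rho>_range[OF t u] by auto
    have "\<rho> t u ^ Suc m \<le> 1" "0 \<le> \<rho> t u ^ Suc m" using 1 by (auto intro: power_le_one simp del: power_Suc)
    then have "\<rho> t u ^ Suc m / real (Suc m) \<le> 1" "0 \<le> \<rho> t u ^ Suc m / real (Suc m)"
      by (auto simp: divide_le_eq simp del: power_Suc)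
    moreover have "0 \<le> L u * \<rho> t u" "L u * \<rho> t u \<le> 1 * 1" using L_range[OF u] 1 by (auto intro: mult_mono mult_le_one)
    ultimately show "\<bar>\<rho> t u ^ Suc m / real (Suc m) - L u * \<rho> t u\<bar> \<le> 1" by linarith
  qed simp
  then show ?thesis by simp
qed

lemma \<Psi>_bmeas: "bmeas {0..T} \<Psi>"
proof -
  have eq: "\<Psi> t = integral {0..1} (\<lambda>u. \<rho> t u ^ Suc m * (1 / real (Suc m))) - integral {0..1} (\<lambda>u. \<rho> t u ^ 1 * L u)"
    if t: "t \<in> {0..T}" for t
  proof -
    have "integral {0..1} (\<lambda>u. \<rho> t u ^ Suc m * (1 / real (Suc m)) - \<rho> t u ^ 1 * L u) =
        integral {0..1} (\<lambda>u. \<rho> t u ^ Suc m * (1 / real (Suc m))) - integral {0..1} (\<lambda>u. \<rho> t u ^ 1 * L u)"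
      by (intro integral_diff bmeas_integrable bmeas_intros \<rho>_slice t bmeas_continuous L_continuous)
    then show ?thesis by (simp add: \<Psi>_def mult.commute)
  qed
  show ?thesis
    by (rule bmeas_cong[OF bmeas_diff eq[symmetric]])
       (intro space_integral_bmeas_fixed continuous_on_const L_continuous)+
qed

lemma \<Psi>_convexity:
  assumes t: "t \<in> {0..T}" and r: "r \<in> {0..T}"
  shows "\<Psi> t - \<Psi> r \<le> integral {0..1} (\<lambda>u. (\<rho> t u - \<rho> r u) * (w t u - L u))"
proof -
  have "\<Psi> t - \<Psi> r = integral {0..1} (\<lambda>u. (\<rho> t u ^ Suc m / real (Suc m) - L u * \<rho> t u) - (\<rho> r u ^ Suc m / real (Suc m) - L u * \<rho> r u))"
    unfolding \<Psi>_def by (intro integral_diff[symmetric] bmeas_integrable \<Psi>_integrand t r)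
  also have "\<dots> \<le> integral {0..1} (\<lambda>u. (\<rho> t u - \<rho> r u) * (w t u - L u))"
  proof (intro integral_le bmeas_integrable)
    show "bmeas {0..1} (\<lambda>u. (\<rho> t u ^ Suc m / real (Suc m) - L u * \<rho> t u) - (\<rho> r u ^ Suc m / real (Suc m) - L u * \<rho> r u))"
      by (intro bmeas_diff \<Psi>_integrand t r)
    show "bmeas {0..1} (\<lambda>u. (\<rho> t u - \<rho> r u) * (w t u - L u))"
      by (intro bmeas_intros \<rho>_slice w_slice t r bmeas_continuous L_continuous)
    fix u :: real assume u: "u \<in> {0..1}"
    have "(\<rho> t u ^ Suc m - \<rho> r u ^ Suc m) / real (Suc m) \<le> (\<rho> t u - \<rho> r u) * \<rho> t u ^ m"
      using \<rho>_range[OF t u] \<rho>_range[OF r u] by (intro power_convexity) auto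
    then show "(\<rho> t u ^ Suc m / real (Suc m) - L u * \<rho> t u) - (\<rho> r u ^ Suc m / real (Suc m) - L u * \<rho> r u)
        \<le> (\<rho> t u - \<rho> r u) * (w t u - L u)"
      by (simp add: w_def diff_divide_distrib right_diff_distrib left_diff_distrib mult.commute del: power_Suc)
  qed
  finally show ?thesis .
qed

text \<open>Since \<open>sin (k \<pi>) = 0\<close>, the boundary values of \<open>\<rho>\<^sup>m\<close> drop out; the cosine modes see the boundary only through the Robin flux.\<close>

lemma weak_form_cos:
  assumes "0 \<le> r" "r \<le> t" "t \<le> T"
  shows "(real k * pi)\<^sup>2 * integral {r..t} (\<lambda>s. cosine_coeff (w s) k) =
    - (cosine_coeff (\<rho> t) k - cosine_coeff (\<rho> r) k)
    + \<kappa> * integral {r..t} (\<lambda>s. \<alpha> - left_trace s) + \<kappa> * cos (real k * pi * 1) * integral {r..t} (\<lambda>s. \<beta> - right_trace s)"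
proof -
  let ?c = "real k * pi"
  have d1: "((\<lambda>u. cos (?c * u)) has_real_derivative (- ?c * sin (?c * u))) (at u)" for u
    by (auto intro!: derivative_eq_intros)
  have d2: "((\<lambda>u. - ?c * sin (?c * u)) has_real_derivative (- (?c\<^sup>2) * cos (?c * u))) (at u)" for u
    by (auto intro!: derivative_eq_intros simp: power2_eq_square)
  have s0: "sin (?c * 1) = 0" "sin (?c * 0) = 0" by (simp_all add: sin_npi)
  have sub: "bmeas {r..t} left_trace" "bmeas {r..t} right_trace" using assms by (auto intro!: bmeas_subset[OF trace_bmeas(1)] bmeas_subset[OF trace_bmeas(2)])
  have lap: "integral {0..1} (\<lambda>u. w s u * (- (?c\<^sup>2) * cos (?c * u))) = - (?c\<^sup>2) * cosine_coeff (w s) k" for s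
    unfolding cosine_coeff_def by (subst integral_mult_right[symmetric]) (simp add: mult_ac)
  have bd: "integral {r..t} (\<lambda>s. cos (?c * 0) * (\<alpha> - left_trace s) + cos (?c * 1) * (\<beta> - right_trace s)) =
      integral {r..t} (\<lambda>s. \<alpha> - left_trace s) + cos (?c * 1) * integral {r..t} (\<lambda>s. \<beta> - right_trace s)"
    by (subst integral_add) (auto intro!: bmeas_integrable bmeas_intros sub)
  have "cosine_coeff (\<rho> t) k - cosine_coeff (\<rho> r) k =
      integral {r..t} (\<lambda>s. - (?c\<^sup>2) * cosine_coeff (w s) k)
      - integral {r..t} (\<lambda>s. right_trace s ^ m * (- ?c * sin (?c * 1)) - left_trace s ^ m * (- ?c * sin (?c * 0)))
      + \<kappa> * (integral {r..t} (\<lambda>s. \<alpha> - left_trace s) + cos (?c * 1) * integral {r..t} (\<lambda>s. \<beta> - right_trace s))"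
    using weak_form_stationary[OF d1 d2 _ assms] unfolding lap bd cosine_coeff_def
    by (simp add: continuous_intros)
  then show ?thesis unfolding s0 by (simp add: algebra_simps)
qed

text \<open>An affine function has no second derivative, but its slope \<open>B - A\<close> leaves the boundary values of \<open>\<rho>\<^sup>m\<close>.\<close>

lemma weak_form_affine:
  assumes "0 \<le> r" "r \<le> t" "t \<le> T"
  shows "integral {0..1} (\<lambda>u. (\<rho> t u - \<rho> r u) * L u) =
    - (B - A) * integral {r..t} (\<lambda>s. right_trace s ^ m - left_trace s ^ m)
    + \<kappa> * (A * integral {r..t} (\<lambda>s. \<alpha> - left_trace s) + B * integral {r..t} (\<lambda>s. \<beta> - right_trace s))"
proof -
  have d1: "(L has_real_derivative (B - A)) (at u)" for u
    unfolding L_def by (auto intro!: derivative_eq_intros)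
  have d2: "((\<lambda>u. B - A) has_real_derivative 0) (at u)" for u by simp
  have tr: "t \<in> {0..T}" "r \<in> {0..T}" using assms by auto
  have sub: "bmeas {r..t} left_trace" "bmeas {r..t} right_trace" using assms by (auto intro!: bmeas_subset[OF trace_bmeas(1)] bmeas_subset[OF trace_bmeas(2)])
  have bd: "integral {r..t} (\<lambda>s. L 0 * (\<alpha> - left_trace s) + L 1 * (\<beta> - right_trace s)) =
      A * integral {r..t} (\<lambda>s. \<alpha> - left_trace s) + B * integral {r..t} (\<lambda>s. \<beta> - right_trace s)"
    by (subst integral_add) (auto simp: L_def intro!: bmeas_integrable bmeas_intros sub)
  have fl: "integral {r..t} (\<lambda>s. right_trace s ^ m * (B - A) - left_trace s ^ m * (B - A)) = (B - A) * integral {r..t} (\<lambda>s. right_trace s ^ m - left_trace s ^ m)"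
    by (subst integral_mult_right[symmetric]) (simp add: algebra_simps)
  have "integral {0..1} (\<lambda>u. (\<rho> t u - \<rho> r u) * L u) =
      integral {0..1} (\<lambda>u. \<rho> t u * L u) - integral {0..1} (\<lambda>u. \<rho> r u * L u)"
    unfolding left_diff_distrib by (intro integral_diff bmeas_integrable bmeas_mult \<rho>_slice tr bmeas_continuous L_continuous)
  also have "\<dots> = integral {r..t} (\<lambda>s. integral {0..1} (\<lambda>u. w s u * 0))
      - (B - A) * integral {r..t} (\<lambda>s. right_trace s ^ m - left_trace s ^ m)
      + \<kappa> * (A * integral {r..t} (\<lambda>s. \<alpha> - left_trace s) + B * integral {r..t} (\<lambda>s. \<beta> - right_trace s))"
    using weak_form_stationary[OF d1 d2 _ assms] unfolding bd fl by simp
  finally show ?thesis by (simp add: left_diff_distrib)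
qed

end

section \<open>The energy step on a time window\<close>

lemma fejer_pairing:
  assumes "bmeas {0..1} f" "bmeas {0..1} v"
  shows "integral {0..1} (\<lambda>u. f u * fejer N v u) = (\<Sum>k<N. fejer_weight N k * cosine_coeff v k * cosine_coeff f k)"
proof -
  have "integral {0..1} (\<lambda>u. f u * fejer N v u) =
      integral {0..1} (\<lambda>u. \<Sum>k<N. fejer_weight N k * cosine_coeff v k * (f u * cos (real k * pi * u)))"
    unfolding fejer_def sum_distrib_left by (intro arg_cong2[where f = integral] ext sum.cong refl) simp
  also have "\<dots> = (\<Sum>k<N. integral {0..1} (\<lambda>u. fejer_weight N k * cosine_coeff v k * (f u * cos (real k * pi * u))))"
    by (intro integral_sum finite_lessThan bmeas_integrable bmeas_intros bmeas_cos assms)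
  finally show ?thesis by (simp add: cosine_coeff_def)
qed

lemma bmeas_fejer: "bmeas {a..b} (fejer N v)"
  unfolding fejer_def by (intro bmeas_intros bmeas_cos)

text \<open>This moves the derivative from the solution to the test function \<open>H\<close> of the energy; the boundary values of \<open>H\<close> appear because
the cosines do not vanish at the ends.\<close>

lemma sine_coeff_by_parts:
  assumes H: "\<And>u. u \<in> {0..1} \<Longrightarrow> (H has_real_derivative H' u) (at u within {0..1})"
    and H': "continuous_on {0..1} H'"
  shows "real k * pi * integral {0..1} (\<lambda>u. H u * sin (real k * pi * u)) =
    H 0 - cos (real k * pi * 1) * H 1 + cosine_coeff H' k"
proof -
  let ?c = "real k * pi"
  have Hc: "continuous_on {0..1} H" using H by (rule DERIV_continuous_on)
  have m: "bmeas {0..1} H" "bmeas {0..1} H'" by (rule bmeas_continuous[OF Hc], rule bmeas_continuous[OF H'])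
  have "((\<lambda>u. H' u * cos (?c * u) - ?c * (H u * sin (?c * u))) has_integral
      (H 1 * cos (?c * 1) - H 0 * cos (?c * 0))) {0..1}"
  proof (intro fundamental_theorem_of_calculus)
    fix u :: real assume u: "u \<in> {0..1}"
    have "((\<lambda>u. H u * cos (?c * u)) has_real_derivative (H' u * cos (?c * u) - ?c * (H u * sin (?c * u)))) (at u within {0..1})"
      by (auto intro!: derivative_eq_intros H[OF u])
    then show "((\<lambda>u. H u * cos (?c * u)) has_vector_derivative (H' u * cos (?c * u) - ?c * (H u * sin (?c * u)))) (at u within {0..1})"
      by (simp add: has_real_derivative_iff_has_vector_derivative)
  qed simp
  then have "integral {0..1} (\<lambda>u. H' u * cos (?c * u) - ?c * (H u * sin (?c * u))) = H 1 * cos (?c * 1) - H 0"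
    by (simp add: integral_unique)
  moreover have "integral {0..1} (\<lambda>u. H' u * cos (?c * u) - ?c * (H u * sin (?c * u))) =
      cosine_coeff H' k - ?c * integral {0..1} (\<lambda>u. H u * sin (?c * u))"
    unfolding cosine_coeff_def
    by (subst integral_diff) (auto intro!: bmeas_integrable bmeas_intros bmeas_cos bmeas_sin m)
  ultimately show ?thesis by (simp add: mult.commute)
qed

context robin_solution begin

text \<open>For \<open>v = w t\<close> with boundary values \<open>a\<close> and \<open>b\<close> this is formally \<open>\<integral>\<close> over \<open>s \<in> [r, t]\<close> of \<open>\<langle>\<partial>\<^sub>u w\<^sub>s, \<partial>\<^sub>u v\<rangle>\<close>, as obtained by
testing the equation on \<open>[r, t]\<close> with \<open>v - L\<close>. The general \<open>v\<close> leaves room for the Fejer means of \<open>w t\<close>.\<close>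

definition balance :: "real \<Rightarrow> real \<Rightarrow> (real \<Rightarrow> real) \<Rightarrow> real \<Rightarrow> real \<Rightarrow> real" where
  "balance r t v a b =
    - integral {0..1} (\<lambda>u. (\<rho> t u - \<rho> r u) * (v u - L u))
    + \<kappa> * ((a - A) * integral {r..t} (\<lambda>s. \<alpha> - left_trace s))
    + \<kappa> * ((b - B) * integral {r..t} (\<lambda>s. \<beta> - right_trace s))
    + (B - A) * integral {r..t} (\<lambda>s. right_trace s ^ m - left_trace s ^ m)"

text \<open>The balance of \<open>w t\<close> with its first term replaced by the difference of \<open>\<Psi>\<close>, which bounds it from above by convexity.\<close>

definition balance_bound :: "real \<Rightarrow> real \<Rightarrow> real" where
  "balance_bound r t = \<Psi> r - \<Psi> t
    + \<kappa> * ((left_trace t ^ m - A) * integral {r..t} (\<lambda>s. \<alpha> - left_trace s))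
    + \<kappa> * ((right_trace t ^ m - B) * integral {r..t} (\<lambda>s. \<beta> - right_trace s))
    + (B - A) * integral {r..t} (\<lambda>s. right_trace s ^ m - left_trace s ^ m)"

lemma fejer_w_range': "t \<in> {0..T} \<Longrightarrow> 0 \<le> fejer N (w t) u \<and> fejer N (w t) u \<le> 1"
  using fejer_w_range[of t N u] by (cases "N = 0") (auto simp: fejer_def)

lemma trace_power_range: "0 \<le> left_trace t ^ m" "left_trace t ^ m \<le> 1" "0 \<le> right_trace t ^ m" "right_trace t ^ m \<le> 1"
  using trace_range[of t] by (auto intro: power_le_one)

lemma balance_abs_le:
  assumes rt: "0 \<le> r" "r \<le> t" "t \<le> T" and v: "bmeas {0..1} v" "\<And>u. u \<in> {0..1} \<Longrightarrow> 0 \<le> v u \<and> v u \<le> 1"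
    and ab: "0 \<le> a" "a \<le> 1" "0 \<le> b" "b \<le> 1"
  shows "\<bar>balance r t v a b\<bar> \<le> 1 + \<kappa> * T + \<kappa> * T + T"
proof -
  have tr: "t \<in> {0..T}" "r \<in> {0..T}" using rt by auto
  have sub: "bmeas {r..t} left_trace" "bmeas {r..t} right_trace" using rt by (auto intro!: bmeas_subset[OF trace_bmeas(1)] bmeas_subset[OF trace_bmeas(2)])
  have "\<bar>integral {0..1} (\<lambda>u. (\<rho> t u - \<rho> r u) * (v u - L u))\<bar> \<le> (1 * 1) * (1 - 0)"
  proof (rule bmeas_integral_abs_le)
    show "bmeas {0..1} (\<lambda>u. (\<rho> t u - \<rho> r u) * (v u - L u))"
      by (intro bmeas_intros \<rho>_slice tr v bmeas_continuous L_continuous)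
    fix u :: real assume u: "u \<in> {0..1}"
    have "\<bar>\<rho> t u - \<rho> r u\<bar> \<le> 1" using \<rho>_range[OF tr(1) u] \<rho>_range[OF tr(2) u] by (auto simp: abs_le_iff)
    moreover have "\<bar>v u - L u\<bar> \<le> 1" using v(2)[OF u] L_range[OF u] by (auto simp: abs_le_iff)
    ultimately show "\<bar>(\<rho> t u - \<rho> r u) * (v u - L u)\<bar> \<le> 1 * 1"
      unfolding abs_mult by (intro mult_mono) auto
  qed simp
  then have 1: "\<bar>integral {0..1} (\<lambda>u. (\<rho> t u - \<rho> r u) * (v u - L u))\<bar> \<le> 1" by simp
  have I: "\<bar>integral {r..t} f\<bar> \<le> T" if f: "bmeas {r..t} f" "\<And>s. s \<in> {r..t} \<Longrightarrow> \<bar>f s\<bar> \<le> 1" for f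
  proof -
    have "\<bar>integral {r..t} f\<bar> \<le> 1 * (t - r)" by (rule bmeas_integral_abs_le[OF f(1) rt(2) f(2)])
    then show ?thesis using rt by simp
  qed
  have I0: "\<bar>integral {r..t} (\<lambda>s. \<alpha> - left_trace s)\<bar> \<le> T"
    using trace_range(1) \<alpha> by (intro I bmeas_intros sub) (simp add: abs_le_iff, smt (verit))
  have I1: "\<bar>integral {r..t} (\<lambda>s. \<beta> - right_trace s)\<bar> \<le> T"
    using trace_range(2) \<beta> by (intro I bmeas_intros sub) (simp add: abs_le_iff, smt (verit))
  have I2: "\<bar>integral {r..t} (\<lambda>s. right_trace s ^ m - left_trace s ^ m)\<bar> \<le> T"
  proof (intro I bmeas_intros sub)
    fix s show "\<bar>right_trace s ^ m - left_trace s ^ m\<bar> \<le> 1" using trace_power_range[of s] by linarith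
  qed
  have P: "\<bar>(p - q) * J\<bar> \<le> T" if "0 \<le> p" "p \<le> 1" "0 \<le> q" "q \<le> 1" "\<bar>J\<bar> \<le> T" for p q J :: real
  proof -
    have "\<bar>p - q\<bar> * \<bar>J\<bar> \<le> 1 * T" using that by (intro mult_mono) auto
    then show ?thesis by (simp add: abs_mult)
  qed
  have K: "\<bar>\<kappa> * z\<bar> \<le> \<kappa> * T" if "\<bar>z\<bar> \<le> T" for z using that \<kappa> by (simp add: abs_mult)
  show ?thesis
    unfolding balance_def
    using 1 K[OF P[OF ab(1,2) AB_range(1,2) I0]] K[OF P[OF ab(3,4) AB_range(3,4) I1]] P[OF AB_range(3,4,1,2) I2]
    by linarith
qed

lemma balance_le_bound:
  assumes "0 \<le> r" "r \<le> t" "t \<le> T"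
  shows "balance r t (w t) (left_trace t ^ m) (right_trace t ^ m) \<le> balance_bound r t"
  using \<Psi>_convexity[of t r] assms by (simp add: balance_def balance_bound_def)

text \<open>The sum on the left is the pairing of the time-integrated Dirichlet form with the Fejer mean. Each mode is
replaced by means of the weak formulation, and the sums are recognized as pairings with, and
end point values of, the Fejer mean; the affine identity accounts for \<open>L\<close>.\<close>

lemma fejer_balance:
  assumes rt: "0 \<le> r" "r \<le> t" "t \<le> T"
  shows "(\<Sum>k<N. fejer_weight N k * (real k * pi)\<^sup>2 * (cosine_coeff (w t) k * integral {r..t} (\<lambda>s. cosine_coeff (w s) k)))
    = balance r t (fejer N (w t)) (fejer N (w t) 0) (fejer N (w t) 1)"
proof -
  let ?I0 = "integral {r..t} (\<lambda>s. \<alpha> - left_trace s)" and ?I1 = "integral {r..t} (\<lambda>s. \<beta> - right_trace s)"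
  let ?d = "\<lambda>k. fejer_weight N k * cosine_coeff (w t) k"
  have tr: "t \<in> {0..T}" "r \<in> {0..T}" using rt by auto
  have "(\<Sum>k<N. fejer_weight N k * (real k * pi)\<^sup>2 * (cosine_coeff (w t) k * integral {r..t} (\<lambda>s. cosine_coeff (w s) k))) =
      (\<Sum>k<N. ?d k * ((real k * pi)\<^sup>2 * integral {r..t} (\<lambda>s. cosine_coeff (w s) k)))"
    by (intro sum.cong refl) (simp add: mult_ac)
  also have "\<dots> = (\<Sum>k<N. (?d k * cosine_coeff (\<rho> r) k - ?d k * cosine_coeff (\<rho> t) k)
      + (\<kappa> * ?I0) * (?d k * cos (real k * pi * 0)) + (\<kappa> * ?I1) * (?d k * cos (real k * pi * 1)))"
    unfolding weak_form_cos[OF rt] by (intro sum.cong refl) (simp add: algebra_simps)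
  also have "\<dots> = ((\<Sum>k<N. ?d k * cosine_coeff (\<rho> r) k) - (\<Sum>k<N. ?d k * cosine_coeff (\<rho> t) k))
      + (\<kappa> * ?I0) * fejer N (w t) 0 + (\<kappa> * ?I1) * fejer N (w t) 1"
    unfolding fejer_def sum.distrib sum_subtractf sum_distrib_left ..
  also have "(\<Sum>k<N. ?d k * cosine_coeff (\<rho> r) k) = integral {0..1} (\<lambda>u. \<rho> r u * fejer N (w t) u)"
    by (rule fejer_pairing[symmetric]) (intro \<rho>_slice w_slice tr)+
  also have "(\<Sum>k<N. ?d k * cosine_coeff (\<rho> t) k) = integral {0..1} (\<lambda>u. \<rho> t u * fejer N (w t) u)"
    by (rule fejer_pairing[symmetric]) (intro \<rho>_slice w_slice tr)+
  finally have 1: "(\<Sum>k<N. fejer_weight N k * (real k * pi)\<^sup>2 * (cosine_coeff (w t) k * integral {r..t} (\<lambda>s. cosine_coeff (w s) k))) =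
      (integral {0..1} (\<lambda>u. \<rho> r u * fejer N (w t) u) - integral {0..1} (\<lambda>u. \<rho> t u * fejer N (w t) u))
      + (\<kappa> * ?I0) * fejer N (w t) 0 + (\<kappa> * ?I1) * fejer N (w t) 1" .
  have m: "bmeas {0..1} (\<rho> t)" "bmeas {0..1} (\<rho> r)" "bmeas {0..1} (fejer N (w t))" "bmeas {0..1} L"
    using tr by (auto intro: \<rho>_slice bmeas_fejer bmeas_continuous L_continuous)
  have "integral {0..1} (\<lambda>u. (\<rho> t u - \<rho> r u) * (fejer N (w t) u - L u)) =
      integral {0..1} (\<lambda>u. (\<rho> t u - \<rho> r u) * fejer N (w t) u) - integral {0..1} (\<lambda>u. (\<rho> t u - \<rho> r u) * L u)"
    unfolding right_diff_distrib by (intro integral_diff bmeas_integrable bmeas_intros m)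
  also have "integral {0..1} (\<lambda>u. (\<rho> t u - \<rho> r u) * fejer N (w t) u) =
      integral {0..1} (\<lambda>u. \<rho> t u * fejer N (w t) u) - integral {0..1} (\<lambda>u. \<rho> r u * fejer N (w t) u)"
    unfolding left_diff_distrib by (intro integral_diff bmeas_integrable bmeas_intros m)
  finally show ?thesis
    unfolding 1 balance_def weak_form_affine[OF rt] by (simp add: algebra_simps)
qed

lemma fejer_balance_tendsto:
  assumes rt: "0 \<le> r" "r \<le> t" "t \<le> T" and H: "w t \<in> H1"
  shows "(\<lambda>N. balance r t (fejer N (w t)) (fejer N (w t) 0) (fejer N (w t) 1)) \<longlonglongrightarrow>
    balance r t (w t) (left_trace t ^ m) (right_trace t ^ m)"
proof -
  have tr: "t \<in> {0..T}" "r \<in> {0..T}" using rt by auto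
  note lim = fejer_w_limits[OF tr(1) H]
  have "(\<lambda>N. integral {0..1} (\<lambda>u. (\<rho> t u - \<rho> r u) * (fejer N (w t) u - L u))) \<longlonglongrightarrow>
      integral {0..1} (\<lambda>u. (\<rho> t u - \<rho> r u) * (w t u - L u))"
  proof (rule bmeas_tendsto_integral[where B = "1 * 1"])
    show "AE u in lebesgue_on {0..1}. (\<lambda>N. (\<rho> t u - \<rho> r u) * (fejer N (w t) u - L u)) \<longlonglongrightarrow> (\<rho> t u - \<rho> r u) * (w t u - L u)"
      using lim(1) by eventually_elim (intro tendsto_intros)
    show "AE u in lebesgue_on {0..1}. \<bar>(\<rho> t u - \<rho> r u) * (fejer N (w t) u - L u)\<bar> \<le> 1 * 1" for N
    proof (rule AE_I2)
      fix u :: real assume "u \<in> space (lebesgue_on {0..1})"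
      then have u: "u \<in> {0..1}" by simp
      have "\<bar>\<rho> t u - \<rho> r u\<bar> \<le> 1" using \<rho>_range[OF tr(1) u] \<rho>_range[OF tr(2) u] by (auto simp: abs_le_iff)
      moreover have "\<bar>fejer N (w t) u - L u\<bar> \<le> 1" using fejer_w_range'[OF tr(1), of N u] L_range[OF u] by (auto simp: abs_le_iff)
      ultimately show "\<bar>(\<rho> t u - \<rho> r u) * (fejer N (w t) u - L u)\<bar> \<le> 1 * 1"
        unfolding abs_mult by (intro mult_mono) auto
    qed
  qed (intro bmeas_intros \<rho>_slice w_slice tr bmeas_fejer bmeas_continuous L_continuous)+
  then show ?thesis
    unfolding balance_def by (intro tendsto_add tendsto_minus tendsto_mult tendsto_diff tendsto_const lim)
qed

text \<open>Integrating the previous identity over the window turns each product of a coefficient with its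
primitive into half a square.\<close>

lemma dirichlet_sum_eq:
  assumes r: "0 \<le> r" "r \<le> s" "s \<le> T"
  shows "bmeas {r..s} (\<lambda>t. balance r t (fejer N (w t)) (fejer N (w t) 0) (fejer N (w t) 1))"
    and "(\<Sum>k<N. fejer_weight N k * (real k * pi * integral {r..s} (\<lambda>t. cosine_coeff (w t) k))\<^sup>2) =
    2 * integral {r..s} (\<lambda>t. balance r t (fejer N (w t)) (fejer N (w t) 0) (fejer N (w t) 1))"
proof -
  let ?d = "\<lambda>k t. cosine_coeff (w t) k"
  let ?q = "\<lambda>t. balance r t (fejer N (w t)) (fejer N (w t) 0) (fejer N (w t) 1)"
  let ?S = "\<lambda>t. \<Sum>k<N. fejer_weight N k * (real k * pi)\<^sup>2 * (?d k t * integral {r..t} (?d k))"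
  have d: "bmeas {r..s} (?d k)" for k using r by (intro bmeas_subset[OF cosine_coeff_w_bmeas]) auto
  have dd: "bmeas {r..s} (\<lambda>t. ?d k t * integral {r..t} (?d k))" for k by (intro bmeas_mult d bmeas_primitive)
  have S: "bmeas {r..s} ?S" by (intro bmeas_sum bmeas_mult bmeas_const dd[unfolded bmeas_mult])
  have eq: "?S t = ?q t" if "t \<in> {r..s}" for t using that r by (intro fejer_balance) auto
  show "bmeas {r..s} ?q" by (rule bmeas_cong[OF S eq])
  have "integral {r..s} ?q = integral {r..s} ?S" by (intro integral_cong eq[symmetric])
  also have "\<dots> = (\<Sum>k<N. fejer_weight N k * (real k * pi)\<^sup>2 * integral {r..s} (\<lambda>t. ?d k t * integral {r..t} (?d k)))"
    by (subst integral_sum) (auto intro!: bmeas_integrable bmeas_mult[OF bmeas_const dd])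
  finally have "2 * integral {r..s} ?q =
      (\<Sum>k<N. fejer_weight N k * (real k * pi)\<^sup>2 * (2 * integral {r..s} (\<lambda>t. ?d k t * integral {r..t} (?d k))))"
    by (simp add: sum_distrib_left mult_ac)
  then show "(\<Sum>k<N. fejer_weight N k * (real k * pi * integral {r..s} (?d k))\<^sup>2) = 2 * integral {r..s} ?q"
    unfolding square_of_primitive[OF d r(2), symmetric] by (simp add: power_mult_distrib mult_ac)
qed

lemma balance_integral_tendsto:
  assumes r: "0 \<le> r" "r \<le> s" "s \<le> T" and bb: "bmeas {r..s} (balance_bound r)"
  obtains l where "(\<lambda>N. integral {r..s} (\<lambda>t. balance r t (fejer N (w t)) (fejer N (w t) 0) (fejer N (w t) 1))) \<longlonglongrightarrow> l"
    and "l \<le> integral {r..s} (balance_bound r)"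
proof -
  let ?C = "1 + \<kappa> * T + \<kappa> * T + T"
  let ?q = "\<lambda>N t. balance r t (fejer N (w t)) (fejer N (w t) 0) (fejer N (w t) 1)"
  let ?b = "\<lambda>t. balance r t (w t) (left_trace t ^ m) (right_trace t ^ m)"
  have q: "bmeas {r..s} (?q N)" for N by (rule dirichlet_sum_eq(1)[OF r])
  have good: "AE t in lebesgue_on {r..s}. t \<in> {0..T} \<and> w t \<in> H1"
    by (rule AE_lebesgue_on_subset[OF AE_H1]) (use r in auto)
  moreover have "AE t in lebesgue_on {r..s}. t \<in> {r..s}" by (intro AE_I2) auto
  ultimately have lim: "AE t in lebesgue_on {r..s}. (\<lambda>N. ?q N t) \<longlonglongrightarrow> ?b t"
  proof eventually_elim
    case (elim t)
    then show ?case using r by (intro fejer_balance_tendsto) auto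
  qed
  have b: "bmeas {r..s} ?b"
  proof (rule bmeasI)
    show "?b \<in> borel_measurable (lebesgue_on {r..s})"
      by (rule bmeas_limit_AE[OF bmeas_measurable[OF q] _ lim]) auto
    fix t assume "t \<in> {r..s}"
    then have t: "0 \<le> r" "r \<le> t" "t \<le> T" "t \<in> {0..T}" using r by auto
    show "\<bar>?b t\<bar> \<le> ?C"
      by (rule balance_abs_le[OF t(1-3) w_slice[OF t(4)] w_range[OF t(4)] trace_power_range])
  qed
  have "(\<lambda>N. integral {r..s} (?q N)) \<longlonglongrightarrow> integral {r..s} ?b"
  proof (rule bmeas_tendsto_integral[OF q b lim, where B = ?C])
    show "AE t in lebesgue_on {r..s}. \<bar>?q N t\<bar> \<le> ?C" for N
    proof (rule AE_I2)
      fix t assume "t \<in> space (lebesgue_on {r..s})"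
      then have t: "0 \<le> r" "r \<le> t" "t \<le> T" "t \<in> {0..T}" using r by auto
      show "\<bar>?q N t\<bar> \<le> ?C"
        by (rule balance_abs_le[OF t(1-3) bmeas_fejer]) (use fejer_w_range'[OF t(4)] in auto)
    qed
  qed
  moreover have "integral {r..s} ?b \<le> integral {r..s} (balance_bound r)"
    using r by (intro integral_le bmeas_integrable b bb balance_le_bound) auto
  ultimately show thesis by (rule that)
qed

lemma balance_bound_bmeas:
  assumes r: "0 \<le> r" "r \<le> s" "s \<le> T"
  shows "bmeas {r..s} (balance_bound r)"
proof -
  have sub: "bmeas {r..s} left_trace" "bmeas {r..s} right_trace" "bmeas {r..s} \<Psi>"
    using r by (auto intro!: bmeas_subset[OF trace_bmeas(1)] bmeas_subset[OF trace_bmeas(2)] bmeas_subset[OF \<Psi>_bmeas])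
  show ?thesis unfolding balance_bound_def[abs_def]
    by (intro bmeas_add bmeas_mult bmeas_diff bmeas_const bmeas_power bmeas_primitive sub)
qed

text \<open>The left-hand side is the duality pairing of \<open>- \<partial>\<^sub>u w\<close>, averaged over the window, with \<open>H\<close>. In terms of
cosine modes, Young's inequality for every mode bounds it by the Dirichlet sum of the averaged solution, which
is controlled by the balance, and by the squared sine coefficients of \<open>H\<close>, which are controlled by Bessel's inequality.
Only then does the number of modes tend to infinity.\<close>

lemma energy_step:
  assumes r: "0 \<le> r" "0 < h" "r + h \<le> T"
    and H: "\<And>u. u \<in> {0..1} \<Longrightarrow> (H has_real_derivative H' u) (at u within {0..1})"
    and H': "continuous_on {0..1} H'"
  shows "integral {r..r + h} (\<lambda>t. integral {0..1} (\<lambda>u. w t u * H' u) + left_trace t ^ m * H 0 - right_trace t ^ m * H 1) / h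
    \<le> 2 / h\<^sup>2 * integral {r..r + h} (balance_bound r) + 1 / 4 * integral {0..1} (\<lambda>u. (H u)\<^sup>2)"
proof -
  let ?J = "{r..r + h}"
  define p where "p k = integral ?J (\<lambda>t. cosine_coeff (w t) k)" for k
  define s where "s k = integral {0..1} (\<lambda>u. H u * sin (real k * pi * u))" for k
  define q where "q N t = balance r t (fejer N (w t)) (fejer N (w t) 0) (fejer N (w t) 1)" for N t
  have r': "0 \<le> r" "r \<le> r + h" "r + h \<le> T" using r by auto
  have Hc: "continuous_on {0..1} H" using H by (rule DERIV_continuous_on)
  have Hm: "bmeas {0..1} H" "bmeas {0..1} H'" by (rule bmeas_continuous[OF Hc], rule bmeas_continuous[OF H'])
  have d: "bmeas ?J (\<lambda>t. cosine_coeff (w t) k)" for k using r by (intro bmeas_subset[OF cosine_coeff_w_bmeas]) auto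
  have young: "(\<Sum>k<N. fejer_weight N k * (real k * pi * p k * s k)) / h \<le>
      2 / h\<^sup>2 * integral ?J (q N) + 1 / 4 * integral {0..1} (\<lambda>u. (H u)\<^sup>2)" for N
  proof -
    have "(\<Sum>k<N. fejer_weight N k * (real k * pi * p k * s k)) / h =
        (\<Sum>k<N. fejer_weight N k * ((real k * pi * p k / h) * s k))"
      by (simp add: sum_divide_distrib mult_ac)
    also have "\<dots> \<le> (\<Sum>k<N. fejer_weight N k * ((real k * pi * p k / h)\<^sup>2 + (s k)\<^sup>2 / 4))"
    proof (intro sum_mono mult_left_mono fejer_weight_nonneg)
      fix k show "(real k * pi * p k / h) * s k \<le> (real k * pi * p k / h)\<^sup>2 + (s k)\<^sup>2 / 4"
        using zero_le_power2[of "real k * pi * p k / h - s k / 2"] by (simp add: power2_diff power_divide)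
    qed simp
    also have "\<dots> = (\<Sum>k<N. fejer_weight N k * (real k * pi * p k)\<^sup>2) / h\<^sup>2 + (\<Sum>k<N. fejer_weight N k * (s k)\<^sup>2) / 4"
      by (simp add: distrib_left sum.distrib sum_divide_distrib power_divide)
    also have "(\<Sum>k<N. fejer_weight N k * (real k * pi * p k)\<^sup>2) = 2 * integral ?J (q N)"
      unfolding p_def q_def by (rule dirichlet_sum_eq(2)[OF r'])
    also have "(\<Sum>k<N. fejer_weight N k * (s k)\<^sup>2) \<le> integral {0..1} (\<lambda>u. (H u)\<^sup>2)"
    proof -
      have s0: "s 0 = 0" by (simp add: s_def)
      have "(\<Sum>k<N. fejer_weight N k * (s k)\<^sup>2) \<le> (\<Sum>k<N. 2 * (s k)\<^sup>2)"
        by (intro sum_mono mult_right_mono fejer_weight_le_2) simp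
      also have "\<dots> = (\<Sum>k\<in>{..<N} - {0}. 2 * (s k)\<^sup>2)" by (rule sum.mono_neutral_right) (auto simp: s0)
      also have "\<dots> \<le> (\<Sum>k=1..N. 2 * (s k)\<^sup>2)" by (rule sum_mono2) auto
      also have "\<dots> = 2 * (\<Sum>k=1..N. (s k)\<^sup>2)" by (simp add: sum_distrib_left)
      also have "\<dots> \<le> (\<integral>u. (H u)\<^sup>2 \<partial>lebesgue_on {0..1})"
        using sine_bessel[OF bmeas_measurable[OF Hm(1)] bmeas_lebesgue_integrable[OF bmeas_power[OF Hm(1)]], of N]
        unfolding s_def by (simp add: bmeas_integral_eq[OF bmeas_mult[OF Hm(1) bmeas_sin]])
      also have "\<dots> = integral {0..1} (\<lambda>u. (H u)\<^sup>2)" by (rule bmeas_integral_eq[OF bmeas_power[OF Hm(1)]])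
      finally show ?thesis .
    qed
    finally show ?thesis by simp
  qed
  define z where "z N t = integral {0..1} (\<lambda>u. H' u * fejer N (w t) u) + fejer N (w t) 0 * H 0 - fejer N (w t) 1 * H 1" for N t
  have dual: "(\<Sum>k<N. fejer_weight N k * (real k * pi * p k * s k)) = integral ?J (z N)" and zm: "bmeas ?J (z N)" for N
  proof -
    let ?c = "\<lambda>k. fejer_weight N k * (H 0 - cos (real k * pi * 1) * H 1 + cosine_coeff H' k)"
    have z: "z N t = (\<Sum>k<N. ?c k * cosine_coeff (w t) k)" if t: "t \<in> ?J" for t
    proof -
      have "t \<in> {0..T}" using t r by auto
      then have "integral {0..1} (\<lambda>u. H' u * fejer N (w t) u) = (\<Sum>k<N. fejer_weight N k * cosine_coeff (w t) k * cosine_coeff H' k)"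
        by (intro fejer_pairing Hm w_slice)
      then show ?thesis
        unfolding z_def fejer_def by (simp add: sum_distrib_left sum_distrib_right flip: sum.distrib sum_subtractf)
          (intro sum.cong refl, simp add: algebra_simps)
    qed
    have zs: "bmeas ?J (\<lambda>t. \<Sum>k<N. ?c k * cosine_coeff (w t) k)" by (intro bmeas_sum bmeas_mult[OF bmeas_const d])
    show "bmeas ?J (z N)" by (rule bmeas_cong[OF zs z[symmetric]])
    have "integral ?J (z N) = integral ?J (\<lambda>t. \<Sum>k<N. ?c k * cosine_coeff (w t) k)" by (intro integral_cong z)
    also have "\<dots> = (\<Sum>k<N. integral ?J (\<lambda>t. ?c k * cosine_coeff (w t) k))"
      by (intro integral_sum finite_lessThan bmeas_integrable bmeas_mult[OF bmeas_const d])
    also have "\<dots> = (\<Sum>k<N. ?c k * p k)" by (simp add: p_def)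
    also have "\<dots> = (\<Sum>k<N. fejer_weight N k * (real k * pi * p k * s k))"
      using sine_coeff_by_parts[OF H H'] unfolding s_def[symmetric]
      by (intro sum.cong refl) (simp add: mult_ac)
    finally show "(\<Sum>k<N. fejer_weight N k * (real k * pi * p k * s k)) = integral ?J (z N)" by simp
  qed
  define Z where "Z t = integral {0..1} (\<lambda>u. w t u * H' u) + left_trace t ^ m * H 0 - right_trace t ^ m * H 1" for t
  have Zm: "bmeas ?J Z"
  proof -
    have "bmeas {0..T} Z" unfolding Z_def w_def
      by (intro bmeas_diff bmeas_add bmeas_mult bmeas_const bmeas_power trace_bmeas space_integral_bmeas_fixed H')
    then show ?thesis by (rule bmeas_subset) (use r in auto)
  qed
  obtain D where D: "\<And>u. u \<in> {0..1} \<Longrightarrow> \<bar>H' u\<bar> \<le> D" using bmeas_bound[OF Hm(2)] by blast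
  have "(\<lambda>N. integral ?J (z N)) \<longlonglongrightarrow> integral ?J Z"
  proof (rule bmeas_tendsto_integral[OF zm Zm, where B = "D + \<bar>H 0\<bar> + \<bar>H 1\<bar>"])
    have good: "AE t in lebesgue_on ?J. t \<in> {0..T} \<and> w t \<in> H1"
      by (rule AE_lebesgue_on_subset[OF AE_H1]) (use r in auto)
    then show "AE t in lebesgue_on ?J. (\<lambda>N. z N t) \<longlonglongrightarrow> Z t"
    proof eventually_elim
      case (elim t)
      then have t: "t \<in> {0..T}" and Ht: "w t \<in> H1" by auto
      have "(\<lambda>N. integral {0..1} (\<lambda>u. H' u * fejer N (w t) u)) \<longlonglongrightarrow> integral {0..1} (\<lambda>u. H' u * w t u)"
      proof (rule bmeas_tendsto_integral[where B = D])
        show "AE u in lebesgue_on {0..1}. (\<lambda>N. H' u * fejer N (w t) u) \<longlonglongrightarrow> H' u * w t u"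
          using fejer_w_limits(1)[OF t Ht] by eventually_elim (intro tendsto_intros)
        show "AE u in lebesgue_on {0..1}. \<bar>H' u * fejer N (w t) u\<bar> \<le> D" for N
        proof (rule AE_I2)
          fix u :: real assume "u \<in> space (lebesgue_on {0..1})"
          then have "\<bar>H' u\<bar> * \<bar>fejer N (w t) u\<bar> \<le> D * 1"
            using D[of u] fejer_w_range'[OF t, of N u] by (intro mult_mono) auto
          then show "\<bar>H' u * fejer N (w t) u\<bar> \<le> D" by (simp add: abs_mult)
        qed
      qed (intro bmeas_mult Hm bmeas_fejer w_slice t)+
      then show ?case unfolding z_def Z_def mult.commute[of "w t _"]
        by (intro tendsto_add tendsto_diff tendsto_mult tendsto_const fejer_w_limits(2,3)[OF t Ht])
    qed
    show "AE t in lebesgue_on ?J. \<bar>z N t\<bar> \<le> D + \<bar>H 0\<bar> + \<bar>H 1\<bar>" for N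
    proof (rule AE_I2)
      fix t assume "t \<in> space (lebesgue_on ?J)"
      then have t: "t \<in> {0..T}" using r by auto
      have "\<bar>integral {0..1} (\<lambda>u. H' u * fejer N (w t) u)\<bar> \<le> D * (1 - 0)"
      proof (rule bmeas_integral_abs_le)
        fix u :: real assume "u \<in> {0..1}"
        then have "\<bar>H' u\<bar> * \<bar>fejer N (w t) u\<bar> \<le> D * 1"
          using D[of u] fejer_w_range'[OF t, of N u] by (intro mult_mono) auto
        then show "\<bar>H' u * fejer N (w t) u\<bar> \<le> D" by (simp add: abs_mult)
      qed (auto intro!: bmeas_mult Hm bmeas_fejer)
      then have 1: "\<bar>integral {0..1} (\<lambda>u. H' u * fejer N (w t) u)\<bar> \<le> D" by simp
      have 2: "\<bar>fejer N (w t) v * x\<bar> \<le> \<bar>x\<bar>" for v x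
        using fejer_w_range'[OF t, of N v] by (simp add: abs_mult mult_left_le_one_le)
      have "\<bar>a + b - c\<bar> \<le> a' + b' + c'" if "\<bar>a\<bar> \<le> a'" "\<bar>b\<bar> \<le> b'" "\<bar>c\<bar> \<le> c'" for a b c a' b' c' :: real
        using that by linarith
      from this[OF 1 2 2] show "\<bar>z N t\<bar> \<le> D + \<bar>H 0\<bar> + \<bar>H 1\<bar>" unfolding z_def .
    qed
  qed
  then have lhs: "(\<lambda>N. integral ?J (z N) / h) \<longlonglongrightarrow> integral ?J Z / h"
    using r by (intro tendsto_divide tendsto_const) auto
  obtain l where l: "(\<lambda>N. integral ?J (q N)) \<longlonglongrightarrow> l" "l \<le> integral ?J (balance_bound r)"
    unfolding q_def by (rule balance_integral_tendsto[OF r' balance_bound_bmeas[OF r']])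
  have rhs: "(\<lambda>N. 2 / h\<^sup>2 * integral ?J (q N) + 1 / 4 * integral {0..1} (\<lambda>u. (H u)\<^sup>2))
      \<longlonglongrightarrow> 2 / h\<^sup>2 * l + 1 / 4 * integral {0..1} (\<lambda>u. (H u)\<^sup>2)"
    by (intro tendsto_intros l)
  have "integral ?J Z / h \<le> 2 / h\<^sup>2 * l + 1 / 4 * integral {0..1} (\<lambda>u. (H u)\<^sup>2)"
    by (rule LIMSEQ_le[OF lhs rhs]) (use young in \<open>auto simp: dual\<close>)
  also have "\<dots> \<le> 2 / h\<^sup>2 * integral ?J (balance_bound r) + 1 / 4 * integral {0..1} (\<lambda>u. (H u)\<^sup>2)"
    by (intro add_right_mono mult_left_mono l) auto
  finally show ?thesis by (simp add: Z_def[abs_def])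
qed

end

section \<open>The energy inequality\<close>

context robin_solution begin

lemma integral_balance_bound:
  assumes r: "0 \<le> r" "0 \<le> h" "r + h \<le> T"
  shows "integral {r..r + h} (balance_bound r) = (h * \<Psi> r - integral {r..r + h} \<Psi>)
    + \<kappa> * triangle_int (\<lambda>t. left_trace t ^ m - A) (\<lambda>t. \<alpha> - left_trace t) h r
    + \<kappa> * triangle_int (\<lambda>t. right_trace t ^ m - B) (\<lambda>t. \<beta> - right_trace t) h r
    + (B - A) * triangle_int (\<lambda>_. 1) (\<lambda>t. right_trace t ^ m - left_trace t ^ m) h r"
proof -
  have m: "bmeas {r..r + h} \<Psi>" using r by (intro bmeas_subset[OF \<Psi>_bmeas]) auto
  have t: "bmeas {r..r + h} (\<lambda>t. (left_trace t ^ m - A) * integral {r..t} (\<lambda>s. \<alpha> - left_trace s))"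
    "bmeas {r..r + h} (\<lambda>t. (right_trace t ^ m - B) * integral {r..t} (\<lambda>s. \<beta> - right_trace s))"
    "bmeas {r..r + h} (\<lambda>t. 1 * integral {r..t} (\<lambda>s. right_trace s ^ m - left_trace s ^ m))"
    by (rule bmeas_times_primitive[OF _ _ r(1,3)]; intro bmeas_intros trace_bmeas)+
  have "integral {r..r + h} (balance_bound r) = integral {r..r + h} (\<lambda>t. ((\<Psi> r - \<Psi> t)
      + \<kappa> * ((left_trace t ^ m - A) * integral {r..t} (\<lambda>s. \<alpha> - left_trace s)))
      + \<kappa> * ((right_trace t ^ m - B) * integral {r..t} (\<lambda>s. \<beta> - right_trace s))
      + (B - A) * (1 * integral {r..t} (\<lambda>s. right_trace s ^ m - left_trace s ^ m)))"
    by (simp add: balance_bound_def[abs_def])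
  also have "\<dots> = integral {r..r + h} (\<lambda>t. \<Psi> r - \<Psi> t)
    + integral {r..r + h} (\<lambda>t. \<kappa> * ((left_trace t ^ m - A) * integral {r..t} (\<lambda>s. \<alpha> - left_trace s)))
    + integral {r..r + h} (\<lambda>t. \<kappa> * ((right_trace t ^ m - B) * integral {r..t} (\<lambda>s. \<beta> - right_trace s)))
    + integral {r..r + h} (\<lambda>t. (B - A) * (1 * integral {r..t} (\<lambda>s. right_trace s ^ m - left_trace s ^ m)))"
    by (subst integral_add, (intro bmeas_integrable bmeas_add bmeas_diff bmeas_mult[OF bmeas_const] bmeas_const m t)+)+ (rule refl)
  also have "integral {r..r + h} (\<lambda>t. \<Psi> r - \<Psi> t) = h * \<Psi> r - integral {r..r + h} \<Psi>"
    using r by (subst integral_diff) (auto intro!: bmeas_integrable bmeas_const m)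
  finally show ?thesis by (simp add: triangle_int_def)
qed

text \<open>The functional \<open>\<Psi>\<close> need not be differentiable in time; averaging over \<open>r\<close> makes the difference quotients telescope up to boundary layers, and \<open>|\<Psi>| \<le> 1\<close>.\<close>

lemma \<Psi>_increments:
  assumes h: "0 < h" "h \<le> T"
  shows "2 / h\<^sup>2 * integral {0..T - h} (\<lambda>r. h * \<Psi> r - integral {r..r + h} \<Psi>) \<le> 6"
    and "bmeas {0..T - h} (\<lambda>r. h * \<Psi> r - integral {r..r + h} \<Psi>)"
proof -
  have h': "0 \<le> h" using h by simp
  have 1: "bmeas {0..T - h} \<Psi>" using h by (intro bmeas_subset[OF \<Psi>_bmeas]) auto
  have 2: "bmeas {0..T - h} (\<lambda>r. integral {r..r + h} \<Psi>)"
    by (rule bmeas_continuous[OF integral_of_increments(2)[OF \<Psi>_bmeas h' h(2)]])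
  show "bmeas {0..T - h} (\<lambda>r. h * \<Psi> r - integral {r..r + h} \<Psi>)" by (intro bmeas_diff bmeas_mult bmeas_const 1 2)
  have "integral {0..T - h} (\<lambda>r. h * \<Psi> r - integral {r..r + h} \<Psi>) =
      h * integral {0..T - h} \<Psi> - integral {0..T - h} (\<lambda>r. integral {r..r + h} \<Psi>)"
    by (subst integral_diff) (auto intro!: bmeas_integrable bmeas_mult bmeas_const 1 2)
  moreover have "\<bar>integral {0..T - h} (\<lambda>r. integral {r..r + h} \<Psi>) - h * integral {0..T} \<Psi>\<bar> \<le> 2 * 1 * h\<^sup>2"
    by (rule integral_of_increments_bounds[OF \<Psi>_bmeas h' h(2) \<Psi>_range])
  moreover have "h * \<bar>integral {0..T} \<Psi> - integral {0..T - h} \<Psi>\<bar> \<le> h * (1 * (T - (T - h)))"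
    using h by (intro mult_left_mono primitive_lipschitz[OF \<Psi>_bmeas] \<Psi>_range) auto
  then have "\<bar>h * integral {0..T} \<Psi> - h * integral {0..T - h} \<Psi>\<bar> \<le> h\<^sup>2"
    using h by (simp add: power2_eq_square abs_mult flip: right_diff_distrib)
  ultimately have "integral {0..T - h} (\<lambda>r. h * \<Psi> r - integral {r..r + h} \<Psi>) \<le> 3 * h\<^sup>2" by linarith
  then have "2 / h\<^sup>2 * integral {0..T - h} (\<lambda>r. h * \<Psi> r - integral {r..r + h} \<Psi>) \<le> 2 / h\<^sup>2 * (3 * h\<^sup>2)"
    by (intro mult_left_mono) auto
  then show "2 / h\<^sup>2 * integral {0..T - h} (\<lambda>r. h * \<Psi> r - integral {r..r + h} \<Psi>) \<le> 6" using h by simp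
qed

lemma C01_facts:
  assumes H: "H \<in> C_time_space 0 1 T"
  shows "continuous_on ({0..T} \<times> {0..1}) (\<lambda>(s, u). H s u)"
    and "continuous_on ({0..T} \<times> {0..1}) (\<lambda>(s, u). space_deriv H s u)"
    and "s \<in> {0..T} \<Longrightarrow> u \<in> {0..1} \<Longrightarrow> (H s has_real_derivative space_deriv H s u) (at u within {0..1})"
    and "s \<in> {0..T} \<Longrightarrow> continuous_on {0..1} (space_deriv H s)"
    and "u \<in> {0..1} \<Longrightarrow> continuous_on {0..T} (\<lambda>s. H s u)"
proof -
  have c: "\<forall>i\<le>1. continuous_on ({0..T} \<times> {0..1}) (\<lambda>(s, u). (space_deriv ^^ i) H s u)"
    and d: "\<forall>i<1. \<forall>s\<in>{0..T}. \<forall>u\<in>{0..1}. (\<lambda>v. (space_deriv ^^ i) H s v) differentiable at u within {0..1}"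
    using H by (auto simp: C_time_space_def)
  show c0: "continuous_on ({0..T} \<times> {0..1}) (\<lambda>(s, u). H s u)" using c[rule_format, of 0] by simp
  show c1: "continuous_on ({0..T} \<times> {0..1}) (\<lambda>(s, u). space_deriv H s u)" using c[rule_format, of 1] by simp
  show "(H s has_real_derivative space_deriv H s u) (at u within {0..1})" if "s \<in> {0..T}" "u \<in> {0..1}" for s u
  proof -
    have "H s differentiable at u within {0..1}" using d that by simp
    then show ?thesis
      unfolding space_deriv_def has_real_derivative_iff_has_vector_derivative by (simp add: vector_derivative_works)
  qed
  show "continuous_on {0..1} (space_deriv H s)" if s: "s \<in> {0..T}" for s
  proof -
    have "continuous_on {0..1} (\<lambda>u::real. (s, u))" by (intro continuous_on_Pair continuous_on_const continuous_on_id)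
    moreover have "(\<lambda>u. (s, u)) ` {0..1} \<subseteq> {0..T} \<times> {0..1}" using s by auto
    ultimately have "continuous_on {0..1} (\<lambda>u. case (s, u) of (s, u) \<Rightarrow> space_deriv H s u)"
      by (rule continuous_on_compose2[OF c1])
    then show ?thesis by simp
  qed
  show "continuous_on {0..T} (\<lambda>s. H s u)" if u: "u \<in> {0..1}" for u
  proof -
    have "continuous_on {0..T} (\<lambda>s::real. (s, u))" by (intro continuous_on_Pair continuous_on_const continuous_on_id)
    moreover have "(\<lambda>s. (s, u)) ` {0..T} \<subseteq> {0..T} \<times> {0..1}" using u by auto
    ultimately have "continuous_on {0..T} (\<lambda>s. case (s, u) of (s, u) \<Rightarrow> H s u)"
      by (rule continuous_on_compose2[OF c0])
    then show ?thesis by simp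
  qed
qed

text \<open>After integration by parts this is the pairing of \<open>- \<partial>\<^sub>u w\<^sub>t\<close> with \<open>H\<^sub>r\<close>; the two times are kept apart because in a time window
the test function is frozen at the left end.\<close>

definition flux_pairing :: "(real \<Rightarrow> real \<Rightarrow> real) \<Rightarrow> real \<Rightarrow> real \<Rightarrow> real" where
  "flux_pairing H r t = integral {0..1} (\<lambda>u. w t u * space_deriv H r u) + left_trace t ^ m * H r 0 - right_trace t ^ m * H r 1"

lemma flux_pairing_bmeas:
  assumes H: "H \<in> C_time_space 0 1 T"
  shows "bmeas {0..T} (\<lambda>t. flux_pairing H t t)" and "r \<in> {0..T} \<Longrightarrow> bmeas {0..T} (flux_pairing H r)"
proof -
  note C = C01_facts[OF H]
  have "bmeas {0..T} (\<lambda>t. H t 0)" "bmeas {0..T} (\<lambda>t. H t 1)" by (intro bmeas_continuous C(5); simp)+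
  then show "bmeas {0..T} (\<lambda>t. flux_pairing H t t)"
    unfolding flux_pairing_def w_def
    by (intro bmeas_diff bmeas_add bmeas_mult bmeas_power trace_bmeas space_integral_bmeas[OF C(2)])
  show "bmeas {0..T} (flux_pairing H r)" if "r \<in> {0..T}"
    unfolding flux_pairing_def[abs_def] w_def
    by (intro bmeas_diff bmeas_add bmeas_mult bmeas_power bmeas_const trace_bmeas space_integral_bmeas_fixed C(4) that)
qed

lemma flux_pairing_modulus:
  assumes H: "H \<in> C_time_space 0 1 T" and e: "0 < e"
  obtains d where "0 < d"
    "\<And>r t. r \<in> {0..T} \<Longrightarrow> t \<in> {0..T} \<Longrightarrow> \<bar>t - r\<bar> < d \<Longrightarrow> \<bar>flux_pairing H t t - flux_pairing H r t\<bar> \<le> 3 * e"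
proof -
  note C = C01_facts[OF H]
  have K: "compact ({0..T} \<times> {0..1::real})" by (intro compact_Times compact_Icc)
  obtain d0 where d0: "d0 > 0" "\<And>z z'. z \<in> {0..T} \<times> {0..1} \<Longrightarrow> z' \<in> {0..T} \<times> {0..1} \<Longrightarrow> dist z' z < d0 \<Longrightarrow>
      dist (case z' of (s, u) \<Rightarrow> H s u) (case z of (s, u) \<Rightarrow> H s u) < e"
    using compact_uniformly_continuous[OF C(1) K] e unfolding uniformly_continuous_on_def by metis
  obtain d1 where d1: "d1 > 0" "\<And>z z'. z \<in> {0..T} \<times> {0..1} \<Longrightarrow> z' \<in> {0..T} \<times> {0..1} \<Longrightarrow> dist z' z < d1 \<Longrightarrow>
      dist (case z' of (s, u) \<Rightarrow> space_deriv H s u) (case z of (s, u) \<Rightarrow> space_deriv H s u) < e"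
    using compact_uniformly_continuous[OF C(2) K] e unfolding uniformly_continuous_on_def by metis
  show thesis
  proof (rule that[of "min d0 d1"])
    show "0 < min d0 d1" using d0 d1 by simp
    fix r t assume rt: "r \<in> {0..T}" "t \<in> {0..T}" "\<bar>t - r\<bar> < min d0 d1"
    have h0: "\<bar>H t u - H r u\<bar> \<le> e" if "u \<in> {0..1}" for u
      using d0(2)[of "(r, u)" "(t, u)"] rt that by (auto simp: dist_Pair_Pair dist_real_def)
    have h1: "\<bar>space_deriv H t u - space_deriv H r u\<bar> \<le> e" if "u \<in> {0..1}" for u
      using d1(2)[of "(r, u)" "(t, u)"] rt that by (auto simp: dist_Pair_Pair dist_real_def)
    have m: "bmeas {0..1} (w t)" "bmeas {0..1} (space_deriv H t)" "bmeas {0..1} (space_deriv H r)"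
      by (rule w_slice[OF rt(2)], rule bmeas_continuous[OF C(4)[OF rt(2)]], rule bmeas_continuous[OF C(4)[OF rt(1)]])
    have "integral {0..1} (\<lambda>u. w t u * space_deriv H t u) - integral {0..1} (\<lambda>u. w t u * space_deriv H r u) =
        integral {0..1} (\<lambda>u. w t u * (space_deriv H t u - space_deriv H r u))"
      unfolding right_diff_distrib by (intro integral_diff[symmetric] bmeas_integrable bmeas_mult m)
    also have "\<bar>\<dots>\<bar> \<le> (1 * e) * (1 - 0)"
    proof (rule bmeas_integral_abs_le)
      fix u :: real assume u: "u \<in> {0..1}"
      show "\<bar>w t u * (space_deriv H t u - space_deriv H r u)\<bar> \<le> 1 * e"
        unfolding abs_mult using w_range[OF rt(2) u] h1[OF u] by (intro mult_mono) auto
    qed (intro bmeas_mult bmeas_diff m, simp)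
    finally have 1: "\<bar>integral {0..1} (\<lambda>u. w t u * space_deriv H t u) - integral {0..1} (\<lambda>u. w t u * space_deriv H r u)\<bar> \<le> e"
      by simp
    have 2: "\<bar>left_trace t ^ m * H t 0 - left_trace t ^ m * H r 0\<bar> \<le> e"
    proof -
      have "\<bar>left_trace t ^ m\<bar> * \<bar>H t 0 - H r 0\<bar> \<le> 1 * e" using trace_power_range[of t] h0[of 0] by (intro mult_mono) auto
      then show ?thesis by (simp add: abs_mult flip: right_diff_distrib)
    qed
    have 3: "\<bar>right_trace t ^ m * H t 1 - right_trace t ^ m * H r 1\<bar> \<le> e"
    proof -
      have "\<bar>right_trace t ^ m\<bar> * \<bar>H t 1 - H r 1\<bar> \<le> 1 * e" using trace_power_range[of t] h0[of 1] by (intro mult_mono) auto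
      then show ?thesis by (simp add: abs_mult flip: right_diff_distrib)
    qed
    have "\<bar>(a + b - c) - (a' + b' - c')\<bar> \<le> 3 * e" if "\<bar>a - a'\<bar> \<le> e" "\<bar>b - b'\<bar> \<le> e" "\<bar>c - c'\<bar> \<le> e" for a a' b b' c c' :: real
      using that by linarith
    from this[OF 1 2 3] show "\<bar>flux_pairing H t t - flux_pairing H r t\<bar> \<le> 3 * e" unfolding flux_pairing_def .
  qed
qed

lemma square_norm_bmeas:
  assumes H: "H \<in> C_time_space 0 1 T"
  shows "bmeas {0..T} (\<lambda>t. integral {0..1} (\<lambda>u. (H t u)\<^sup>2))"
proof -
  have "continuous_on ({0..T} \<times> {0..1}) (\<lambda>z. ((\<lambda>(s, u). H s u) z)\<^sup>2)"
    by (intro continuous_on_power C01_facts(1)[OF H])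
  then have "continuous_on ({0..T} \<times> {0..1}) (\<lambda>(s, u). (H s u)\<^sup>2)" by (simp add: case_prod_unfold)
  from space_integral_bmeas[OF this, of 0] show ?thesis by simp
qed

text \<open>The energy step is applied with the test function \<open>H\<^sub>r\<close> and integrated over the left end \<open>r\<close> of the window. The error \<open>2 C h\<close>
stems from the boundary layers in time, and \<open>e T\<close> from freezing \<open>H\<close> at time \<open>r\<close>.\<close>

lemma averaged_energy_inequality:
  assumes H: "H \<in> C_time_space 0 1 T" and h: "0 < h" "h \<le> T"
    and C: "\<And>t. t \<in> {0..T} \<Longrightarrow> \<bar>flux_pairing H t t\<bar> \<le> C"
    and e: "0 \<le> e" "\<And>r t. r \<in> {0..T} \<Longrightarrow> t \<in> {0..T} \<Longrightarrow> \<bar>t - r\<bar> \<le> h \<Longrightarrow> \<bar>flux_pairing H t t - flux_pairing H r t\<bar> \<le> e"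
  shows "integral {0..T} (\<lambda>t. flux_pairing H t t) - 2 * C * h - e * T \<le>
    6 + \<kappa> * triangle_mean T (\<lambda>t. left_trace t ^ m - A) (\<lambda>t. \<alpha> - left_trace t) h
    + \<kappa> * triangle_mean T (\<lambda>t. right_trace t ^ m - B) (\<lambda>t. \<beta> - right_trace t) h
    + (B - A) * triangle_mean T (\<lambda>_. 1) (\<lambda>t. right_trace t ^ m - left_trace t ^ m) h
    + 1 / 4 * integral {0..T} (\<lambda>t. integral {0..1} (\<lambda>u. (H t u)\<^sup>2))"
proof -
  let ?Z = "\<lambda>t. flux_pairing H t t" and ?N = "\<lambda>t. integral {0..1} (\<lambda>u. (H t u)\<^sup>2)"
  let ?t0 = "triangle_int (\<lambda>t. left_trace t ^ m - A) (\<lambda>t. \<alpha> - left_trace t) h"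
  let ?t1 = "triangle_int (\<lambda>t. right_trace t ^ m - B) (\<lambda>t. \<beta> - right_trace t) h"
  let ?t2 = "triangle_int (\<lambda>_. 1) (\<lambda>t. right_trace t ^ m - left_trace t ^ m) h"
  let ?p = "\<lambda>r. h * \<Psi> r - integral {r..r + h} \<Psi>"
  note Cf = C01_facts[OF H]
  have h': "0 \<le> h" using h by simp
  note Z = flux_pairing_bmeas(1)[OF H] and N = square_norm_bmeas[OF H]
  have N': "bmeas {0..T - h} ?N" using h by (intro bmeas_subset[OF N]) auto
  have ti: "bmeas {0..T - h} ?t0" "bmeas {0..T - h} ?t1" "bmeas {0..T - h} ?t2"
    by (intro bmeas_triangle_int bmeas_intros trace_bmeas h' h)+
  note pm = \<Psi>_increments(2)[OF h]
  have IZ: "bmeas {0..T - h} (\<lambda>r. integral {r..r + h} ?Z)"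
    by (rule bmeas_continuous[OF integral_of_increments(2)[OF Z h' h(2)]])
  \<comment> \<open>The right-hand side of the energy step, split into the part with \<open>\<Psi>\<close>, the triangle averages and the norm of \<open>H\<^sub>r\<close>.\<close>
  define R where "R r = 2 / h\<^sup>2 * ?p r + \<kappa> * (2 / h\<^sup>2 * ?t0 r) + \<kappa> * (2 / h\<^sup>2 * ?t1 r) + (B - A) * (2 / h\<^sup>2 * ?t2 r) + 1 / 4 * ?N r" for r
  have Rm: "bmeas {0..T - h} R" unfolding R_def by (intro bmeas_add bmeas_mult bmeas_const pm ti N')
  have step: "integral {r..r + h} ?Z / h - e \<le> R r" if r: "r \<in> {0..T - h}" for r
  proof -
    have r': "0 \<le> r" "r + h \<le> T" "r \<in> {0..T}" using r h by auto
    have sub: "bmeas {r..r + h} ?Z" "bmeas {r..r + h} (flux_pairing H r)"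
      using r' by (auto intro!: bmeas_subset[OF Z] bmeas_subset[OF flux_pairing_bmeas(2)[OF H r'(3)]])
    have "integral {r..r + h} ?Z - integral {r..r + h} (flux_pairing H r) =
        integral {r..r + h} (\<lambda>t. ?Z t - flux_pairing H r t)"
      by (intro integral_diff[symmetric] bmeas_integrable sub)
    also have "\<dots> \<le> integral {r..r + h} (\<lambda>t. e)"
    proof (intro integral_le bmeas_integrable bmeas_diff sub bmeas_const)
      fix t assume t: "t \<in> {r..r + h}"
      then show "?Z t - flux_pairing H r t \<le> e"
        using e(2)[of r t] r' by (auto simp: abs_le_iff)
    qed
    also have "\<dots> = h * e" using h by simp
    finally have "integral {r..r + h} ?Z - h * e \<le> integral {r..r + h} (flux_pairing H r)" by simp
    then have "(integral {r..r + h} ?Z - h * e) / h \<le> integral {r..r + h} (flux_pairing H r) / h"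
      using h by (intro divide_right_mono) auto
    then have "integral {r..r + h} ?Z / h - e \<le> integral {r..r + h} (flux_pairing H r) / h"
      using h by (simp add: diff_divide_distrib)
    also have "\<dots> \<le> 2 / h\<^sup>2 * integral {r..r + h} (balance_bound r) + 1 / 4 * ?N r"
      unfolding flux_pairing_def[abs_def] by (rule energy_step[OF r'(1) h(1) r'(2) Cf(3)[OF r'(3)] Cf(4)[OF r'(3)]])
    also have "\<dots> = R r"
      unfolding integral_balance_bound[OF r'(1) h' r'(2)] R_def by (simp add: distrib_left mult_ac)
    finally show ?thesis .
  qed
  have "integral {0..T - h} (\<lambda>r. integral {r..r + h} ?Z / h - e) \<le> integral {0..T - h} R"
    by (intro integral_le bmeas_integrable bmeas_diff bmeas_divide_const bmeas_const IZ Rm step)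
  also have "integral {0..T - h} R = 2 / h\<^sup>2 * integral {0..T - h} ?p + \<kappa> * (2 / h\<^sup>2 * integral {0..T - h} ?t0)
      + \<kappa> * (2 / h\<^sup>2 * integral {0..T - h} ?t1) + (B - A) * (2 / h\<^sup>2 * integral {0..T - h} ?t2) + 1 / 4 * integral {0..T - h} ?N"
  proof -
    have i: "(\<lambda>r. c * f r) integrable_on {0..T - h}" if "bmeas {0..T - h} f" for c f
      using that by (intro bmeas_integrable bmeas_mult bmeas_const)
    have "integral {0..T - h} R = integral {0..T - h} (\<lambda>r. 2 / h\<^sup>2 * ?p r) + integral {0..T - h} (\<lambda>r. \<kappa> * (2 / h\<^sup>2 * ?t0 r))
      + integral {0..T - h} (\<lambda>r. \<kappa> * (2 / h\<^sup>2 * ?t1 r)) + integral {0..T - h} (\<lambda>r. (B - A) * (2 / h\<^sup>2 * ?t2 r))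
      + integral {0..T - h} (\<lambda>r. 1 / 4 * ?N r)"
      unfolding R_def
      by (subst integral_add, (intro bmeas_integrable bmeas_add bmeas_mult[OF bmeas_const] pm ti N')+)+ (rule refl)
    then show ?thesis by (simp only: integral_mult_right)
  qed
  also have "2 / h\<^sup>2 * integral {0..T - h} ?p \<le> 6" by (rule \<Psi>_increments(1)[OF h])
  also have "integral {0..T - h} ?N \<le> integral {0..T} ?N"
  proof (intro integral_subset_le bmeas_integrable N N' ballI)
    fix t assume t: "t \<in> {0..T}"
    have "continuous_on {0..1} (H t)" using Cf(3)[OF t] by (rule DERIV_continuous_on)
    then have "bmeas {0..1} (\<lambda>u. (H t u)\<^sup>2)" by (intro bmeas_power bmeas_continuous)
    then show "0 \<le> ?N t" by (intro integral_nonneg bmeas_integrable) auto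
  qed (use h in auto)
  finally have up: "integral {0..T - h} (\<lambda>r. integral {r..r + h} ?Z / h - e) \<le> 6
      + \<kappa> * triangle_mean T (\<lambda>t. left_trace t ^ m - A) (\<lambda>t. \<alpha> - left_trace t) h
      + \<kappa> * triangle_mean T (\<lambda>t. right_trace t ^ m - B) (\<lambda>t. \<beta> - right_trace t) h
      + (B - A) * triangle_mean T (\<lambda>_. 1) (\<lambda>t. right_trace t ^ m - left_trace t ^ m) h
      + 1 / 4 * integral {0..T} ?N"
    by (simp add: triangle_mean_def)
  have "integral {0..T - h} (\<lambda>r. integral {r..r + h} ?Z / h - e) =
      integral {0..T - h} (\<lambda>r. integral {r..r + h} ?Z) / h - (T - h) * e"
    using h by (subst integral_diff) (auto intro!: bmeas_integrable bmeas_divide_const bmeas_const IZ)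
  moreover have "integral {0..T} ?Z - 2 * C * h \<le> integral {0..T - h} (\<lambda>r. integral {r..r + h} ?Z) / h"
  proof -
    have "\<bar>integral {0..T - h} (\<lambda>r. integral {r..r + h} ?Z) - h * integral {0..T} ?Z\<bar> \<le> 2 * C * h\<^sup>2"
      by (rule integral_of_increments_bounds[OF Z h' h(2) C])
    then have "h * integral {0..T} ?Z - 2 * C * h\<^sup>2 \<le> integral {0..T - h} (\<lambda>r. integral {r..r + h} ?Z)" by linarith
    then have "(h * integral {0..T} ?Z - 2 * C * h\<^sup>2) / h \<le> integral {0..T - h} (\<lambda>r. integral {r..r + h} ?Z) / h"
      using h by (intro divide_right_mono) auto
    then show ?thesis using h by (simp add: diff_divide_distrib power2_eq_square)
  qed
  moreover have "(T - h) * e \<le> e * T" using e(1) h by (simp add: algebra_simps)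
  ultimately show ?thesis using up by linarith
qed

text \<open>The limit \<open>h \<rightarrow> 0\<close> of the averaged inequality. The two integrals multiplied by \<open>\<kappa>\<close> are nonpositive: up to sign they are the boundary dissipation, which the energy still has to use up.\<close>

lemma energy_inequality:
  assumes H: "H \<in> C_time_space 0 1 T"
  shows "integral {0..T} (\<lambda>t. flux_pairing H t t) \<le> 6 + T
    + \<kappa> * integral {0..T} (\<lambda>t. (left_trace t ^ m - A) * (\<alpha> - left_trace t))
    + \<kappa> * integral {0..T} (\<lambda>t. (right_trace t ^ m - B) * (\<beta> - right_trace t))
    + 1 / 4 * integral {0..T} (\<lambda>t. integral {0..1} (\<lambda>u. (H t u)\<^sup>2))"
    (is "?I \<le> 6 + T + \<kappa> * ?a + \<kappa> * ?b + 1 / 4 * ?N")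
proof -
  have g2: "bmeas {0..T} (\<lambda>t. right_trace t ^ m - left_trace t ^ m)" by (intro bmeas_intros trace_bmeas)
  have "\<bar>integral {0..T} (\<lambda>t. 1 * (right_trace t ^ m - left_trace t ^ m))\<bar> \<le> 1 * (T - 0)"
  proof (rule bmeas_integral_abs_le)
    fix t show "\<bar>1 * (right_trace t ^ m - left_trace t ^ m)\<bar> \<le> 1" using trace_power_range[of t] by (simp add: abs_le_iff)
  qed (use g2 T in auto)
  then have "\<bar>B - A\<bar> * \<bar>integral {0..T} (\<lambda>t. 1 * (right_trace t ^ m - left_trace t ^ m))\<bar> \<le> 1 * T"
    using AB_range by (intro mult_mono) auto
  then have last: "(B - A) * integral {0..T} (\<lambda>t. 1 * (right_trace t ^ m - left_trace t ^ m)) \<le> T"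
    by (simp add: abs_le_iff flip: abs_mult)
  obtain C where C: "\<And>t. t \<in> {0..T} \<Longrightarrow> \<bar>flux_pairing H t t\<bar> \<le> C"
    using bmeas_bound[OF flux_pairing_bmeas(1)[OF H]] by blast
  define h where "h n = T / real (Suc n)" for n
  have h: "0 < h n" "h n \<le> T" for n using T by (auto simp: h_def field_simps)
  have h0: "h \<longlonglongrightarrow> 0"
    using tendsto_mult[OF tendsto_const[of T] LIMSEQ_inverse_real_of_nat] by (simp add: h_def[abs_def] divide_inverse)
  have eps: "?I \<le> (6 + T + \<kappa> * ?a + \<kappa> * ?b + 1 / 4 * ?N) + e" if e: "0 < e" for e
  proof -
    \<comment> \<open>The pairing consists of three terms, each of which changes by at most \<open>\<epsilon>\<close> when \<open>H\<close> is frozen.\<close>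
    define \<epsilon> where "\<epsilon> = e / (3 * T)"
    have \<epsilon>: "0 < \<epsilon>" using e T by (simp add: \<epsilon>_def)
    obtain d where d: "0 < d" "\<And>r t. r \<in> {0..T} \<Longrightarrow> t \<in> {0..T} \<Longrightarrow> \<bar>t - r\<bar> < d \<Longrightarrow>
        \<bar>flux_pairing H t t - flux_pairing H r t\<bar> \<le> 3 * \<epsilon>"
      using flux_pairing_modulus[OF H \<epsilon>] by metis
    have small: "\<forall>\<^sub>F n in sequentially. h n < d" using h0 d(1) by (rule order_tendstoD)
    let ?R = "\<lambda>n. 6 + \<kappa> * triangle_mean T (\<lambda>t. left_trace t ^ m - A) (\<lambda>t. \<alpha> - left_trace t) (h n)
      + \<kappa> * triangle_mean T (\<lambda>t. right_trace t ^ m - B) (\<lambda>t. \<beta> - right_trace t) (h n)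
      + (B - A) * triangle_mean T (\<lambda>_. 1) (\<lambda>t. right_trace t ^ m - left_trace t ^ m) (h n) + 1 / 4 * ?N"
    have ev: "\<forall>\<^sub>F n in sequentially. ?I - 2 * C * h n - (3 * \<epsilon>) * T \<le> ?R n"
      using small
    proof eventually_elim
      case (elim n)
      show ?case
      proof (rule averaged_energy_inequality[OF H h C])
        show "0 \<le> 3 * \<epsilon>" using \<epsilon> by simp
        show "\<bar>flux_pairing H t t - flux_pairing H r t\<bar> \<le> 3 * \<epsilon>"
          if "r \<in> {0..T}" "t \<in> {0..T}" "\<bar>t - r\<bar> \<le> h n" for r t
          using that elim by (intro d(2)) auto
      qed
    qed
    have l: "(\<lambda>n. ?I - 2 * C * h n - (3 * \<epsilon>) * T) \<longlonglongrightarrow> ?I - 2 * C * 0 - (3 * \<epsilon>) * T"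
      by (intro tendsto_intros h0)
    have r: "?R \<longlonglongrightarrow> 6 + \<kappa> * ?a + \<kappa> * ?b + (B - A) * integral {0..T} (\<lambda>t. 1 * (right_trace t ^ m - left_trace t ^ m)) + 1 / 4 * ?N"
      by (intro tendsto_add tendsto_mult tendsto_const triangle_mean_tendsto h h0 bmeas_diff bmeas_const bmeas_power trace_bmeas)
    have "?I - 2 * C * 0 - (3 * \<epsilon>) * T \<le> 6 + \<kappa> * ?a + \<kappa> * ?b + (B - A) * integral {0..T} (\<lambda>t. 1 * (right_trace t ^ m - left_trace t ^ m)) + 1 / 4 * ?N"
      by (rule tendsto_le[OF sequentially_bot r l ev])
    moreover have "(3 * \<epsilon>) * T = e" using T by (simp add: \<epsilon>_def)
    ultimately show ?thesis using last by linarith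
  qed
  show ?thesis by (rule field_le_epsilon) (rule eps)
qed

lemma power_diff_P_poly: "x ^ m - \<gamma> ^ m = P_poly m \<gamma> x * (x - \<gamma>)"
proof -
  have "x ^ m - \<gamma> ^ m = (x - \<gamma>) * (\<Sum>i<m. \<gamma> ^ (m - Suc i) * x ^ i)" by (rule power_diff_sumr2)
  then show ?thesis by (simp add: P_poly_def mult.commute)
qed

text \<open>With \<open>y = \<rho>(0) - \<alpha>\<close> and \<open>z = H(0)\<close>, the boundary dissipation \<open>\<kappa> P y\<^sup>2\<close> pays for the boundary term \<open>P y z\<close> of the energy up to
a multiple of \<open>P z\<^sup>2 / \<kappa>\<close>, the weight in the energy norm.\<close>

lemma boundary_young:
  assumes "0 \<le> P" shows "- (P * y * z) - \<kappa> * (P * y * y) \<le> 1 / 4 * (P / \<kappa> * z\<^sup>2)"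
proof -
  have "0 \<le> P / (4 * \<kappa>) * (z + 2 * \<kappa> * y)\<^sup>2" using assms \<kappa> by simp
  also have "P / (4 * \<kappa>) * (z + 2 * \<kappa> * y)\<^sup>2 = 1 / 4 * (P / \<kappa> * z\<^sup>2) + P * y * z + \<kappa> * (P * y * y)"
    using \<kappa> by (simp add: power2_eq_square field_simps)
  finally show ?thesis by simp
qed

text \<open>The boundary terms of the energy and of the energy inequality are compared for each time separately; what remains of
the two is bounded by a quarter of the boundary part of the energy norm.\<close>

lemma energy_bound:
  assumes H: "H \<in> C_time_space 0 1 T"
  shows "energy_linear T \<alpha> \<beta> m (extend m \<rho>) H - 1 / 4 * energy_norm T \<alpha> \<beta> m \<kappa> (extend m \<rho>) H \<le> 6 + T"
proof -
  note C = C01_facts[OF H]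
  let ?V = "\<lambda>t. integral {0..1} (\<lambda>u. w t u * space_deriv H t u)"
  let ?N = "\<lambda>t. integral {0..1} (\<lambda>u. (H t u)\<^sup>2)"
  let ?P0 = "\<lambda>t. P_poly m \<alpha> (left_trace t)" and ?P1 = "\<lambda>t. P_poly m \<beta> (right_trace t)"
  have Hb: "bmeas {0..T} (\<lambda>t. H t 0)" "bmeas {0..T} (\<lambda>t. H t 1)" by (intro bmeas_continuous C(5); simp)+
  have V: "bmeas {0..T} ?V" unfolding w_def by (rule space_integral_bmeas[OF C(2)])
  note N = square_norm_bmeas[OF H]
  have Tt: "T \<in> {0..T}" using T by simp
  have lin1: "L2_inner_time T (\<lambda>s u. extend m \<rho> s u ^ m) (space_deriv H) = integral {0..T} ?V"
  proof -
    have "L2_inner (\<lambda>u. extend m \<rho> s u ^ m) (space_deriv H s) = ?V s" if s: "s \<in> {0..T}" for s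
    proof -
      have wm: "bmeas {0..1} (\<lambda>u. w s u * space_deriv H s u)"
        by (intro bmeas_mult w_slice s bmeas_continuous C(4))
      have "{0, 1::real} \<in> null_sets lebesgue" by (simp add: null_sets_completionI)
      then have "AE u in lebesgue. u \<notin> {0, 1::real}" by (rule AE_not_in)
      then have "AE u in lebesgue. u \<in> {0..1} \<longrightarrow> w s u * space_deriv H s u = extend m \<rho> s u ^ m * space_deriv H s u"
        by eventually_elim (auto simp: extend_def w_def)
      then have ae: "AE u in lebesgue_on {0..1}. w s u * space_deriv H s u = extend m \<rho> s u ^ m * space_deriv H s u"
        by (subst AE_restrict_space_iff) auto
      have "(\<lambda>u. extend m \<rho> s u ^ m * space_deriv H s u) \<in> borel_measurable (lebesgue_on {0..1})"
      proof (rule bmeas_limit_AE[OF bmeas_measurable[OF wm]])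
        show "AE u in lebesgue_on {0..1}. (\<lambda>n. w s u * space_deriv H s u) \<longlonglongrightarrow> extend m \<rho> s u ^ m * space_deriv H s u"
          using ae
        proof eventually_elim
          case (elim u)
          show ?case unfolding elim by (rule tendsto_const)
        qed
      qed simp
      then have "L2_inner (\<lambda>u. extend m \<rho> s u ^ m) (space_deriv H s) = (\<integral>u. w s u * space_deriv H s u \<partial>lebesgue_on {0..1})"
        unfolding L2_inner_def using ae bmeas_measurable[OF wm] by (intro integral_cong_AE) (auto elim: eventually_mono)
      then show ?thesis by (simp add: bmeas_integral_eq[OF wm])
    qed
    then have "L2_inner_time T (\<lambda>s u. extend m \<rho> s u ^ m) (space_deriv H) = (\<integral>s. ?V s \<partial>lebesgue_on {0..T})"
      unfolding L2_inner_time_def by (intro Bochner_Integration.integral_cong) auto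
    then show ?thesis by (simp add: bmeas_integral_eq[OF V])
  qed
  have lm: "bmeas {0..T} (\<lambda>s. \<alpha> ^ m * H s 0 - \<beta> ^ m * H s 1)" by (intro bmeas_intros Hb)
  have lin: "energy_linear T \<alpha> \<beta> m (extend m \<rho>) H = integral {0..T} ?V + integral {0..T} (\<lambda>s. A * H s 0 - B * H s 1)"
    unfolding energy_linear_def lin1 bmeas_integral_eq[OF lm] by (simp add: A_def B_def)
  have norm1: "L2_inner_time T H H = integral {0..T} ?N"
  proof -
    have "L2_inner (H s) (H s) = ?N s" if s: "s \<in> {0..T}" for s
    proof -
      have "bmeas {0..1} (H s)" using C(3)[OF s] by (intro bmeas_continuous DERIV_continuous_on)
      then have "bmeas {0..1} (\<lambda>u. H s u * H s u)" by (intro bmeas_mult)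
      then show ?thesis by (simp add: L2_inner_def bmeas_integral_eq power2_eq_square)
    qed
    then have "L2_inner_time T H H = (\<integral>s. ?N s \<partial>lebesgue_on {0..T})"
      unfolding L2_inner_time_def by (intro Bochner_Integration.integral_cong) auto
    then show ?thesis by (simp add: bmeas_integral_eq[OF N])
  qed
  have P0: "bmeas {0..T} ?P0" "bmeas {0..T} ?P1" unfolding P_poly_def by (intro bmeas_intros trace_bmeas)+
  have bdm: "bmeas {0..T} (\<lambda>s. ?P0 s / \<kappa> * (H s 0)\<^sup>2 + ?P1 s / \<kappa> * (H s 1)\<^sup>2)" by (intro bmeas_intros P0 Hb)
  have norm2: "(\<integral>s. P_poly m \<alpha> (extend m \<rho> s 0) / \<kappa> * (H s 0)\<^sup>2 + P_poly m \<beta> (extend m \<rho> s 1) / \<kappa> * (H s 1)\<^sup>2 \<partial>lebesgue_on {0..T})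
      = integral {0..T} (\<lambda>s. ?P0 s / \<kappa> * (H s 0)\<^sup>2 + ?P1 s / \<kappa> * (H s 1)\<^sup>2)"
  proof (rule integral_extend[OF Tt, where F = "\<lambda>s x y. P_poly m \<alpha> x / \<kappa> * (H s 0)\<^sup>2 + P_poly m \<beta> y / \<kappa> * (H s 1)\<^sup>2"])
    show "bmeas {0..T} (\<lambda>s. ?P0 s / \<kappa> * (H s 0)\<^sup>2 + ?P1 s / \<kappa> * (H s 1)\<^sup>2)" by (rule bdm)
    show "(\<lambda>s. P_poly m \<alpha> (extend m \<rho> s 0) / \<kappa> * (H s 0)\<^sup>2 + P_poly m \<beta> (extend m \<rho> s 1) / \<kappa> * (H s 1)\<^sup>2)
        \<in> borel_measurable (lebesgue_on {0..T})"
      unfolding P_poly_def using extend_measurable Hb[THEN bmeas_measurable] by measurable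
  qed
  have fp: "integral {0..T} (\<lambda>t. flux_pairing H t t) = integral {0..T} ?V + integral {0..T} (\<lambda>t. left_trace t ^ m * H t 0 - right_trace t ^ m * H t 1)"
    unfolding flux_pairing_def add_diff_eq[symmetric]
    by (intro integral_add bmeas_integrable V bmeas_intros trace_bmeas Hb)
  let ?f0 = "\<lambda>t. (left_trace t ^ m - A) * (\<alpha> - left_trace t)" and ?f1 = "\<lambda>t. (right_trace t ^ m - B) * (\<beta> - right_trace t)"
  let ?b = "\<lambda>t. left_trace t ^ m * H t 0 - right_trace t ^ m * H t 1" and ?a = "\<lambda>t. A * H t 0 - B * H t 1"
  have m: "bmeas {0..T} ?f0" "bmeas {0..T} ?f1" "bmeas {0..T} ?b" "bmeas {0..T} ?a"
    by (intro bmeas_intros trace_bmeas Hb)+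
  have "integral {0..T} (\<lambda>t. \<kappa> * ?f0 t + \<kappa> * ?f1 t + (?a t - ?b t)) \<le>
      integral {0..T} (\<lambda>s. 1 / 4 * (?P0 s / \<kappa> * (H s 0)\<^sup>2 + ?P1 s / \<kappa> * (H s 1)\<^sup>2))"
  proof (intro integral_le bmeas_integrable bmeas_mult[OF bmeas_const] bmeas_add bmeas_diff[OF m(4) m(3)] m(1,2))
    show "bmeas {0..T} (\<lambda>s. ?P0 s / \<kappa> * (H s 0)\<^sup>2)" "bmeas {0..T} (\<lambda>s. ?P1 s / \<kappa> * (H s 1)\<^sup>2)"
      by (intro bmeas_intros P0 Hb)+
    fix t
    have 0: "0 \<le> ?P0 t" "0 \<le> ?P1 t"
      unfolding P_poly_def using \<alpha> \<beta> trace_range[of t] by (auto intro!: sum_nonneg mult_nonneg_nonneg)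
    have "- (?P0 t * (left_trace t - \<alpha>) * H t 0) - \<kappa> * (?P0 t * (left_trace t - \<alpha>) * (left_trace t - \<alpha>)) \<le> 1 / 4 * (?P0 t / \<kappa> * (H t 0)\<^sup>2)"
      by (rule boundary_young[OF 0(1)])
    moreover have "- (?P1 t * (right_trace t - \<beta>) * (- H t 1)) - \<kappa> * (?P1 t * (right_trace t - \<beta>) * (right_trace t - \<beta>)) \<le> 1 / 4 * (?P1 t / \<kappa> * (- H t 1)\<^sup>2)"
      by (rule boundary_young[OF 0(2)])
    moreover have "\<kappa> * ?f0 t + \<kappa> * ?f1 t + (?a t - ?b t) =
        (- ((left_trace t ^ m - A) * H t 0) - \<kappa> * ((left_trace t ^ m - A) * (left_trace t - \<alpha>)))
        + (- ((right_trace t ^ m - B) * (- H t 1)) - \<kappa> * ((right_trace t ^ m - B) * (right_trace t - \<beta>)))"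
      by (simp add: algebra_simps)
    ultimately show "\<kappa> * ?f0 t + \<kappa> * ?f1 t + (?a t - ?b t) \<le> 1 / 4 * (?P0 t / \<kappa> * (H t 0)\<^sup>2 + ?P1 t / \<kappa> * (H t 1)\<^sup>2)"
      unfolding A_def B_def power_diff_P_poly by simp
  qed
  moreover have "integral {0..T} (\<lambda>t. \<kappa> * ?f0 t + \<kappa> * ?f1 t + (?a t - ?b t)) =
      \<kappa> * integral {0..T} ?f0 + \<kappa> * integral {0..T} ?f1 + (integral {0..T} ?a - integral {0..T} ?b)"
  proof -
    have "integral {0..T} (\<lambda>t. \<kappa> * ?f0 t + \<kappa> * ?f1 t + (?a t - ?b t)) =
        integral {0..T} (\<lambda>t. \<kappa> * ?f0 t) + integral {0..T} (\<lambda>t. \<kappa> * ?f1 t) + integral {0..T} (\<lambda>t. ?a t - ?b t)"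
      by (subst integral_add, (intro bmeas_integrable bmeas_add bmeas_mult[OF bmeas_const] bmeas_diff[OF m(4) m(3)] m(1,2))+)+ (rule refl)
    also have "integral {0..T} (\<lambda>t. ?a t - ?b t) = integral {0..T} ?a - integral {0..T} ?b"
      by (intro integral_diff bmeas_integrable m)
    finally show ?thesis by (simp only: integral_mult_right)
  qed
  ultimately have bdry: "\<kappa> * integral {0..T} ?f0 + \<kappa> * integral {0..T} ?f1 + (integral {0..T} ?a - integral {0..T} ?b)
      \<le> 1 / 4 * integral {0..T} (\<lambda>s. ?P0 s / \<kappa> * (H s 0)\<^sup>2 + ?P1 s / \<kappa> * (H s 1)\<^sup>2)"
    by (simp only: integral_mult_right)
  have "v + a - 1 / 4 * (n + p) \<le> c" if "k0 + k1 + (a - b) \<le> 1 / 4 * p" "v + b \<le> c + k0 + k1 + 1 / 4 * n"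
    for v a b c n p k0 k1 :: real
    using that by (simp add: distrib_left)
  from this[OF bdry energy_inequality[OF H, unfolded fp]] show ?thesis
    unfolding lin energy_norm_def norm1 norm2 .
qed

lemma energy_le: "energy T \<alpha> \<beta> m \<kappa> (1 / 4) (extend m \<rho>) \<le> ereal (6 + T)"
  unfolding energy_def by (intro SUP_least) (simp only: ereal_less_eq energy_bound)

end

theorem proposition5p3:
  fixes \<alpha> \<beta> T a \<theta> :: real and g :: "real \<Rightarrow> real" and m :: nat
  assumes "0 < \<alpha>" "\<alpha> < 1" "0 < \<beta>" "\<beta> < 1" and "0 < T" and "1 < a" "a < 2" and "\<theta> = 1"
    and "g \<in> borel_measurable (lebesgue_on {0..1})" and "\<forall>u\<in>{0..1}. g u \<in> {0..1}"
    and "m \<ge> 1"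
  shows "\<exists>M\<^sub>0 c :: real. c > 0 \<and>
    (\<forall>\<kappa>>0. \<forall>\<rho> \<mu> P Q.
       weak_solution_Robin T \<alpha> \<beta> m \<kappa> g \<rho> \<and>
       (\<forall>n\<ge>2. set_pmf (\<mu> n) \<subseteq> configs n) \<and>
       associated \<mu> g \<and>
       (\<forall>n\<ge>2. markov_law T (configs n)
          (\<lambda>f \<eta>. (real n)\<^sup>2 * generator \<alpha> \<beta> \<kappa> a \<theta> m n f \<eta>) (\<mu> n) (P n)) \<and>
       limit_point_laws (skorokhod_topology T) (\<lambda>n. empirical_law T n (P n)) Q
       \<longrightarrow> (\<integral>\<^sup>+\<pi>. e2ennreal (energy T \<alpha> \<beta> m \<kappa> c (extend m \<rho>)) \<partial>Q) \<le> ennreal M\<^sub>0)"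
proof (rule exI[of _ "6 + T"], rule exI[of _ "1 / 4"], intro conjI allI impI)
  fix \<kappa> :: real and \<rho> :: "real \<Rightarrow> real \<Rightarrow> real" and \<mu> P Q
  assume \<kappa>: "0 < \<kappa>" and hyps: "weak_solution_Robin T \<alpha> \<beta> m \<kappa> g \<rho> \<and>
       (\<forall>n\<ge>2. set_pmf (\<mu> n) \<subseteq> configs n) \<and>
       associated \<mu> g \<and>
       (\<forall>n\<ge>2. markov_law T (configs n)
          (\<lambda>f \<eta>. (real n)\<^sup>2 * generator \<alpha> \<beta> \<kappa> a \<theta> m n f \<eta>) (\<mu> n) (P n)) \<and>
       limit_point_laws (skorokhod_topology T) (\<lambda>n. empirical_law T n (P n)) Q"
  interpret robin_solution T \<alpha> \<beta> \<kappa> m g \<rho>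
    by unfold_locales (use assms \<kappa> hyps in auto)
  interpret Q: prob_space Q using hyps by (simp add: limit_point_laws_def)
  have "e2ennreal (energy T \<alpha> \<beta> m \<kappa> (1 / 4) (extend m \<rho>)) \<le> e2ennreal (ereal (6 + T))"
    by (rule e2ennreal_mono[OF energy_le])
  also have "\<dots> = ennreal (6 + T)" by (rule e2ennreal_ereal)
  finally show "(\<integral>\<^sup>+\<pi>. e2ennreal (energy T \<alpha> \<beta> m \<kappa> (1 / 4) (extend m \<rho>)) \<partial>Q) \<le> ennreal (6 + T)"
    by (simp add: Q.emeasure_space_1)
qed simp

end
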